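(* For every partition $\lambda$ of $n$ there is an isomorphism of left $RS_n$-modules $\operatorname{Ind}(\lambda)\cong C(\lambda)$.
   Context: $R$ is the localization of $\mathbb Z$ at a prime $(p)$. Jucys–Murphy elements $L_1=0$, $L_k=\sum_{j<k}(j,k)$. $\operatorname{GZ}_n$ is the (commutative) $R$-subalgebra of $RS_n$ generated by $L_1,\dots,L_n$. Content $r_t(k)=j-i$ if $k$ is in node $[i,j]$; $t^\lambda$ is the $\lambda$-tableau with $1,\dots,n$ along rows; $r_\lambda(i):=r_{t^\lambda}(i)$. $I_\lambda$ is the ideal of $\operatorname{GZ}_n$ generated by $L_i-r_\lambda(i)$, $i=1,\dots,n$, and $1_\lambda:=\operatorname{GZ}_n/I_\lambda$. For a finitely generated $R$-module $M$, $M^*:=\operatorname{Hom}_R(M,R)$ and $\operatorname{Fr}(M):=M^{**}$ ($\cong M/\operatorname{Tor}(M)$). For a finitely generated $\operatorname{GZ}_n$-module $M$, $\operatorname{Ind}(M):=\operatorname{Fr}(RS_n\otimes_{\operatorname{GZ}_n}M)$, and $\operatorname{Ind}(\lambda):=\operatorname{Ind}(1_\lambda)$. Murphy basis: $S_\lambda$ row stabilizer of $t^\lambda$, $x_\lambda=\sum_{\sigma\in S_\lambda}\sigma$, $d(t)$ defined by $t^\lambda d(t)=t$ (right action), $x_{st}=d(s)^{-1}x_\lambda d(t)$; $\{x_{st}\}$, with $s,t$ standard of the same shape, is an $R$-basis of $RS_n$. $RS_n^{\rhd\lambda}$ is the $R$-span of the $x_{uv}$ with $u,v$ standard $\mu$-tableaux,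 $\mu\rhd\lambda$ (dominance order); it is a two-sided ideal. The cell module $C(\lambda)$ is the left $RS_n$-module $(RS_nx_\lambda+RS_n^{\rhd\lambda})/RS_n^{\rhd\lambda}$, free over $R$ with basis the images of $x_{s t^\lambda}$, $s$ standard $\lambda$-tableau. *)

theory Defs
  imports Complex_Main "HOL-Combinatorics.Permutations" "HOL-Computational_Algebra.Primes"
begin

section \<open>Scalars: R = Z localized at (p), as a subring of Q\<close>

definition Rloc :: "nat \<Rightarrow> rat set" where
  "Rloc p = {q. \<not> (int p dvd snd (quotient_of q))}"

section \<open>The group algebra R S_n\<close>

text \<open>Permutations of {1..n}. Products follow the right-action convention of the
paper (t^lambda d(t) = t): sigma * tau means first sigma, then tau, i.e. tau o sigma.\<close>

definition perms :: "nat \<Rightarrow> (nat \<Rightarrow> nat) set" where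
  "perms n = {\<sigma>. \<sigma> permutes {1..n}}"

type_synonym ga = "(nat \<Rightarrow> nat) \<Rightarrow> rat"

definition GA :: "nat \<Rightarrow> nat \<Rightarrow> ga set" where
  "GA p n = {f. (\<forall>\<sigma>. \<sigma> \<notin> perms n \<longrightarrow> f \<sigma> = 0) \<and> (\<forall>\<sigma>. f \<sigma> \<in> Rloc p)}"

definition ga_add :: "ga \<Rightarrow> ga \<Rightarrow> ga" where
  "ga_add f g = (\<lambda>\<sigma>. f \<sigma> + g \<sigma>)"

definition ga_smult :: "rat \<Rightarrow> ga \<Rightarrow> ga" where
  "ga_smult r f = (\<lambda>\<sigma>. r * f \<sigma>)"

definition ga_mult :: "nat \<Rightarrow> ga \<Rightarrow> ga \<Rightarrow> ga" where
  "ga_mult n f g = (\<lambda>\<rho>. if \<rho> \<in> perms n then (\<Sum>\<sigma>\<in>perms n. f \<sigma> * g (\<rho> \<circ> inv \<sigma>)) else 0)"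

definition ga_of :: "(nat \<Rightarrow> nat) \<Rightarrow> ga" where
  "ga_of \<sigma> = (\<lambda>\<tau>. if \<tau> = \<sigma> then 1 else 0)"

definition ga_scal :: "rat \<Rightarrow> ga" where
  "ga_scal r = (\<lambda>\<tau>. if \<tau> = id then r else 0)"

definition transp :: "nat \<Rightarrow> nat \<Rightarrow> nat \<Rightarrow> nat" where
  "transp j k = (\<lambda>x. if x = j then k else if x = k then j else x)"

text \<open>Jucys--Murphy elements L_k = sum_{j<k} (j,k); L_1 = 0.\<close>
definition JM :: "nat \<Rightarrow> ga" where
  "JM k = (\<lambda>\<sigma>. \<Sum>j\<in>{1..<k}. ga_of (transp j k) \<sigma>)"

text \<open>GZ_n: the R-subalgebra of R S_n generated by L_1, ..., L_n.\<close>
inductive_set GZ :: "nat \<Rightarrow> nat \<Rightarrow> ga set" for p n where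
  GZ_one: "ga_scal 1 \<in> GZ p n"
| GZ_gen: "k \<in> {1..n} \<Longrightarrow> JM k \<in> GZ p n"
| GZ_add: "a \<in> GZ p n \<Longrightarrow> b \<in> GZ p n \<Longrightarrow> ga_add a b \<in> GZ p n"
| GZ_smult: "r \<in> Rloc p \<Longrightarrow> a \<in> GZ p n \<Longrightarrow> ga_smult r a \<in> GZ p n"
| GZ_mult: "a \<in> GZ p n \<Longrightarrow> b \<in> GZ p n \<Longrightarrow> ga_mult n a b \<in> GZ p n"

section \<open>Partitions, tableaux, contents\<close>

definition is_partition :: "nat \<Rightarrow> nat list \<Rightarrow> bool" where
  "is_partition n lam \<longleftrightarrow> sorted_wrt (\<ge>) lam \<and> 0 \<notin> set lam \<and> sum_list lam = n"

text \<open>Nodes [i,j], 1-based: row i, column j.\<close>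
definition nodes :: "nat list \<Rightarrow> (nat \<times> nat) set" where
  "nodes lam = {(i, j). 1 \<le> i \<and> i \<le> length lam \<and> 1 \<le> j \<and> j \<le> lam ! (i - 1)}"

text \<open>t^lambda: 1..n filled along rows.\<close>
definition tlam :: "nat list \<Rightarrow> nat \<times> nat \<Rightarrow> nat" where
  "tlam lam x = sum_list (take (fst x - 1) lam) + snd x"

definition node_of :: "nat list \<Rightarrow> nat \<Rightarrow> nat \<times> nat" where
  "node_of lam k = (THE x. x \<in> nodes lam \<and> tlam lam x = k)"

text \<open>r_lambda(k) = j - i where k is in node [i,j] of t^lambda.\<close>
definition content :: "nat list \<Rightarrow> nat \<Rightarrow> int" where
  "content lam k = int (snd (node_of lam k)) - int (fst (node_of lam k))"

definition is_tableau :: "nat \<Rightarrow> nat list \<Rightarrow> (nat \<times> nat \<Rightarrow> nat) \<Rightarrow> bool" where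
  "is_tableau n lam t \<longleftrightarrow> bij_betw t (nodes lam) {1..n}"

definition standard :: "nat \<Rightarrow> nat list \<Rightarrow> (nat \<times> nat \<Rightarrow> nat) \<Rightarrow> bool" where
  "standard n lam t \<longleftrightarrow> is_tableau n lam t
     \<and> (\<forall>i j. (i, j) \<in> nodes lam \<and> (i, Suc j) \<in> nodes lam \<longrightarrow> t (i, j) < t (i, Suc j))
     \<and> (\<forall>i j. (i, j) \<in> nodes lam \<and> (Suc i, j) \<in> nodes lam \<longrightarrow> t (i, j) < t (Suc i, j))"

text \<open>d(t): the permutation with t^lambda d(t) = t, where the right action of a
permutation on a tableau applies it to the entries: (t d)(x) = d (t x).\<close>
definition dperm :: "nat \<Rightarrow> nat list \<Rightarrow> (nat \<times> nat \<Rightarrow> nat) \<Rightarrow> nat \<Rightarrow> nat" where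
  "dperm n lam t = (\<lambda>k. if k \<in> {1..n} then t (node_of lam k) else k)"

text \<open>Row stabilizer S_lambda of t^lambda and x_lambda.\<close>
definition row_stab :: "nat \<Rightarrow> nat list \<Rightarrow> (nat \<Rightarrow> nat) set" where
  "row_stab n lam = {\<sigma> \<in> perms n. \<forall>k\<in>{1..n}. fst (node_of lam (\<sigma> k)) = fst (node_of lam k)}"

definition xlam :: "nat \<Rightarrow> nat list \<Rightarrow> ga" where
  "xlam n lam = (\<lambda>\<sigma>. if \<sigma> \<in> row_stab n lam then 1 else 0)"

definition xst :: "nat \<Rightarrow> nat list \<Rightarrow> (nat \<times> nat \<Rightarrow> nat) \<Rightarrow> (nat \<times> nat \<Rightarrow> nat) \<Rightarrow> ga" where
  "xst n lam s t = ga_mult n (ga_mult n (ga_of (inv (dperm n lam s))) (xlam n lam)) (ga_of (dperm n lam t))"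

text \<open>Dominance order on partitions.\<close>
definition dominates :: "nat list \<Rightarrow> nat list \<Rightarrow> bool" where
  "dominates mu lam \<longleftrightarrow> (\<forall>k. sum_list (take k lam) \<le> sum_list (take k mu))"

definition sdominates :: "nat list \<Rightarrow> nat list \<Rightarrow> bool" where
  "sdominates mu lam \<longleftrightarrow> dominates mu lam \<and> mu \<noteq> lam"

definition rspan :: "nat \<Rightarrow> ga set \<Rightarrow> ga set" where
  "rspan p S = {f. \<exists>F c. finite F \<and> F \<subseteq> S \<and> (\<forall>x\<in>F. c x \<in> Rloc p)
                  \<and> f = (\<lambda>\<sigma>. \<Sum>x\<in>F. c x * x \<sigma>)}"

text \<open>R S_n^{\<rhd> lambda}.\<close>
definition ideal_above :: "nat \<Rightarrow> nat \<Rightarrow> nat list \<Rightarrow> ga set" where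
  "ideal_above p n lam = rspan p {xst n mu u v | mu u v.
      is_partition n mu \<and> sdominates mu lam \<and> standard n mu u \<and> standard n mu v}"

section \<open>Left R S_n-modules\<close>

record 'm lmod =
  mcar :: "'m set"
  madd :: "'m \<Rightarrow> 'm \<Rightarrow> 'm"
  mact :: "ga \<Rightarrow> 'm \<Rightarrow> 'm"

text \<open>Isomorphism of left R S_n-modules (R acts through R \<subseteq> R S_n).\<close>
definition lmod_iso :: "nat \<Rightarrow> nat \<Rightarrow> ('m, 'x) lmod_scheme \<Rightarrow> ('k, 'y) lmod_scheme \<Rightarrow> bool" where
  "lmod_iso p n M N \<longleftrightarrow> (\<exists>f. bij_betw f (mcar M) (mcar N)
      \<and> (\<forall>x\<in>mcar M. \<forall>y\<in>mcar M. f (madd M x y) = madd N (f x) (f y))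
      \<and> (\<forall>a\<in>GA p n. \<forall>x\<in>mcar M. f (mact M a x) = mact N a (f x)))"

text \<open>Quotient of a module M by a submodule N (elements are cosets).\<close>
definition coset :: "('m, 'x) lmod_scheme \<Rightarrow> 'm set \<Rightarrow> 'm \<Rightarrow> 'm set" where
  "coset M N a = {madd M a v | v. v \<in> N}"

definition quot_mod :: "('m, 'x) lmod_scheme \<Rightarrow> 'm set \<Rightarrow> 'm set lmod" where
  "quot_mod M N = \<lparr> mcar = coset M N ` mcar M,
     madd = (\<lambda>X Y. coset M N (madd M (SOME x. x \<in> X) (SOME y. y \<in> Y))),
     mact = (\<lambda>a X. coset M N (mact M a (SOME x. x \<in> X))) \<rparr>"

text \<open>M^* = Hom_R(M,R) (R-action on M via r \<mapsto> r \<cdot> 1 in R S_n).\<close>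
definition dual_set :: "nat \<Rightarrow> ('m, 'x) lmod_scheme \<Rightarrow> ('m \<Rightarrow> rat) set" where
  "dual_set p M = {f. (\<forall>m. m \<notin> mcar M \<longrightarrow> f m = 0) \<and> (\<forall>m\<in>mcar M. f m \<in> Rloc p)
      \<and> (\<forall>x\<in>mcar M. \<forall>y\<in>mcar M. f (madd M x y) = f x + f y)
      \<and> (\<forall>r\<in>Rloc p. \<forall>m\<in>mcar M. f (mact M (ga_scal r) m) = r * f m)}"

text \<open>M^* with its (pointwise) R-module structure; the action field is
f \<mapsto> f o (a \<cdot> -) (a right action of R S_n, used here only for scalars).\<close>
definition dual_mod :: "nat \<Rightarrow> ('m, 'x) lmod_scheme \<Rightarrow> ('m \<Rightarrow> rat) lmod" where
  "dual_mod p M = \<lparr> mcar = dual_set p M,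
     madd = (\<lambda>f g m. f m + g m),
     mact = (\<lambda>a f m. if m \<in> mcar M then f (mact M a m) else 0) \<rparr>"

text \<open>Fr(M) = M^{**} with its left R S_n-module structure (a \<Phi>)(f) = \<Phi>(f o (a \<cdot> -)).\<close>
definition Fr :: "nat \<Rightarrow> ('m, 'x) lmod_scheme \<Rightarrow> (('m \<Rightarrow> rat) \<Rightarrow> rat) lmod" where
  "Fr p M = \<lparr> mcar = dual_set p (dual_mod p M),
     madd = (\<lambda>\<Phi> \<Psi> f. \<Phi> f + \<Psi> f),
     mact = (\<lambda>a \<Phi> f. if f \<in> dual_set p M then \<Phi> (mact (dual_mod p M) a f) else 0) \<rparr>"

section \<open>1_lambda = GZ_n / I_lambda\<close>

text \<open>I_lambda: ideal of GZ_n generated by L_i - r_lambda(i), i = 1..n.\<close>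
inductive_set Ilam :: "nat \<Rightarrow> nat \<Rightarrow> nat list \<Rightarrow> ga set" for p n lam where
  I_gen: "i \<in> {1..n} \<Longrightarrow> ga_add (JM i) (ga_scal (- of_int (content lam i))) \<in> Ilam p n lam"
| I_zero: "(\<lambda>\<sigma>. 0) \<in> Ilam p n lam"
| I_add: "a \<in> Ilam p n lam \<Longrightarrow> b \<in> Ilam p n lam \<Longrightarrow> ga_add a b \<in> Ilam p n lam"
| I_lmult: "c \<in> GZ p n \<Longrightarrow> a \<in> Ilam p n lam \<Longrightarrow> ga_mult n c a \<in> Ilam p n lam"
| I_rmult: "c \<in> GZ p n \<Longrightarrow> a \<in> Ilam p n lam \<Longrightarrow> ga_mult n a c \<in> Ilam p n lam"

text \<open>GZ_n as a module over itself, and 1_lambda as a quotient (elements are cosets).\<close>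
definition GZ_mod :: "nat \<Rightarrow> nat \<Rightarrow> ga lmod" where
  "GZ_mod p n = \<lparr> mcar = GZ p n, madd = ga_add, mact = ga_mult n \<rparr>"

definition one_lam :: "nat \<Rightarrow> nat \<Rightarrow> nat list \<Rightarrow> ga set lmod" where
  "one_lam p n lam = quot_mod (GZ_mod p n) (Ilam p n lam)"

section \<open>R S_n \<otimes>_{GZ_n} 1_lambda\<close>

type_synonym tpair = "ga \<times> ga set"

definition tdelta :: "tpair \<Rightarrow> tpair \<Rightarrow> int" where
  "tdelta q = (\<lambda>q'. if q' = q then 1 else 0)"

definition fs_add :: "(tpair \<Rightarrow> int) \<Rightarrow> (tpair \<Rightarrow> int) \<Rightarrow> tpair \<Rightarrow> int" where
  "fs_add F G = (\<lambda>q. F q + G q)"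

text \<open>Free Z-module on pairs (a, X), a \<in> R S_n, X \<in> 1_lambda, with left R S_n-action
x \<cdot> (a, X) = (x a, X).\<close>
definition free_mod :: "nat \<Rightarrow> nat \<Rightarrow> nat list \<Rightarrow> (tpair \<Rightarrow> int) lmod" where
  "free_mod p n lam = \<lparr> mcar = {F. finite {q. F q \<noteq> 0}
        \<and> (\<forall>a X. F (a, X) \<noteq> 0 \<longrightarrow> a \<in> GA p n \<and> X \<in> mcar (one_lam p n lam))},
     madd = fs_add,
     mact = (\<lambda>x F (b, X). \<Sum>a\<in>{a. F (a, X) \<noteq> 0 \<and> ga_mult n x a = b}. F (a, X)) \<rparr>"

text \<open>Relations defining the balanced tensor product over GZ_n.\<close>
inductive_set tens_rel :: "nat \<Rightarrow> nat \<Rightarrow> nat list \<Rightarrow> (tpair \<Rightarrow> int) set" for p n lam where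
  rel_l: "a \<in> GA p n \<Longrightarrow> a' \<in> GA p n \<Longrightarrow> X \<in> mcar (one_lam p n lam) \<Longrightarrow>
     (\<lambda>q. tdelta (ga_add a a', X) q - tdelta (a, X) q - tdelta (a', X) q) \<in> tens_rel p n lam"
| rel_r: "a \<in> GA p n \<Longrightarrow> X \<in> mcar (one_lam p n lam) \<Longrightarrow> Y \<in> mcar (one_lam p n lam) \<Longrightarrow>
     (\<lambda>q. tdelta (a, madd (one_lam p n lam) X Y) q - tdelta (a, X) q - tdelta (a, Y) q) \<in> tens_rel p n lam"
| rel_bal: "a \<in> GA p n \<Longrightarrow> b \<in> GZ p n \<Longrightarrow> X \<in> mcar (one_lam p n lam) \<Longrightarrow>
     (\<lambda>q. tdelta (ga_mult n a b, X) q - tdelta (a, mact (one_lam p n lam) b X) q) \<in> tens_rel p n lam"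
| rel_zero: "(\<lambda>q. 0) \<in> tens_rel p n lam"
| rel_add: "F \<in> tens_rel p n lam \<Longrightarrow> G \<in> tens_rel p n lam \<Longrightarrow> fs_add F G \<in> tens_rel p n lam"
| rel_neg: "F \<in> tens_rel p n lam \<Longrightarrow> (\<lambda>q. - F q) \<in> tens_rel p n lam"

definition tensor_mod :: "nat \<Rightarrow> nat \<Rightarrow> nat list \<Rightarrow> (tpair \<Rightarrow> int) set lmod" where
  "tensor_mod p n lam = quot_mod (free_mod p n lam) (tens_rel p n lam)"

text \<open>Ind(lambda) = Fr(R S_n \<otimes>_{GZ_n} 1_lambda).\<close>
definition Ind :: "nat \<Rightarrow> nat \<Rightarrow> nat list \<Rightarrow> (((tpair \<Rightarrow> int) set \<Rightarrow> rat) \<Rightarrow> rat) lmod" where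
  "Ind p n lam = Fr p (tensor_mod p n lam)"

section \<open>Cell module C(lambda)\<close>

definition cell_ambient :: "nat \<Rightarrow> nat \<Rightarrow> nat list \<Rightarrow> ga lmod" where
  "cell_ambient p n lam = \<lparr> mcar = {ga_add (ga_mult n c (xlam n lam)) b | c b.
        c \<in> GA p n \<and> b \<in> ideal_above p n lam},
     madd = ga_add, mact = ga_mult n \<rparr>"

definition Cell :: "nat \<Rightarrow> nat \<Rightarrow> nat list \<Rightarrow> ga set lmod" where
  "Cell p n lam = quot_mod (cell_ambient p n lam) (ideal_above p n lam)"

end

theory Submission
  imports Defs "HOL-Library.Function_Algebras"
begin

text \<open>Write \<open>rmatch f g\<close> for the sum of all permutations \<open>\<sigma>\<close> with \<open>g \<circ> \<sigma> = f\<close>, where \<open>f\<close> and \<open>g\<close>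
are words in the row numbers. The Murphy element of a pair of tableaux is \<open>rmatch\<close> of their row-reading
words, permutations act on either argument by permuting positions, and the span \<open>RS\<^sub>n\<^sup>\<rhd>\<^sup>\<lambda>\<close> turns out to be
the span of all \<open>rmatch f g\<close> of strictly dominating type, visibly an ideal. Garnir relations express a word
that is not a lattice word by words of larger weight, and the same relations show that Jucys--Murphy
elements act triangularly with the contents of the word on the diagonal; in particular \<open>x\<^sub>\<lambda>\<close> is a
joint eigenvector modulo \<open>RS\<^sub>n\<^sup>\<rhd>\<^sup>\<lambda>\<close>, whence a surjection \<open>RS\<^sub>n \<otimes> 1\<^sub>\<lambda> \<rightarrow> C(\<lambda>)\<close>. A signed column pairing makes the
standard elements linearly independent, so \<open>C(\<lambda>)\<close> is free. Finally the contents of \<open>t\<^sup>\<lambda>\<close> occur for no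
other word, so triangularity of the right action makes \<open>RS\<^sub>n \<otimes> 1\<^sub>\<lambda>\<close> spanned, up to torsion, by the
images of \<open>rmatch f t\<^sup>\<lambda>\<close>; together with \<open>x\<^sub>\<lambda>\<^sup>2 = |S\<^sub>\<lambda>| x\<^sub>\<lambda>\<close> this forces the kernel of the surjection to be
torsion. Hence both modules have the same dual, and the bidual of the first is \<open>C(\<lambda>)\<close>.\<close>

text \<open>The obstacle is that R is not a field: contents that differ as integers may agree modulo
  p, so the L_k cannot be separated by idempotents, and neither |S_lambda| nor a difference of
  contents need be invertible. Hence eliminations take place in submodules T of RS_n closed under
  division by nonzero integers (the hypothesis \<open>sat\<close>), and conclusions hold up to the
  torsion that Fr discards. Being rational-valued, a functional has a kernel of this kind; for this
  reason the tensor product is studied only through its dual, which \<open>Dual_balanced\<close>,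
  \<open>Dual_eqI\<close> and \<open>Dual_exists\<close> identify with the \<open>balanced\<close>
  functionals on RS_n. Cancelling |S_lambda| at the end is legitimate because C(lambda) is free,
  which is why the linear independence of the standard elements precedes the torsion argument. Words
  replace tableaux because \<open>rmatch\<close> makes sense for every pair of words: Garnir
  relations and swaps of entries leave standard tableaux, and moving entries between rows leaves
  partition shapes.\<close>

lemma sum_fun_apply: "(\<Sum>i\<in>I. F i) x = (\<Sum>i\<in>I. (F i x :: 'b::comm_monoid_add))"
  by (induction I rule: infinite_finite_induct) auto

lemma ga_add_eq: "ga_add f g = f + g"
  by (simp add: ga_add_def plus_fun_def)

lemma ga_smult_apply [simp]: "ga_smult r f \<sigma> = r * f \<sigma>"
  by (simp add: ga_smult_def)

lemma transp_eq: "transp = Transposition.transpose"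
  by (intro ext) (simp add: transp_def Transposition.transpose_def)

section \<open>The symmetric group on {1..n}\<close>

lemma perms_comp: "\<sigma> \<in> perms n \<Longrightarrow> \<tau> \<in> perms n \<Longrightarrow> \<sigma> \<circ> \<tau> \<in> perms n"
  by (simp add: perms_def permutes_compose)

lemma perms_inv: "\<sigma> \<in> perms n \<Longrightarrow> inv \<sigma> \<in> perms n"
  by (simp add: perms_def permutes_inv)

lemma perms_id: "id \<in> perms n"
  by (simp add: perms_def permutes_id)

lemma perms_bij: "\<sigma> \<in> perms n \<Longrightarrow> bij \<sigma>"
  by (simp add: perms_def permutes_bij)

lemma finite_perms: "finite (perms n)"
  unfolding perms_def by (rule finite_permutations) simp

lemma perms_in: "\<sigma> \<in> perms n \<Longrightarrow> \<sigma> k \<in> {1..n} \<longleftrightarrow> k \<in> {1..n}"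
  unfolding perms_def by (metis mem_Collect_eq permutes_in_image)

lemma perms_inv_apply [simp]:
  assumes "\<sigma> \<in> perms n" shows "\<sigma> (inv \<sigma> k) = k" "inv \<sigma> (\<sigma> k) = k"
  using assms unfolding perms_def by (auto simp: permutes_inverses)

lemma perms_comp_inv [simp]:
  assumes "\<sigma> \<in> perms n" shows "\<sigma> \<circ> inv \<sigma> = id" "inv \<sigma> \<circ> \<sigma> = id"
  using assms unfolding perms_def by (auto simp: permutes_inv_o)

lemma perms_out: "\<sigma> \<in> perms n \<Longrightarrow> k \<notin> {1..n} \<Longrightarrow> \<sigma> k = k"
  unfolding perms_def by (auto simp: permutes_def)

lemma transpose_perms: "j \<in> {1..n} \<Longrightarrow> k \<in> {1..n} \<Longrightarrow> Transposition.transpose j k \<in> perms n"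
  unfolding perms_def by (simp add: permutes_swap_id)

lemma sum_perms_right:
  assumes "\<tau> \<in> perms n"
  shows "(\<Sum>\<sigma>\<in>perms n. h (\<sigma> \<circ> \<tau>)) = (\<Sum>\<sigma>\<in>perms n. h \<sigma>)"
  by (rule sum.reindex_bij_witness[where i="\<lambda>\<sigma>. \<sigma> \<circ> inv \<tau>" and j="\<lambda>\<sigma>. \<sigma> \<circ> \<tau>"])
     (use assms in \<open>auto simp: perms_comp perms_inv comp_assoc\<close>)

section \<open>The ring of scalars\<close>

text \<open>\<open>Rloc\<close> looks at the reduced denominator. That one divides the denominator
  of every other fraction for q, so closure under sums and products can be checked on unreduced
  fractions.\<close>

lemma Rloc_iff:
  assumes "prime p"
  shows "q \<in> Rloc p \<longleftrightarrow> (\<exists>a b. q = of_int a / of_int b \<and> \<not> int p dvd b)"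
proof
  assume "q \<in> Rloc p"
  moreover obtain a b where ab: "quotient_of q = (a, b)" by fastforce
  ultimately show "\<exists>a b. q = of_int a / of_int b \<and> \<not> int p dvd b"
    using quotient_of_div[OF ab] by (auto simp: Rloc_def)
next
  assume "\<exists>a b. q = of_int a / of_int b \<and> \<not> int p dvd b"
  then obtain a b where q: "q = of_int a / of_int b" and b: "\<not> int p dvd b" by blast
  obtain c d where cd: "quotient_of q = (c, d)" by fastforce
  have d: "d > 0" and cop: "coprime c d" and qcd: "q = of_int c / of_int d"
    using quotient_of_denom_pos[OF cd] quotient_of_coprime[OF cd] quotient_of_div[OF cd] by auto
  have "b \<noteq> 0" using b by auto
  then have "(of_int (c * b) :: rat) = of_int (a * d)"
    using q qcd d by (simp add: field_simps)
  then have "c * b = a * d" by (simp only: of_int_eq_iff)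
  then have "d dvd c * b" by simp
  then have "d dvd b" using cop by (simp add: coprime_commute coprime_dvd_mult_right_iff)
  then have "\<not> int p dvd d" using b dvd_trans by blast
  then show "q \<in> Rloc p" by (simp add: Rloc_def cd)
qed

lemma Rloc_of_int [simp]: "prime p \<Longrightarrow> of_int a \<in> Rloc p"
  by (simp only: Rloc_iff, rule exI[of _ a], rule exI[of _ 1]) (use prime_gt_1_nat[of p] in simp)

lemma Rloc_0 [simp]: "prime p \<Longrightarrow> 0 \<in> Rloc p" using Rloc_of_int[of p 0] by simp
lemma Rloc_1 [simp]: "prime p \<Longrightarrow> 1 \<in> Rloc p" using Rloc_of_int[of p 1] by simp
lemma Rloc_m1 [simp]: "prime p \<Longrightarrow> -1 \<in> Rloc p" using Rloc_of_int[of p "-1"] by simp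
lemma Rloc_mult [simp]:
  assumes "prime p" "x \<in> Rloc p" "y \<in> Rloc p" shows "x * y \<in> Rloc p"
proof -
  obtain a b c d where h: "x = of_int a / of_int b" "\<not> int p dvd b"
    "y = of_int c / of_int d" "\<not> int p dvd d" using assms by (auto simp: Rloc_iff)
  then have "x * y = of_int (a * c) / of_int (b * d)" by simp
  moreover have "\<not> int p dvd b * d" using h assms(1) by (simp add: prime_dvd_mult_iff)
  ultimately show ?thesis using assms(1) Rloc_iff by blast
qed

lemma Rloc_add [simp]:
  assumes "prime p" "x \<in> Rloc p" "y \<in> Rloc p" shows "x + y \<in> Rloc p"
proof -
  obtain a b c d where h: "x = of_int a / of_int b" "\<not> int p dvd b"
    "y = of_int c / of_int d" "\<not> int p dvd d" using assms by (auto simp: Rloc_iff)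
  then have "b \<noteq> 0" "d \<noteq> 0" by auto
  then have "x + y = of_int (a * d + c * b) / of_int (b * d)"
    using h by (simp add: field_simps)
  moreover have "\<not> int p dvd b * d" using h assms(1) by (simp add: prime_dvd_mult_iff)
  ultimately show ?thesis using assms(1) Rloc_iff by blast
qed

lemma Rloc_minus [simp]: "prime p \<Longrightarrow> x \<in> Rloc p \<Longrightarrow> - x \<in> Rloc p"
  using Rloc_mult[of p "-1" x] by simp

lemma Rloc_sum: "prime p \<Longrightarrow> (\<And>i. i \<in> I \<Longrightarrow> h i \<in> Rloc p) \<Longrightarrow> sum h I \<in> Rloc p"
  by (induction I rule: infinite_finite_induct) auto

section \<open>Submodules of the group algebra\<close>

text \<open>Spans are handled by closure rather than by coefficients: to prove a property on a span,
  or on all of RS_n, the set of elements having it is shown to be an \<open>rsub\<close> containing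
  the generators. The letter T below usually stands for such a set.\<close>

definition rsub :: "nat \<Rightarrow> ga set \<Rightarrow> bool" where
  "rsub p T \<longleftrightarrow> 0 \<in> T \<and> (\<forall>a\<in>T. \<forall>b\<in>T. a + b \<in> T) \<and> (\<forall>r\<in>Rloc p. \<forall>a\<in>T. ga_smult r a \<in> T)"

lemma rsubI:
  assumes "0 \<in> T" "\<And>a b. a \<in> T \<Longrightarrow> b \<in> T \<Longrightarrow> a + b \<in> T"
    "\<And>r a. r \<in> Rloc p \<Longrightarrow> a \<in> T \<Longrightarrow> ga_smult r a \<in> T"
  shows "rsub p T"
  using assms by (auto simp: rsub_def)

lemma rsub_0: "rsub p T \<Longrightarrow> 0 \<in> T"
  and rsub_add: "rsub p T \<Longrightarrow> a \<in> T \<Longrightarrow> b \<in> T \<Longrightarrow> a + b \<in> T"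
  and rsub_smult: "rsub p T \<Longrightarrow> r \<in> Rloc p \<Longrightarrow> a \<in> T \<Longrightarrow> ga_smult r a \<in> T"
  by (auto simp: rsub_def)

lemma rsub_uminus: "prime p \<Longrightarrow> rsub p T \<Longrightarrow> a \<in> T \<Longrightarrow> - a \<in> T"
proof -
  assume *: "prime p" "rsub p T" "a \<in> T"
  have "ga_smult (-1) a = - a" by (auto simp: fun_eq_iff)
  then show ?thesis using rsub_smult[OF *(2) Rloc_m1[OF *(1)] *(3)] by simp
qed

lemma rsub_diff: "prime p \<Longrightarrow> rsub p T \<Longrightarrow> a \<in> T \<Longrightarrow> b \<in> T \<Longrightarrow> a - b \<in> T"
  using rsub_add[of p T a "- b"] rsub_uminus[of p T b] by simp

lemma rsub_sum: "rsub p T \<Longrightarrow> (\<And>i. i \<in> I \<Longrightarrow> F i \<in> T) \<Longrightarrow> (\<Sum>i\<in>I. F i) \<in> T"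
  by (induction I rule: infinite_finite_induct) (auto simp: rsub_0 rsub_add)

lemma rspan_eq:
  "rspan p S = {\<Sum>x\<in>F. ga_smult (c x) x | F c. finite F \<and> F \<subseteq> S \<and> (\<forall>x\<in>F. c x \<in> Rloc p)}"
  unfolding rspan_def by (auto simp: fun_eq_iff sum_fun_apply)

lemma rspan_base: "prime p \<Longrightarrow> x \<in> S \<Longrightarrow> x \<in> rspan p S"
  unfolding rspan_def by (rule CollectI, rule exI[of _ "{x}"], rule exI[of _ "\<lambda>_. 1"]) auto

lemma rspan_minimal: "rsub p T \<Longrightarrow> S \<subseteq> T \<Longrightarrow> rspan p S \<subseteq> T"
  unfolding rspan_eq by (auto intro!: rsub_sum rsub_smult)

lemma rspan_rsub:
  assumes "prime p" shows "rsub p (rspan p S)"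
proof (rule rsubI)
  show "0 \<in> rspan p S" unfolding rspan_eq by (rule CollectI, rule exI[of _ "{}"]) auto
next
  fix a b assume "a \<in> rspan p S" "b \<in> rspan p S"
  then obtain F c G d where F: "finite F" "F \<subseteq> S" "\<forall>x\<in>F. c x \<in> Rloc p" "a = (\<Sum>x\<in>F. ga_smult (c x) x)"
    and G: "finite G" "G \<subseteq> S" "\<forall>x\<in>G. d x \<in> Rloc p" "b = (\<Sum>x\<in>G. ga_smult (d x) x)"
    unfolding rspan_eq by blast
  \<comment> \<open>The coefficients are extended by zero to the union of the two supports.\<close>
  define e where "e x = (if x \<in> F then c x else 0) + (if x \<in> G then d x else 0)" for x
  have "a = (\<Sum>x\<in>F \<union> G. ga_smult (if x \<in> F then c x else 0) x)"
    unfolding F(4) using F G by (intro sum.mono_neutral_cong_left) (auto simp: fun_eq_iff)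
  moreover have "b = (\<Sum>x\<in>F \<union> G. ga_smult (if x \<in> G then d x else 0) x)"
    unfolding G(4) using F G by (intro sum.mono_neutral_cong_left) (auto simp: fun_eq_iff)
  ultimately have "a + b = (\<Sum>x\<in>F \<union> G. ga_smult (e x) x)"
    by (simp add: e_def fun_eq_iff sum_fun_apply sum.distrib algebra_simps)
  moreover have "\<forall>x\<in>F \<union> G. e x \<in> Rloc p" using F G assms by (auto simp: e_def)
  ultimately show "a + b \<in> rspan p S" unfolding rspan_eq using F G by blast
next
  fix r a assume "r \<in> Rloc p" "a \<in> rspan p S"
  then obtain F c where F: "finite F" "F \<subseteq> S" "\<forall>x\<in>F. c x \<in> Rloc p" "a = (\<Sum>x\<in>F. ga_smult (c x) x)"
    unfolding rspan_eq by blast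
  have "ga_smult r a = (\<Sum>x\<in>F. ga_smult (r * c x) x)"
    unfolding F(4) by (auto simp: fun_eq_iff sum_fun_apply sum_distrib_left mult.assoc)
  then show "ga_smult r a \<in> rspan p S" unfolding rspan_eq using F assms \<open>r \<in> Rloc p\<close>
    by (intro CollectI exI[of _ F] exI[of _ "\<lambda>x. r * c x"]) auto
qed

section \<open>Multiplication in the group algebra\<close>

lemma ga_mult_add_left: "ga_mult n (a + b) c = ga_mult n a c + ga_mult n b c"
  by (auto simp: ga_mult_def fun_eq_iff sum.distrib algebra_simps)

lemma ga_mult_add_right: "ga_mult n a (b + c) = ga_mult n a b + ga_mult n a c"
  by (auto simp: ga_mult_def fun_eq_iff sum.distrib algebra_simps)

lemma ga_mult_smult_left: "ga_mult n (ga_smult r a) b = ga_smult r (ga_mult n a b)"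
  by (auto simp: ga_mult_def fun_eq_iff sum_distrib_left mult.assoc)

lemma ga_mult_smult_right: "ga_mult n a (ga_smult r b) = ga_smult r (ga_mult n a b)"
  by (auto simp: ga_mult_def fun_eq_iff sum_distrib_left algebra_simps)

lemma ga_mult_0_left [simp]: "ga_mult n 0 a = 0"
  by (auto simp: ga_mult_def fun_eq_iff)

lemma ga_mult_0_right [simp]: "ga_mult n a 0 = 0"
  by (auto simp: ga_mult_def fun_eq_iff)

lemma ga_mult_uminus_right: "ga_mult n a (- b) = - ga_mult n a b"
  by (auto simp: ga_mult_def fun_eq_iff sum_negf)

lemma ga_mult_uminus_left: "ga_mult n (- a) b = - ga_mult n a b"
  by (auto simp: ga_mult_def fun_eq_iff sum_negf)

lemma ga_mult_diff_right: "ga_mult n a (b - c) = ga_mult n a b - ga_mult n a c"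
  using ga_mult_add_right[of n a b "- c"] by (simp add: ga_mult_uminus_right)

lemma ga_mult_diff_left: "ga_mult n (a - b) c = ga_mult n a c - ga_mult n b c"
  using ga_mult_add_left[of n a "- b" c] by (simp add: ga_mult_uminus_left)

lemma ga_mult_sum_left: "ga_mult n (\<Sum>i\<in>I. F i) c = (\<Sum>i\<in>I. ga_mult n (F i) c)"
  by (induction I rule: infinite_finite_induct)
     (simp_all only: ga_mult_add_left sum.infinite sum.empty sum.insert ga_mult_0_left not_False_eq_True)

lemma ga_mult_sum_right: "ga_mult n c (\<Sum>i\<in>I. F i) = (\<Sum>i\<in>I. ga_mult n c (F i))"
  by (induction I rule: infinite_finite_induct)
     (simp_all only: ga_mult_add_right sum.infinite sum.empty sum.insert ga_mult_0_right not_False_eq_True)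

lemma ga_mult_assoc: "ga_mult n (ga_mult n a b) c = ga_mult n a (ga_mult n b c)"
proof
  fix \<rho>
  show "ga_mult n (ga_mult n a b) c \<rho> = ga_mult n a (ga_mult n b c) \<rho>"
  proof (cases "\<rho> \<in> perms n")
    case True
    have "ga_mult n (ga_mult n a b) c \<rho> =
        (\<Sum>\<sigma>\<in>perms n. \<Sum>\<tau>\<in>perms n. a \<tau> * b (\<sigma> \<circ> inv \<tau>) * c (\<rho> \<circ> inv \<sigma>))"
      using True by (simp add: ga_mult_def sum_distrib_right)
    also have "\<dots> = (\<Sum>\<tau>\<in>perms n. \<Sum>\<sigma>\<in>perms n. a \<tau> * b (\<sigma> \<circ> inv \<tau>) * c (\<rho> \<circ> inv \<sigma>))"
      by (rule sum.swap)
    also have "\<dots> = (\<Sum>\<tau>\<in>perms n. \<Sum>\<sigma>\<in>perms n. a \<tau> * b \<sigma> * c (\<rho> \<circ> inv \<tau> \<circ> inv \<sigma>))"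
    proof (rule sum.cong[OF refl])
      fix \<tau> assume t: "\<tau> \<in> perms n"
      have "(\<Sum>\<sigma>\<in>perms n. a \<tau> * b (\<sigma> \<circ> inv \<tau>) * c (\<rho> \<circ> inv \<sigma>)) =
         (\<Sum>\<sigma>\<in>perms n. a \<tau> * b ((\<sigma> \<circ> \<tau>) \<circ> inv \<tau>) * c (\<rho> \<circ> inv (\<sigma> \<circ> \<tau>)))"
        by (rule sum_perms_right[OF t, symmetric])
      also have "\<dots> = (\<Sum>\<sigma>\<in>perms n. a \<tau> * b \<sigma> * c (\<rho> \<circ> inv \<tau> \<circ> inv \<sigma>))"
        by (intro sum.cong refl) (use t in \<open>simp add: o_inv_distrib perms_bij comp_assoc\<close>)
      finally show "(\<Sum>\<sigma>\<in>perms n. a \<tau> * b (\<sigma> \<circ> inv \<tau>) * c (\<rho> \<circ> inv \<sigma>)) =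
        (\<Sum>\<sigma>\<in>perms n. a \<tau> * b \<sigma> * c (\<rho> \<circ> inv \<tau> \<circ> inv \<sigma>))" .
    qed
    also have "\<dots> = ga_mult n a (ga_mult n b c) \<rho>"
      using True by (simp add: ga_mult_def sum_distrib_left perms_comp perms_inv mult.assoc)
    finally show ?thesis .
  qed (simp add: ga_mult_def)
qed

text \<open>The product of \<sigma> and \<tau> is \<open>\<tau> \<circ> \<sigma>\<close>, so a left
  factor is undone on the right of \<rho> and a right factor on its left. This is the reason why
  multiplication composes the first word of \<open>rmatch\<close> with \<pi>, but the second one
  with its inverse.\<close>

lemma ga_of_mult:
  assumes "\<pi> \<in> perms n"
  shows "ga_mult n (ga_of \<pi>) a = (\<lambda>\<rho>. if \<rho> \<in> perms n then a (\<rho> \<circ> inv \<pi>) else 0)"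
proof -
  have "(\<Sum>\<sigma>\<in>perms n. ga_of \<pi> \<sigma> * a (\<rho> \<circ> inv \<sigma>)) = a (\<rho> \<circ> inv \<pi>)" for \<rho>
    using assms by (simp add: ga_of_def if_distrib[of "\<lambda>x. x * _"] sum.delta finite_perms cong: if_cong)
  then show ?thesis by (simp add: ga_mult_def fun_eq_iff)
qed

lemma mult_ga_of:
  assumes "\<pi> \<in> perms n"
  shows "ga_mult n a (ga_of \<pi>) = (\<lambda>\<rho>. if \<rho> \<in> perms n then a (inv \<pi> \<circ> \<rho>) else 0)"
proof -
  have "(\<Sum>\<sigma>\<in>perms n. a \<sigma> * ga_of \<pi> (\<rho> \<circ> inv \<sigma>)) = a (inv \<pi> \<circ> \<rho>)" if r: "\<rho> \<in> perms n" for \<rho>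
  proof -
    have "\<rho> \<circ> inv \<sigma> = \<pi> \<longleftrightarrow> \<sigma> = inv \<pi> \<circ> \<rho>" if "\<sigma> \<in> perms n" for \<sigma>
    proof
      assume "\<rho> \<circ> inv \<sigma> = \<pi>"
      then have "inv \<pi> \<circ> \<rho> = inv (\<rho> \<circ> inv \<sigma>) \<circ> \<rho>" by simp
      also have "\<dots> = \<sigma> \<circ> (inv \<rho> \<circ> \<rho>)" using r that
        by (simp add: o_inv_distrib perms_bij bij_imp_bij_inv inv_inv_eq o_assoc del: perms_comp_inv)
      also have "\<dots> = \<sigma>" using r by simp
      finally show "\<sigma> = inv \<pi> \<circ> \<rho>" by simp
    next
      assume "\<sigma> = inv \<pi> \<circ> \<rho>"
      then have "\<rho> \<circ> inv \<sigma> = (\<rho> \<circ> inv \<rho>) \<circ> \<pi>" using r assms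
        by (simp add: o_inv_distrib perms_bij bij_imp_bij_inv inv_inv_eq o_assoc del: perms_comp_inv)
      then show "\<rho> \<circ> inv \<sigma> = \<pi>" using r by simp
    qed
    then have "(\<Sum>\<sigma>\<in>perms n. a \<sigma> * ga_of \<pi> (\<rho> \<circ> inv \<sigma>)) =
        (\<Sum>\<sigma>\<in>perms n. if \<sigma> = inv \<pi> \<circ> \<rho> then a \<sigma> else 0)"
      by (intro sum.cong) (auto simp: ga_of_def)
    then show ?thesis using r assms by (simp add: finite_perms perms_comp perms_inv)
  qed
  then show ?thesis by (simp add: ga_mult_def fun_eq_iff)
qed

lemma ga_scal_eq: "ga_scal r = ga_smult r (ga_of id)"
  by (auto simp: ga_scal_def ga_of_def fun_eq_iff)

lemma ga_scal_mult:
  assumes "\<And>\<sigma>. \<sigma> \<notin> perms n \<Longrightarrow> a \<sigma> = 0"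
  shows "ga_mult n (ga_scal r) a = ga_smult r a" "ga_mult n a (ga_scal r) = ga_smult r a"
proof -
  have "ga_mult n (ga_of id) a = a" "ga_mult n a (ga_of id) = a"
    using assms by (auto simp: ga_of_mult mult_ga_of perms_id fun_eq_iff)
  then show "ga_mult n (ga_scal r) a = ga_smult r a" "ga_mult n a (ga_scal r) = ga_smult r a"
    by (simp_all only: ga_scal_eq ga_mult_smult_left ga_mult_smult_right)
qed

lemma GA_D: "a \<in> GA p n \<Longrightarrow> \<sigma> \<notin> perms n \<Longrightarrow> a \<sigma> = 0"
  by (simp add: GA_def)

lemma GA_scal_mult:
  assumes "a \<in> GA p n"
  shows "ga_mult n (ga_scal r) a = ga_smult r a" "ga_mult n a (ga_scal r) = ga_smult r a"
  using ga_scal_mult[of n a r] GA_D[OF assms] by auto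

lemma GA_rsub: "prime p \<Longrightarrow> rsub p (GA p n)"
  by (rule rsubI) (auto simp: GA_def)

lemma GA_mult: "prime p \<Longrightarrow> a \<in> GA p n \<Longrightarrow> b \<in> GA p n \<Longrightarrow> ga_mult n a b \<in> GA p n"
  by (auto simp: GA_def ga_mult_def intro!: Rloc_sum)

lemma GA_ga_of: "prime p \<Longrightarrow> \<sigma> \<in> perms n \<Longrightarrow> ga_of \<sigma> \<in> GA p n"
  by (auto simp: GA_def ga_of_def)

lemma GA_scal: "prime p \<Longrightarrow> r \<in> Rloc p \<Longrightarrow> ga_scal r \<in> GA p n"
  by (auto simp: GA_def ga_scal_def perms_id)

lemma JM_eq: "JM k = (\<Sum>j\<in>{1..<k}. ga_of (Transposition.transpose j k))"
  by (auto simp: JM_def fun_eq_iff sum_fun_apply transp_eq)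

lemma GA_JM: "prime p \<Longrightarrow> k \<in> {1..n} \<Longrightarrow> JM k \<in> GA p n"
  unfolding JM_eq by (intro rsub_sum[OF GA_rsub] GA_ga_of transpose_perms) auto

lemma GA_expand:
  assumes "a \<in> GA p n"
  shows "a = (\<Sum>\<sigma>\<in>perms n. ga_smult (a \<sigma>) (ga_of \<sigma>))"
proof
  fix \<rho>
  have "(\<Sum>\<sigma>\<in>perms n. a \<sigma> * ga_of \<sigma> \<rho>) = (\<Sum>\<sigma>\<in>perms n. if \<sigma> = \<rho> then a \<sigma> else 0)"
    by (intro sum.cong) (auto simp: ga_of_def)
  then show "a \<rho> = (\<Sum>\<sigma>\<in>perms n. ga_smult (a \<sigma>) (ga_of \<sigma>)) \<rho>"
    using GA_D[OF assms] by (auto simp: sum_fun_apply finite_perms)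
qed

lemma rsub_GA_induct:
  assumes "rsub p T" "\<And>\<sigma>. \<sigma> \<in> perms n \<Longrightarrow> ga_of \<sigma> \<in> T" "a \<in> GA p n"
  shows "a \<in> T"
proof -
  have "(\<Sum>\<sigma>\<in>perms n. ga_smult (a \<sigma>) (ga_of \<sigma>)) \<in> T"
    using assms by (intro rsub_sum rsub_smult) (auto simp: GA_def)
  then show ?thesis using GA_expand[OF assms(3)] by simp
qed

lemma rsub_vimage_mult_left:
  assumes "rsub p T" shows "rsub p {a. ga_mult n a b \<in> T}"
  using assms by (auto simp: rsub_def ga_mult_add_left ga_mult_smult_left)

lemma rsub_vimage_mult_right:
  assumes "rsub p T" shows "rsub p {b. ga_mult n a b \<in> T}"
  using assms by (auto simp: rsub_def ga_mult_add_right ga_mult_smult_right)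

section \<open>The anti-involution of the group algebra\<close>

text \<open>The guard matters: \<open>inv\<close> of a map that is not bijective is arbitrary and
  could be a permutation. As the two words of \<open>rmatch\<close> are exchanged, statements on
  left multiplication yield those on right multiplication.\<close>

definition ga_star :: "ga \<Rightarrow> ga" where
  "ga_star a = (\<lambda>\<sigma>. if bij \<sigma> then a (inv \<sigma>) else 0)"

lemma ga_star_add: "ga_star (a + b) = ga_star a + ga_star b"
  and ga_star_smult: "ga_star (ga_smult r a) = ga_smult r (ga_star a)"
  and ga_star_0: "ga_star 0 = 0"
  by (auto simp: ga_star_def fun_eq_iff)

lemma ga_star_diff: "ga_star (a - b) = ga_star a - ga_star b"
  by (auto simp: ga_star_def fun_eq_iff)

lemma ga_star_sum: "ga_star (\<Sum>i\<in>I. F i) = (\<Sum>i\<in>I. ga_star (F i))"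
  by (induction I rule: infinite_finite_induct)
     (simp_all only: ga_star_add ga_star_0 sum.infinite sum.empty sum.insert not_False_eq_True)

lemma rsub_vimage_star: "rsub p T \<Longrightarrow> rsub p {a. ga_star a \<in> T}"
  by (auto simp: rsub_def ga_star_add ga_star_smult ga_star_0)

section \<open>Words and row-matching elements\<close>

text \<open>Rows are numbered from 1 as in \<open>nodes\<close>. The value 0 at i = 0 and beyond the
  last row forces the letters of a word of type \<open>lam\<close> to be row numbers.\<close>

definition part :: "nat list \<Rightarrow> nat \<Rightarrow> nat" where
  "part lam i = (if 1 \<le> i \<and> i \<le> length lam then lam ! (i - 1) else 0)"

definition psum :: "nat list \<Rightarrow> nat \<Rightarrow> nat" where
  "psum lam k = (\<Sum>i=1..k. part lam i)"

text \<open>The Murphy element \<open>x\<^sub>s\<^sub>t\<close> is \<open>rmatch\<close> of the row words of \<open>s\<close> and \<open>t\<close>; see \<open>xst_eq\<close>.\<close>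

definition rmatch :: "nat \<Rightarrow> (nat \<Rightarrow> nat) \<Rightarrow> (nat \<Rightarrow> nat) \<Rightarrow> ga" where
  "rmatch n f g = (\<lambda>\<sigma>. if \<sigma> \<in> perms n \<and> (\<forall>k\<in>{1..n}. g (\<sigma> k) = f k) then 1 else 0)"

text \<open>A word sends each entry to its row, so these are the tabloids of shape
  \<open>lam\<close>. The value 0 outside {1..n} makes a word determined by its letters.\<close>

definition words :: "nat \<Rightarrow> nat list \<Rightarrow> (nat \<Rightarrow> nat) set" where
  "words n lam = {f. (\<forall>i. card {k\<in>{1..n}. f k = i} = part lam i) \<and> (\<forall>k. k \<notin> {1..n} \<longrightarrow> f k = 0)}"

text \<open>Ballot (Yamanouchi) words; for a partition they are exactly the row words of standard
  tableaux, see \<open>rword_lattice\<close> and \<open>lattice_standard\<close>.\<close>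

definition lattice :: "nat \<Rightarrow> (nat \<Rightarrow> nat) \<Rightarrow> bool" where
  "lattice n f \<longleftrightarrow> (\<forall>m\<le>n. \<forall>i\<ge>1. card {k\<in>{1..m}. f k = Suc i} \<le> card {k\<in>{1..m}. f k = i})"

text \<open>The measure for straightening and for triangularity: it grows when a letter is exchanged
  with a smaller one further to the right.\<close>

definition wt :: "nat \<Rightarrow> (nat \<Rightarrow> nat) \<Rightarrow> nat" where
  "wt n f = (\<Sum>k=1..n. k * f k)"

text \<open>Strict dominance of the type of a word over \<open>\<lambda>\<close>; the sets \<open>K\<close> of row numbers replace
sorting the rows by length.\<close>

definition sdom :: "nat \<Rightarrow> (nat \<Rightarrow> nat) \<Rightarrow> nat list \<Rightarrow> bool" where
  "sdom n g lam \<longleftrightarrow>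
    (\<forall>k. \<exists>K. finite K \<and> card K \<le> k \<and> psum lam k \<le> card {x\<in>{1..n}. g x \<in> K}) \<and>
    (\<exists>k K. finite K \<and> card K \<le> k \<and> psum lam k < card {x\<in>{1..n}. g x \<in> K})"

text \<open>Only g is restricted, since a nonzero \<open>rmatch n f g\<close> has two words of the
  same type. The words may be nonstandard and their types unsorted, which makes closure under
  multiplication immediate.\<close>

definition dom_ideal :: "nat \<Rightarrow> nat \<Rightarrow> nat list \<Rightarrow> ga set" where
  "dom_ideal p n lam = rspan p {rmatch n f g | f g. sdom n g lam}"

section \<open>Row-matching elements under multiplication, inversion and renaming\<close>

lemma rmatch_cong:
  assumes "\<And>k. k \<in> {1..n} \<Longrightarrow> f k = f' k" "\<And>k. k \<in> {1..n} \<Longrightarrow> g k = g' k"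
  shows "rmatch n f g = rmatch n f' g'"
  using assms perms_in unfolding rmatch_def by (intro ext if_cong conj_cong ball_cong refl) metis

lemma rmatch_left:
  assumes "\<pi> \<in> perms n"
  shows "ga_mult n (ga_of \<pi>) (rmatch n f g) = rmatch n (f \<circ> \<pi>) g"
proof
  fix \<rho>
  have "(\<forall>k\<in>{1..n}. g (\<rho> (inv \<pi> k)) = f k) \<longleftrightarrow> (\<forall>k\<in>{1..n}. g (\<rho> k) = f (\<pi> k))"
    using perms_in[OF assms] perms_in[OF perms_inv[OF assms]] perms_inv_apply[OF assms] by metis
  then show "ga_mult n (ga_of \<pi>) (rmatch n f g) \<rho> = rmatch n (f \<circ> \<pi>) g \<rho>"
    using assms by (auto simp: ga_of_mult rmatch_def perms_comp perms_inv)
qed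

lemma rmatch_right:
  assumes "\<pi> \<in> perms n"
  shows "ga_mult n (rmatch n f g) (ga_of \<pi>) = rmatch n f (g \<circ> inv \<pi>)"
  using assms by (auto simp: mult_ga_of rmatch_def perms_comp perms_inv fun_eq_iff)

lemma rmatch_star: "ga_star (rmatch n f g) = rmatch n g f"
proof
  fix \<sigma>
  show "ga_star (rmatch n f g) \<sigma> = rmatch n g f \<sigma>"
  proof (cases "\<sigma> \<in> perms n")
    case True
    have "(\<forall>k\<in>{1..n}. g (inv \<sigma> k) = f k) \<longleftrightarrow> (\<forall>k\<in>{1..n}. f (\<sigma> k) = g k)"
      using perms_in[OF True] perms_in[OF perms_inv[OF True]] perms_inv_apply[OF True] by metis
    then show ?thesis using True by (simp add: ga_star_def rmatch_def perms_inv perms_bij)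
  next
    case False
    then have "bij \<sigma> \<Longrightarrow> inv \<sigma> \<notin> perms n" using perms_inv inv_inv_eq by metis
    then show ?thesis using False by (simp add: ga_star_def rmatch_def)
  qed
qed

lemma rmatch_GA: "prime p \<Longrightarrow> rmatch n f g \<in> GA p n"
  by (auto simp: GA_def rmatch_def)

lemma rmatch_eq_0:
  assumes "\<not> (\<exists>\<sigma>\<in>perms n. \<forall>k\<in>{1..n}. g (\<sigma> k) = f k)" shows "rmatch n f g = 0"
  using assms by (auto simp: rmatch_def fun_eq_iff)

lemma card_perm_vimage:
  assumes "\<sigma> \<in> perms n"
  shows "card {k\<in>{1..n}. P (\<sigma> k)} = card {k\<in>{1..n}. P k}"
proof -
  have "bij_betw \<sigma> {k\<in>{1..n}. P (\<sigma> k)} {k\<in>{1..n}. P k}"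
    unfolding bij_betw_def
  proof
    show "inj_on \<sigma> {k\<in>{1..n}. P (\<sigma> k)}"
      using perms_bij[OF assms] bij_is_inj inj_on_subset by blast
    show "\<sigma> ` {k\<in>{1..n}. P (\<sigma> k)} = {k\<in>{1..n}. P k}"
    proof (intro equalityI subsetI)
      fix y assume y: "y \<in> {k\<in>{1..n}. P k}"
      then have "\<sigma> (inv \<sigma> y) = y" "inv \<sigma> y \<in> {1..n}"
        using assms perms_in[OF perms_inv[OF assms], of y] by auto
      then have "inv \<sigma> y \<in> {k\<in>{1..n}. P (\<sigma> k)}" using y by simp
      then show "y \<in> \<sigma> ` {k\<in>{1..n}. P (\<sigma> k)}" using \<open>\<sigma> (inv \<sigma> y) = y\<close> by (metis imageI)
    qed (use perms_in[OF assms] in blast)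
  qed
  then show ?thesis by (rule bij_betw_same_card)
qed

text \<open>Any permutation in the support carries the letters of f to those of g.\<close>

lemma rmatch_type:
  assumes "rmatch n f g \<noteq> 0"
  shows "card {k\<in>{1..n}. P (f k)} = card {k\<in>{1..n}. P (g k)}"
proof -
  have "\<exists>\<sigma>\<in>perms n. \<forall>k\<in>{1..n}. g (\<sigma> k) = f k"
    using rmatch_eq_0[of n g f] assms by (rule contrapos_np[rotated])
  then obtain \<sigma> where s: "\<sigma> \<in> perms n" "\<forall>k\<in>{1..n}. g (\<sigma> k) = f k" by blast
  have "{k\<in>{1..n}. P (f k)} = {k\<in>{1..n}. P (g (\<sigma> k))}"
    using s(2) by (intro Collect_cong conj_cong refl) (simp only:)
  then show ?thesis using card_perm_vimage[OF s(1), of "\<lambda>x. P (g x)"] by (simp only:)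
qed

text \<open>With pairwise distinct letters nothing is summed. This is how the whole group algebra is
  reached in \<open>torsion_GA\<close>.\<close>

lemma rmatch_id: "\<sigma> \<in> perms n \<Longrightarrow> ga_of \<sigma> = rmatch n \<sigma> id"
proof
  fix \<tau> assume s: "\<sigma> \<in> perms n"
  have "\<tau> \<in> perms n \<Longrightarrow> \<forall>k\<in>{1..n}. \<tau> k = \<sigma> k \<Longrightarrow> \<tau> = \<sigma>"
    using s perms_out by (intro ext) metis
  then show "ga_of \<sigma> \<tau> = rmatch n \<sigma> id \<tau>" using s by (auto simp: ga_of_def rmatch_def)
qed

text \<open>Only the pattern of equal letters matters, so rows may be renumbered;
  \<open>sdom_words\<close> uses this to sort them by length.\<close>

lemma rmatch_rename:
  assumes "inj_on h (f ` {1..n} \<union> g ` {1..n})"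
  shows "rmatch n (h \<circ> f) (h \<circ> g) = rmatch n f g"
proof -
  have "h (g (\<sigma> k)) = h (f k) \<longleftrightarrow> g (\<sigma> k) = f k" if "\<sigma> \<in> perms n" "k \<in> {1..n}" for \<sigma> k
    using inj_on_eq_iff[OF assms] that perms_in[OF that(1)] by blast
  then show ?thesis unfolding rmatch_def by (intro ext if_cong conj_cong ball_cong refl) auto
qed

section \<open>The ideal of elements of strictly dominating type\<close>

lemma dom_ideal_rsub: "prime p \<Longrightarrow> rsub p (dom_ideal p n lam)"
  unfolding dom_ideal_def by (rule rspan_rsub)

lemma dom_ideal_base: "prime p \<Longrightarrow> sdom n g lam \<Longrightarrow> rmatch n f g \<in> dom_ideal p n lam"
  unfolding dom_ideal_def by (rule rspan_base) auto

lemma dom_ideal_minimal: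
  assumes "rsub p T" "\<And>f g. sdom n g lam \<Longrightarrow> rmatch n f g \<in> T" shows "dom_ideal p n lam \<subseteq> T"
  unfolding dom_ideal_def using assms by (intro rspan_minimal) auto

lemma sdom_star: "rmatch n f g \<noteq> 0 \<Longrightarrow> sdom n g lam \<Longrightarrow> sdom n f lam"
proof -
  assume X: "rmatch n f g \<noteq> 0" and s: "sdom n g lam"
  have eq: "card {x\<in>{1..n}. f x \<in> K} = card {x\<in>{1..n}. g x \<in> K}" for K
    using rmatch_type[OF X, of "\<lambda>x. x \<in> K"] .
  show ?thesis unfolding sdom_def eq using s unfolding sdom_def .
qed

lemma dom_ideal_star: "prime p \<Longrightarrow> a \<in> dom_ideal p n lam \<Longrightarrow> ga_star a \<in> dom_ideal p n lam"
proof -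
  assume p: "prime p" and a: "a \<in> dom_ideal p n lam"
  have "dom_ideal p n lam \<subseteq> {a. ga_star a \<in> dom_ideal p n lam}"
  proof (rule dom_ideal_minimal[OF rsub_vimage_star[OF dom_ideal_rsub[OF p]]])
    fix f g assume "sdom n g lam"
    then have "rmatch n g f \<in> dom_ideal p n lam" if "rmatch n f g \<noteq> 0"
      using sdom_star[OF that] dom_ideal_base[OF p] by blast
    moreover have "ga_star 0 \<in> dom_ideal p n lam" using rsub_0[OF dom_ideal_rsub[OF p]] ga_star_0 by metis
    ultimately show "rmatch n f g \<in> {a. ga_star a \<in> dom_ideal p n lam}"
      unfolding mem_Collect_eq by (metis rmatch_star)
  qed
  then show ?thesis using a by blast
qed

lemma dom_ideal_left:
  assumes "prime p" "a \<in> GA p n" "b \<in> dom_ideal p n lam" shows "ga_mult n a b \<in> dom_ideal p n lam"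
proof -
  have "dom_ideal p n lam \<subseteq> {b. ga_mult n (ga_of \<sigma>) b \<in> dom_ideal p n lam}" if "\<sigma> \<in> perms n" for \<sigma>
    by (rule dom_ideal_minimal[OF rsub_vimage_mult_right[OF dom_ideal_rsub[OF assms(1)]]])
       (simp only: mem_Collect_eq rmatch_left[OF that] dom_ideal_base[OF assms(1)])
  then have "a \<in> {a. ga_mult n a b \<in> dom_ideal p n lam}"
    using assms(3) by (intro rsub_GA_induct[OF rsub_vimage_mult_left[OF dom_ideal_rsub[OF assms(1)]] _ assms(2)]) blast
  then show ?thesis unfolding mem_Collect_eq .
qed

section \<open>Words of a fixed type\<close>

lemma words_D:
  assumes "f \<in> words n lam"
  shows "card {k\<in>{1..n}. f k = i} = part lam i" "k \<notin> {1..n} \<Longrightarrow> f k = 0"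
  using assms by (auto simp: words_def)

lemma words_range:
  assumes "f \<in> words n lam" "k \<in> {1..n}" shows "1 \<le> f k" "f k \<le> length lam"
proof -
  have "card {j\<in>{1..n}. f j = f k} \<noteq> 0" using assms by auto
  then have "part lam (f k) \<noteq> 0" using words_D[OF assms(1)] by metis
  then show "1 \<le> f k" "f k \<le> length lam" by (auto simp: part_def split: if_splits)
qed

lemma words_comp: "f \<in> words n lam \<Longrightarrow> \<sigma> \<in> perms n \<Longrightarrow> f \<circ> \<sigma> \<in> words n lam"
  using card_perm_vimage[of \<sigma> n "\<lambda>x. f x = _"] perms_out[of \<sigma> n] by (auto simp: words_def)

lemma finite_words: "finite (words n lam)"
proof (rule finite_subset)
  show "words n lam \<subseteq> {f. \<forall>x. (x \<in> {1..n} \<longrightarrow> f x \<in> {0..length lam}) \<and> (x \<notin> {1..n} \<longrightarrow> f x = 0)}"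
    using words_range words_D by fastforce
qed (rule finite_set_of_finite_funs; simp)

lemma words_eqI:
  assumes "f \<in> words n lam" "g \<in> words n mu" "\<And>k. k \<in> {1..n} \<Longrightarrow> f k = g k" shows "f = g"
  using assms words_D(2) by (intro ext) metis

lemma card_fibres:
  assumes "finite K" "finite A"
  shows "card {x\<in>A. g x \<in> K} = (\<Sum>i\<in>K. card {x\<in>A. g x = i})"
proof -
  have "{x\<in>A. g x \<in> K} = (\<Union>i\<in>K. {x\<in>A. g x = i})" by auto
  then show ?thesis using assms by (simp only:) (rule card_UN_disjoint; auto)
qed

lemma words_psum: "g \<in> words n lam \<Longrightarrow> card {x\<in>{1..n}. g x \<in> {1..k}} = psum lam k"
  unfolding psum_def using words_D(1) by (subst card_fibres) (simp_all only: finite_atLeastAtMost)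

text \<open>Moving entries to earlier rows never lowers the number of entries in the first k rows.
  The dominating words in the Garnir relations all arise in this way.\<close>

lemma sdom_lower:
  assumes g: "g \<in> words n lam" and le: "\<And>x. x \<in> {1..n} \<Longrightarrow> 1 \<le> g' x \<and> g' x \<le> g x"
    and x: "x \<in> {1..n}" "g' x < g x"
  shows "sdom n g' lam"
proof -
  have sub: "{x\<in>{1..n}. g x \<in> {1..k}} \<subseteq> {x\<in>{1..n}. g' x \<in> {1..k}}" for k
    using le by fastforce
  have "psum lam k \<le> card {x\<in>{1..n}. g' x \<in> {1..k}}" for k
    unfolding words_psum[OF g, symmetric] using sub by (intro card_mono) auto
  \<comment> \<open>Strictness shows at the new row of x: for g' the first \<open>g' x\<close> rows
    contain x, for g they do not.\<close>
  moreover have "psum lam (g' x) < card {y\<in>{1..n}. g' y \<in> {1..g' x}}"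
  proof -
    have "x \<in> {y\<in>{1..n}. g' y \<in> {1..g' x}} - {y\<in>{1..n}. g y \<in> {1..g' x}}"
      using x le by auto
    then show ?thesis unfolding words_psum[OF g, symmetric] using sub[of "g' x"]
      by (intro psubset_card_mono) auto
  qed
  moreover have "finite {1..k::nat}" "card {1..k::nat} \<le> k" for k by auto
  ultimately show ?thesis unfolding sdom_def by blast
qed

section \<open>Garnir relations\<close>

text \<open>The condition defining \<open>Garnir_elt\<close> prescribes the union of the rows \<open>a\<close> and \<open>b\<close> but, within it,
only the positions \<open>L\<close> (row \<open>a\<close>) and \<open>C\<close> (row \<open>b\<close>). It lies in \<open>dom_ideal\<close> as soon as
fewer positions are prescribed than row \<open>b\<close> has entries: for \<open>L = {}\<close> it can be rewritten with
entries of row \<open>b\<close> moved up to row \<open>a\<close>, and elements of \<open>L\<close> are added by inclusion--exclusion.\<close>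

definition Garnir_elt :: "nat \<Rightarrow> (nat \<Rightarrow> nat) \<Rightarrow> (nat \<Rightarrow> nat) \<Rightarrow> nat \<Rightarrow> nat \<Rightarrow> nat set \<Rightarrow> nat set \<Rightarrow> ga" where
  "Garnir_elt n f g a b L C = (\<lambda>\<sigma>. if \<sigma> \<in> perms n \<and> (\<forall>k\<in>{1..n}. f k \<notin> {a, b} \<longrightarrow> g (\<sigma> k) = f k)
      \<and> (\<forall>k\<in>{1..n}. f k \<in> {a, b} \<longrightarrow> g (\<sigma> k) \<in> {a, b})
      \<and> (\<forall>k\<in>L. g (\<sigma> k) = a) \<and> (\<forall>k\<in>C. g (\<sigma> k) = b) then 1 else 0)"

text \<open>The permutations satisfying the condition are sorted by the image D of C. Entries of row
  b outside D are merged into row a, which does not affect the condition. Since C is too small to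
  fill row b, at least one entry moves up, and every summand has dominating type.\<close>

lemma Garnir_elt_empty_dom_ideal:
  assumes p: "prime p" and g: "g \<in> words n lam" and ab: "1 \<le> a" "a < b"
    and C: "C \<subseteq> {k\<in>{1..n}. f k \<in> {a, b}}" "card C < part lam b"
  shows "Garnir_elt n f g a b {} C \<in> dom_ideal p n lam"
proof -
  define G where "G = {x\<in>{1..n}. g x = b}"
  define f' where "f' k = (if f k \<in> {a, b} then if k \<in> C then b else a else f k)" for k
  define g' where "g' D x = (if g x \<in> {a, b} then if x \<in> D then b else a else g x)" for D x
  define I where "I = {D. D \<subseteq> G \<and> card D = card C}"
  have finG: "finite G" and finC: "finite C"
    using C by (auto simp: G_def intro: finite_subset)
  have finI: "finite I" using finG unfolding I_def by simp
  have "Garnir_elt n f g a b {} C = (\<Sum>D\<in>I. rmatch n f' (g' D))"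
  proof
    fix \<sigma>
    show "Garnir_elt n f g a b {} C \<sigma> = (\<Sum>D\<in>I. rmatch n f' (g' D)) \<sigma>"
    proof (cases "\<sigma> \<in> perms n")
      case s: True
      have inj: "inj \<sigma>" using perms_bij[OF s] bij_is_inj by blast
      define W where "W \<longleftrightarrow> (\<forall>k\<in>{1..n}. f k \<notin> {a, b} \<longrightarrow> g (\<sigma> k) = f k)
        \<and> (\<forall>k\<in>{1..n}. f k \<in> {a, b} \<longrightarrow> g (\<sigma> k) \<in> {a, b}) \<and> (\<forall>k\<in>C. g (\<sigma> k) = b)"
      \<comment> \<open>For a fixed \<sigma> only one D contributes: the image of C lies in D, and
        equal cardinalities make it all of D.\<close>
      have eq: "(\<forall>k\<in>{1..n}. g' D (\<sigma> k) = f' k) \<longleftrightarrow> W \<and> D = \<sigma> ` C" if D: "D \<in> I" for D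
      proof
        assume *: "\<forall>k\<in>{1..n}. g' D (\<sigma> k) = f' k"
        have 1: "f k \<notin> {a, b} \<longrightarrow> g (\<sigma> k) = f k" "f k \<in> {a, b} \<longrightarrow> g (\<sigma> k) \<in> {a, b}" if "k \<in> {1..n}" for k
          using *[rule_format, OF that] by (auto simp: f'_def g'_def split: if_splits)
        have 2: "\<sigma> k \<in> D" if "k \<in> C" for k
          using *[rule_format, of k] C that ab by (auto simp: f'_def g'_def split: if_splits)
        then have "\<sigma> ` C \<subseteq> D" by auto
        moreover have "card (\<sigma> ` C) = card D" using inj D by (simp add: I_def card_image inj_on_def)
        moreover have "finite D" using D finG finite_subset by (auto simp: I_def)
        ultimately have "D = \<sigma> ` C" by (metis card_subset_eq)
        moreover have "\<forall>k\<in>C. g (\<sigma> k) = b" using 2 D by (auto simp: I_def G_def)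
        ultimately show "W \<and> D = \<sigma> ` C" using 1 by (auto simp: W_def)
      next
        assume *: "W \<and> D = \<sigma> ` C"
        then have "\<sigma> k \<in> D \<longleftrightarrow> k \<in> C" for k using inj by (auto simp: inj_def)
        then show "\<forall>k\<in>{1..n}. g' D (\<sigma> k) = f' k" using * unfolding W_def f'_def g'_def by auto
      qed
      have mem: "\<sigma> ` C \<in> I" if W
      proof -
        have "card (\<sigma> ` C) = card C" using inj by (simp add: card_image inj_on_def)
        moreover have "\<sigma> k \<in> G" if k: "k \<in> C" for k
        proof -
          have "k \<in> {1..n}" using k C by blast
          then have "\<sigma> k \<in> {1..n}" using perms_in[OF s, of k] by blast
          then show ?thesis using \<open>W\<close> k by (simp add: W_def G_def)
        qed
        ultimately show ?thesis by (auto simp: I_def)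
      qed
      have "(\<Sum>D\<in>I. rmatch n f' (g' D)) \<sigma> = (\<Sum>D\<in>I. if D = \<sigma> ` C then (if W then 1 else 0) else 0)"
        unfolding sum_fun_apply by (intro sum.cong refl) (use s eq in \<open>auto simp: rmatch_def\<close>)
      also have "\<dots> = (if W then 1 else 0)" using finI mem by auto
      also have "\<dots> = Garnir_elt n f g a b {} C \<sigma>" using s by (simp add: Garnir_elt_def W_def)
      finally show ?thesis by simp
    qed (simp add: Garnir_elt_def rmatch_def sum_fun_apply)
  qed
  moreover have "rmatch n f' (g' D) \<in> dom_ideal p n lam" if D: "D \<in> I" for D
  proof -
    have "card D < card G" using D C words_D(1)[OF g, of b] by (simp add: I_def G_def)
    then have "\<not> G \<subseteq> D" using D finG finite_subset card_mono by (metis (no_types, lifting) I_def leD mem_Collect_eq)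
    then obtain x where "x \<in> G" "x \<notin> D" by auto
    then have "sdom n (g' D) lam"
      using ab words_range[OF g] D by (intro sdom_lower[OF g, where x=x]) (auto simp: g'_def G_def I_def)
    then show ?thesis by (rule dom_ideal_base[OF p])
  qed
  ultimately show ?thesis by (simp only:) (rule rsub_sum[OF dom_ideal_rsub[OF p]])
qed

text \<open>The induction over L keeps C arbitrary because an element taken out of L may enter C;
  the bound on \<open>card L + card C\<close> survives this exchange.\<close>

lemma Garnir_elt_dom_ideal:
  assumes p: "prime p" and g: "g \<in> words n lam" and ab: "1 \<le> a" "a < b"
    and "finite L" "L \<union> C \<subseteq> {k\<in>{1..n}. f k \<in> {a, b}}" "card L + card C < part lam b"
  shows "Garnir_elt n f g a b L C \<in> dom_ideal p n lam"
  using assms(5-7)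
proof (induction L arbitrary: C rule: finite_induct)
  case empty
  then show ?case by (intro Garnir_elt_empty_dom_ideal[OF p g ab]) auto
next
  case (insert x L)
  have "C \<subseteq> {1..n}" using insert.prems by auto
  then have "finite C" using finite_subset by blast
  then have "card (insert x C) \<le> Suc (card C)" by (simp add: card_insert_if)
  then have "Garnir_elt n f g a b L C \<in> dom_ideal p n lam" "Garnir_elt n f g a b L (insert x C) \<in> dom_ideal p n lam"
    using insert.prems insert.hyps by (intro insert.IH; auto)+
  \<comment> \<open>As x lies in the union of the two rows, it is sent to row a or to row b;
    demanding a is demanding nothing minus demanding b.\<close>
  moreover have "Garnir_elt n f g a b (insert x L) C = Garnir_elt n f g a b L C - Garnir_elt n f g a b L (insert x C)"
  proof
    fix \<sigma>
    define B where "B \<longleftrightarrow> \<sigma> \<in> perms n \<and> (\<forall>k\<in>{1..n}. f k \<notin> {a, b} \<longrightarrow> g (\<sigma> k) = f k)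
      \<and> (\<forall>k\<in>{1..n}. f k \<in> {a, b} \<longrightarrow> g (\<sigma> k) \<in> {a, b})
      \<and> (\<forall>k\<in>L. g (\<sigma> k) = a) \<and> (\<forall>k\<in>C. g (\<sigma> k) = b)"
    have "Garnir_elt n f g a b (insert x L) C \<sigma> = (if B \<and> g (\<sigma> x) = a then 1 else 0)"
      "Garnir_elt n f g a b L (insert x C) \<sigma> = (if B \<and> g (\<sigma> x) = b then 1 else 0)"
      "Garnir_elt n f g a b L C \<sigma> = (if B then 1 else 0)"
      unfolding Garnir_elt_def B_def ball_simps by (simp_all only: conj_ac)
    moreover have "x \<in> {1..n}" "f x \<in> {a, b}" using insert.prems by auto
    then have "B \<Longrightarrow> g (\<sigma> x) \<in> {a, b}" unfolding B_def by blast
    ultimately show "Garnir_elt n f g a b (insert x L) C \<sigma> = (Garnir_elt n f g a b L C - Garnir_elt n f g a b L (insert x C)) \<sigma>"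
      using ab by auto
  qed
  ultimately show ?case using rsub_diff[OF p dom_ideal_rsub[OF p]] by metis
qed

definition Garnir_words :: "nat \<Rightarrow> nat list \<Rightarrow> (nat \<Rightarrow> nat) \<Rightarrow> nat \<Rightarrow> nat \<Rightarrow> nat set \<Rightarrow> nat set \<Rightarrow> (nat \<Rightarrow> nat) set" where
  "Garnir_words n lam f a b L C = {f' \<in> words n lam. (\<forall>k\<in>{1..n}. f k \<notin> {a, b} \<longrightarrow> f' k = f k)
      \<and> (\<forall>k\<in>{1..n}. f k \<in> {a, b} \<longrightarrow> f' k \<in> {a, b}) \<and> (\<forall>k\<in>L. f' k = a) \<and> (\<forall>k\<in>C. f' k = b)}"

text \<open>Each \<sigma> is counted by exactly one word of type \<open>lam\<close>, namely
  \<open>g \<circ> \<sigma>\<close>, so a condition on \<sigma> turns into a sum over the words it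
  allows.\<close>

lemma Garnir_elt_eq_sum:
  assumes g: "g \<in> words n lam" and LC: "L \<subseteq> {1..n}" "C \<subseteq> {1..n}"
  shows "Garnir_elt n f g a b L C = (\<Sum>f'\<in>Garnir_words n lam f a b L C. rmatch n f' g)"
proof
  fix \<sigma>
  have fin: "finite (Garnir_words n lam f a b L C)" unfolding Garnir_words_def using finite_words by simp
  show "Garnir_elt n f g a b L C \<sigma> = (\<Sum>f'\<in>Garnir_words n lam f a b L C. rmatch n f' g) \<sigma>"
  proof (cases "\<sigma> \<in> perms n")
    case s: True
    define h where "h = g \<circ> \<sigma>"
    have h: "h \<in> words n lam" unfolding h_def using words_comp g s by blast
    have "rmatch n f' g \<sigma> = (if f' = h then 1 else 0)" if "f' \<in> Garnir_words n lam f a b L C" for f'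
      using that s words_eqI[OF h, of f'] by (auto simp: rmatch_def h_def Garnir_words_def)
    then have "(\<Sum>f'\<in>Garnir_words n lam f a b L C. rmatch n f' g) \<sigma> = (\<Sum>f'\<in>Garnir_words n lam f a b L C. if f' = h then 1 else 0)"
      by (simp add: sum_fun_apply)
    also have "\<dots> = (if h \<in> Garnir_words n lam f a b L C then 1 else 0)" using fin by simp
    also have "\<dots> = Garnir_elt n f g a b L C \<sigma>" using s h by (auto simp: Garnir_elt_def Garnir_words_def h_def)
    finally show ?thesis by simp
  qed (simp add: Garnir_elt_def rmatch_def sum_fun_apply)
qed

lemma Garnir:
  assumes "prime p" "g \<in> words n lam" "1 \<le> a" "a < b"
    "L \<union> C \<subseteq> {k\<in>{1..n}. f k \<in> {a, b}}" "card L + card C < part lam b"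
  shows "(\<Sum>f'\<in>Garnir_words n lam f a b L C. rmatch n f' g) \<in> dom_ideal p n lam"
proof -
  have LC: "L \<subseteq> {1..n}" "C \<subseteq> {1..n}" using assms(5) by auto
  then have "finite L" using finite_subset by blast
  then show ?thesis using Garnir_elt_dom_ideal[OF assms(1-4) _ assms(5,6)] Garnir_elt_eq_sum[OF assms(2) LC, of f a b] by simp
qed

section \<open>Straightening by weight\<close>

lemma words_sum: "f \<in> words n lam \<Longrightarrow> (\<Sum>k=1..n. f k) = (\<Sum>i\<le>length lam. part lam i * i)"
proof -
  assume f: "f \<in> words n lam"
  then have "f ` {1..n} \<subseteq> {..length lam}" using words_range by force
  then show ?thesis using sum_fun_comp[of "{1..n}" "{..length lam}" f "\<lambda>x. x"] words_D(1)[OF f] by simp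
qed

text \<open>Words of one type have the same letter sum, so positions may be measured from m: the
  difference of the weights is the sum of \<open>(int k - int m) * d k\<close>, where no term is
  negative.\<close>

lemma wt_less:
  assumes f: "f \<in> words n lam" and f': "f' \<in> words n lam" and ne: "f' \<noteq> f"
    and le: "\<And>k. k \<in> {1..n} \<Longrightarrow> k \<le> m \<Longrightarrow> f' k \<le> f k"
    and ge: "\<And>k. k \<in> {1..n} \<Longrightarrow> m < k \<Longrightarrow> f k \<le> f' k"
  shows "wt n f < wt n f'"
proof -
  define d where "d k = int (f' k) - int (f k)" for k
  have sd: "(\<Sum>k=1..n. d k) = 0"
    using words_sum[OF f] words_sum[OF f'] unfolding d_def sum_subtractf
    by (metis cancel_comm_monoid_add_class.diff_cancel of_nat_sum)
  have pos: "(int k - int m) * d k \<ge> 0" if "k \<in> {1..n}" for k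
    using le[OF that] ge[OF that] by (cases "k \<le> m") (auto simp: d_def mult_nonpos_nonpos)
  have "(\<Sum>k=1..n. (int k - int m) * d k) = int (wt n f') - int (wt n f) - int m * (\<Sum>k=1..n. d k)"
    unfolding wt_def d_def by (simp add: algebra_simps sum.distrib sum_subtractf sum_distrib_left)
  then have eq: "(\<Sum>k=1..n. (int k - int m) * d k) = int (wt n f') - int (wt n f)" using sd by simp
  have "(\<Sum>k=1..n. (int k - int m) * d k) \<noteq> 0"
  proof
    assume "(\<Sum>k=1..n. (int k - int m) * d k) = 0"
    then have z: "\<forall>k\<in>{1..n}. (int k - int m) * d k = 0"
      using pos by (subst (asm) sum_nonneg_eq_0_iff) auto
    then have z': "d k = 0" if "k \<in> {1..n}" "k \<noteq> m" for k using that by fastforce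
    \<comment> \<open>The factor vanishes at k = m, so this letter has to be recovered from the
      equality of the letter sums.\<close>
    have "d m = 0" if "m \<in> {1..n}"
    proof -
      have "(\<Sum>k=1..n. d k) = d m" using z' that by (subst sum.remove[of _ m]) auto
      then show ?thesis using sd by simp
    qed
    then have "f' k = f k" if "k \<in> {1..n}" for k using that z' by (cases "k = m") (auto simp: d_def)
    then show False using ne words_eqI[OF f' f] by blast
  qed
  moreover have "(\<Sum>k=1..n. (int k - int m) * d k) \<ge> 0" using pos by (rule sum_nonneg)
  ultimately show ?thesis using eq by linarith
qed

text \<open>Some prefix, of length m, has more letters a + 1 than a. Fixing the letters a inside it
  and the letters a + 1 behind it fixes fewer than \<open>part lam (Suc a)\<close> positions, so a
  Garnir relation applies. In its other words letters can only drop up to m and rise after m, which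
  raises the weight.\<close>

lemma straighten_step:
  assumes p: "prime p" and f: "f \<in> words n lam" and g: "g \<in> words n lam" and ny: "\<not> lattice n f"
    and T: "rsub p T" "dom_ideal p n lam \<subseteq> T"
    and up: "\<And>f'. f' \<in> words n lam \<Longrightarrow> wt n f < wt n f' \<Longrightarrow> rmatch n f' g \<in> T"
  shows "rmatch n f g \<in> T"
proof -
  obtain m a where m: "m \<le> n" "a \<ge> 1" "card {k\<in>{1..m}. f k = a} < card {k\<in>{1..m}. f k = Suc a}"
    using ny unfolding lattice_def by (auto simp: not_le)
  define L where "L = {k\<in>{1..m}. f k = a}"
  define C where "C = {k\<in>{m<..n}. f k = Suc a}"
  have "{k\<in>{1..n}. f k = Suc a} = {k\<in>{1..m}. f k = Suc a} \<union> C" using m by (auto simp: C_def)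
  moreover have "{k\<in>{1..m}. f k = Suc a} \<inter> C = {}" by (auto simp: C_def)
  ultimately have "part lam (Suc a) = card {k\<in>{1..m}. f k = Suc a} + card C"
    using words_D(1)[OF f, of "Suc a"] card_Un_disjoint[of "{k\<in>{1..m}. f k = Suc a}" C] by (simp add: C_def)
  then have lt: "card L + card C < part lam (Suc a)" using m by (simp add: L_def)
  define F where "F = Garnir_words n lam f a (Suc a) L C"
  have "(\<Sum>f'\<in>F. rmatch n f' g) \<in> dom_ideal p n lam" unfolding F_def
    by (rule Garnir[OF p g m(2) _ _ lt]) (use m in \<open>auto simp: L_def C_def\<close>)
  then have 1: "(\<Sum>f'\<in>F. rmatch n f' g) \<in> T" using T by blast
  have fF: "f \<in> F" using f by (auto simp: F_def Garnir_words_def L_def C_def)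
  have "rmatch n f' g \<in> T" if f': "f' \<in> F - {f}" for f'
  proof (rule up)
    show w: "f' \<in> words n lam" using f' by (simp add: F_def Garnir_words_def)
    show "wt n f < wt n f'"
    proof (rule wt_less[OF f w, where m=m])
      show "f' \<noteq> f" using f' by simp
      have *: "f k \<notin> {a, Suc a} \<Longrightarrow> f' k = f k" "f k \<in> {a, Suc a} \<Longrightarrow> f' k \<in> {a, Suc a}"
        "k \<in> L \<Longrightarrow> f' k = a" "k \<in> C \<Longrightarrow> f' k = Suc a" if "k \<in> {1..n}" for k
        using f' that by (auto simp: F_def Garnir_words_def)
      show "f' k \<le> f k" if "k \<in> {1..n}" "k \<le> m" for k
        using *[of k] that by (cases "f k = a"; cases "f k = Suc a") (auto simp: L_def)
      show "f k \<le> f' k" if "k \<in> {1..n}" "m < k" for k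
        using *[of k] that by (cases "f k = a"; cases "f k = Suc a") (auto simp: C_def)
    qed
  qed
  then have 2: "(\<Sum>f'\<in>F - {f}. rmatch n f' g) \<in> T" by (rule rsub_sum[OF T(1)])
  have "finite F" unfolding F_def Garnir_words_def using finite_words by simp
  then have "(\<Sum>f'\<in>F. rmatch n f' g) = rmatch n f g + (\<Sum>f'\<in>F - {f}. rmatch n f' g)" using fF by (rule sum.remove)
  then have "rmatch n f g = (\<Sum>f'\<in>F. rmatch n f' g) - (\<Sum>f'\<in>F - {f}. rmatch n f' g)" by simp
  then show ?thesis using rsub_diff[OF p T(1) 1 2] by simp
qed

lemma wt_bound: "f \<in> words n lam \<Longrightarrow> wt n f \<le> (\<Sum>k=1..n. k * length lam)"
  unfolding wt_def using words_range by (intro sum_mono mult_left_mono) auto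

text \<open>Induction from heavy words to light ones, well-founded by
  \<open>wt_bound\<close>.\<close>

lemma wt_induct [consumes 1]:
  assumes "f \<in> words n lam"
    and "\<And>f. f \<in> words n lam \<Longrightarrow> (\<And>f'. f' \<in> words n lam \<Longrightarrow> wt n f < wt n f' \<Longrightarrow> P f') \<Longrightarrow> P f"
  shows "P f"
  using assms(1)
proof (induction "(\<Sum>k=1..n. k * length lam) - wt n f" arbitrary: f rule: less_induct)
  case less
  show ?case
  proof (rule assms(2)[OF less.prems])
    fix f' assume f': "f' \<in> words n lam" "wt n f < wt n f'"
    then have "(\<Sum>k=1..n. k * length lam) - wt n f' < (\<Sum>k=1..n. k * length lam) - wt n f"
      using wt_bound[OF f'(1)] by linarith
    then show "P f'" using less.hyps f' by blast
  qed
qed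

lemma straighten:
  assumes p: "prime p" and f: "f \<in> words n lam" and g: "g \<in> words n lam"
    and T: "rsub p T" "dom_ideal p n lam \<subseteq> T"
    and y: "\<And>f. f \<in> words n lam \<Longrightarrow> lattice n f \<Longrightarrow> rmatch n f g \<in> T"
  shows "rmatch n f g \<in> T"
  using f
proof (induction rule: wt_induct)
  case (1 f)
  then show ?case using straighten_step[OF p 1(1) g _ T] y by blast
qed

section \<open>Jucys--Murphy elements\<close>

abbreviation tr :: "nat \<Rightarrow> nat \<Rightarrow> nat \<Rightarrow> nat" where "tr \<equiv> Transposition.transpose"

text \<open>Content of k in the row-standard tableau with row word f: its column is one more than
  the number of earlier entries of its row, and the shift by 1 is moved to the row number.\<close>

definition wcont :: "(nat \<Rightarrow> nat) \<Rightarrow> nat \<Rightarrow> int" where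
  "wcont f k = int (card {j\<in>{1..<k}. f j = f k}) - (int (f k) - 1)"

lemma JM_rmatch:
  assumes "k \<in> {1..n}"
  shows "ga_mult n (JM k) (rmatch n f g) = (\<Sum>j\<in>{1..<k}. rmatch n (f \<circ> tr j k) g)"
  unfolding JM_eq ga_mult_sum_left
  by (rule sum.cong[OF refl], rule rmatch_left, rule transpose_perms) (use assms in auto)

lemma rmatch_JM:
  assumes "k \<in> {1..n}"
  shows "ga_mult n (rmatch n g f) (JM k) = (\<Sum>j\<in>{1..<k}. rmatch n g (f \<circ> tr j k))"
  unfolding JM_eq ga_mult_sum_right
proof (rule sum.cong[OF refl])
  fix j assume "j \<in> {1..<k}"
  then have "tr j k \<in> perms n" using assms by (intro transpose_perms) auto
  moreover have "inv (tr j k) = tr j k" by (rule inv_unique_comp) simp_all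
  ultimately show "ga_mult n (rmatch n g f) (ga_of (tr j k)) = rmatch n g (f \<circ> tr j k)"
    using rmatch_right by metis
qed

lemma JM_star: "k \<in> {1..n} \<Longrightarrow> ga_star (ga_mult n (JM k) (rmatch n f g)) = ga_mult n (rmatch n g f) (JM k)"
  by (simp only: JM_rmatch rmatch_JM ga_star_sum rmatch_star)

text \<open>This is the Garnir relation in which row \<open>f k\<close> is prescribed except for k
  itself. One place of that row stays free: either k keeps it, which gives f, or an entry j of row a
  takes it, which gives f with j and k swapped.\<close>

lemma row_exchange:
  assumes p: "prime p" and f: "f \<in> words n lam" and g: "g \<in> words n lam"
    and k: "k \<in> {1..n}" and a: "1 \<le> a" "a < f k"
  shows "rmatch n f g + (\<Sum>j\<in>{j\<in>{1..n}. f j = a}. rmatch n (f \<circ> tr j k) g) \<in> dom_ideal p n lam"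
proof -
  define C where "C = {j\<in>{1..n}. f j = f k} - {k}"
  have Cc: "Suc (card C) = part lam (f k)"
    unfolding C_def words_D(1)[OF f, symmetric] by (rule card_Suc_Diff1) (use k in auto)
  define S where "S = (\<lambda>j. f \<circ> tr j k) ` {j\<in>{1..n}. f j = a}"
  have val: "(f \<circ> tr j k) j = f k" for j by simp
  have Garnir_words: "Garnir_words n lam f a (f k) {} C = insert f S"
  proof (intro equalityI subsetI)
    fix f' assume "f' \<in> Garnir_words n lam f a (f k) {} C"
    then have f': "f' \<in> words n lam" and 1: "\<And>i. i \<in> {1..n} \<Longrightarrow> f i \<notin> {a, f k} \<Longrightarrow> f' i = f i"
      and 2: "\<And>i. i \<in> {1..n} \<Longrightarrow> f i \<in> {a, f k} \<Longrightarrow> f' i \<in> {a, f k}" and 3: "\<And>i. i \<in> C \<Longrightarrow> f' i = f k"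
      by (auto simp: Garnir_words_def)
    define B where "B = {j\<in>{1..n}. f' j = f k}"
    have CB: "C \<subseteq> B" using 3 by (auto simp: B_def C_def)
    \<comment> \<open>The single element j of the difference is the entry that takes the free
      place.\<close>
    have "card (B - C) = 1"
      using Cc words_D(1)[OF f', of "f k"] CB by (subst card_Diff_subset) (auto simp: B_def C_def)
    then obtain j where j: "B - C = {j}" by (rule card_1_singletonE)
    have jB: "j \<in> {1..n}" "f' j = f k" "j \<notin> C" using j by (auto simp: B_def)
    have other: "f' i = a" if "i \<in> {1..n}" "i \<notin> C" "i \<noteq> j" "f i \<in> {a, f k}" for i
    proof -
      have "i \<notin> B" using j that by blast
      then show ?thesis using 2 that by (auto simp: B_def)
    qed
    have "f j \<in> {a, f k}" using 1[OF jB(1)] jB(2) by auto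
    moreover have "j = k" if "f j = f k" using that jB by (auto simp: C_def)
    ultimately consider "j = k" | "f j = a" "j \<noteq> k" by blast
    then show "f' \<in> insert f S"
    proof cases
      case 1: 1
      have "f' = f"
      proof (rule words_eqI[OF f' f])
        fix i assume i: "i \<in> {1..n}"
        show "f' i = f i"
          using \<open>\<And>i. i \<in> {1..n} \<Longrightarrow> f i \<notin> {a, f k} \<Longrightarrow> f' i = f i\<close>[OF i] 3[of i] other[OF i] 1 jB i
          by (cases "i = k"; cases "f i = f k"; cases "f i = a") (auto simp: C_def)
      qed
      then show ?thesis by simp
    next
      case 2: 2
      have "tr j k \<in> perms n" using jB k by (intro transpose_perms)
      then have "f \<circ> tr j k \<in> words n lam" using words_comp f by blast
      then have "f' = f \<circ> tr j k"
      proof (rule words_eqI[OF f'])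
        fix i assume i: "i \<in> {1..n}"
        consider "i = j" | "i = k" | "i \<noteq> j" "i \<noteq> k" by blast
        then show "f' i = (f \<circ> tr j k) i"
        proof cases
          case 1 then show ?thesis using jB by simp
        next
          case c: 2
          then show ?thesis using other[OF i] 2 by (auto simp: C_def)
        next
          case c: 3
          then have "(f \<circ> tr j k) i = f i" by simp
          moreover have "f' i = f i"
            using 1[OF i] 3[of i] other[OF i] c i by (cases "f i = f k"; cases "f i = a") (auto simp: C_def)
          ultimately show ?thesis by simp
        qed
      qed
      then show ?thesis using jB 2 by (auto simp: S_def)
    qed
  next
    fix f' assume "f' \<in> insert f S"
    then consider "f' = f" | j where "j \<in> {1..n}" "f j = a" "f' = f \<circ> tr j k" unfolding S_def by blast
    then show "f' \<in> Garnir_words n lam f a (f k) {} C"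
    proof cases
      case 1
      then show ?thesis using f by (auto simp: Garnir_words_def C_def)
    next
      case 2
      have w: "f' \<in> words n lam" unfolding 2 using words_comp f transpose_perms[OF 2(1) k] by blast
      have "f' i = (if i = j then f k else if i = k then a else f i)" for i
        using 2 by (auto simp: Transposition.transpose_def)
      then show ?thesis using w 2 a by (auto simp: Garnir_words_def C_def)
    qed
  qed
  have inj: "inj_on (\<lambda>j. f \<circ> tr j k) {j\<in>{1..n}. f j = a}"
  proof (rule inj_onI)
    fix i j assume ij: "i \<in> {j\<in>{1..n}. f j = a}" "j \<in> {j\<in>{1..n}. f j = a}" "f \<circ> tr i k = f \<circ> tr j k"
    then have "(f \<circ> tr j k) i = f k" using val[of i] by metis
    then show "i = j" using ij a by (auto simp: Transposition.transpose_def split: if_splits)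
  qed
  have "f \<notin> S"
  proof
    assume "f \<in> S"
    then obtain j where j: "f j = a" "f = f \<circ> tr j k" unfolding S_def by blast
    show False using fun_cong[OF j(2), of j] val[of j] j(1) a by simp
  qed
  moreover have "finite S" by (simp add: S_def)
  ultimately have "(\<Sum>f'\<in>Garnir_words n lam f a (f k) {} C. rmatch n f' g) = rmatch n f g + (\<Sum>f'\<in>S. rmatch n f' g)"
    unfolding Garnir_words by (intro sum.insert)
  moreover have "(\<Sum>f'\<in>S. rmatch n f' g) = (\<Sum>j\<in>{j\<in>{1..n}. f j = a}. rmatch n (f \<circ> tr j k) g)"
    unfolding S_def using inj by (subst sum.reindex) (simp_all add: comp_def)
  moreover have "(\<Sum>f'\<in>Garnir_words n lam f a (f k) {} C. rmatch n f' g) \<in> dom_ideal p n lam"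
    by (rule Garnir[OF p g]) (use a Cc in \<open>auto simp: C_def\<close>)
  ultimately show ?thesis by metis
qed

text \<open>Swaps of k with earlier entries of its own row reproduce f. Swaps with earlier entries
  in rows above are eliminated by \<open>row_exchange\<close>, once for each of the
  \<open>f k - 1\<close> rows; this costs f each time and leaves swaps with later entries of those
  rows. The multiplicities of f add up to the content.\<close>

lemma JM_mod_dom_ideal:
  assumes p: "prime p" and f: "f \<in> words n lam" and g: "g \<in> words n lam" and k: "k \<in> {1..n}"
  shows "ga_mult n (JM k) (rmatch n f g) - ga_smult (of_int (wcont f k)) (rmatch n f g)
    - (\<Sum>j\<in>{j\<in>{1..<k}. f k < f j}. rmatch n (f \<circ> tr j k) g)
    + (\<Sum>j\<in>{j\<in>{k<..n}. f j < f k}. rmatch n (f \<circ> tr j k) g) \<in> dom_ideal p n lam"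
proof -
  define Y where "Y j = rmatch n (f \<circ> tr j k) g" for j
  define A1 A2 A3 A4 where "A1 = {j\<in>{1..<k}. f j = f k}" "A2 = {j\<in>{1..<k}. f k < f j}"
    "A3 = {j\<in>{1..<k}. f j < f k}" "A4 = {j\<in>{k<..n}. f j < f k}"
  note A = this
  have "{1..<k} = A1 \<union> (A2 \<union> A3)" by (auto simp: A)
  then have "(\<Sum>j\<in>{1..<k}. Y j) = sum Y (A1 \<union> (A2 \<union> A3))" by (rule arg_cong)
  also have "\<dots> = sum Y A1 + sum Y (A2 \<union> A3)"
    by (rule sum.union_disjoint) (auto simp: A)
  also have "sum Y (A2 \<union> A3) = sum Y A2 + sum Y A3" by (rule sum.union_disjoint) (auto simp: A)
  finally have 1: "ga_mult n (JM k) (rmatch n f g) = sum Y A1 + (sum Y A2 + sum Y A3)"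
    unfolding JM_rmatch[OF k] Y_def .
  have "Y j = rmatch n f g" if "j \<in> A1" for j
  proof -
    have "(f \<circ> tr j k) i = f i" for i using that by (auto simp: A Transposition.transpose_def)
    then show ?thesis unfolding Y_def by (intro rmatch_cong) (simp_all only:)
  qed
  then have "(\<Sum>j\<in>A1. Y j \<sigma>) = (\<Sum>j\<in>A1. rmatch n f g \<sigma>)" for \<sigma> by (intro sum.cong refl) (simp only:)
  then have 2: "sum Y A1 \<sigma> = of_nat (card A1) * rmatch n f g \<sigma>" for \<sigma>
    unfolding sum_fun_apply by (simp only: sum_constant)
  have "(\<Sum>a\<in>{1..<f k}. rmatch n f g + (\<Sum>j\<in>{j\<in>{1..n}. f j = a}. Y j)) \<in> dom_ideal p n lam"
    unfolding Y_def by (rule rsub_sum[OF dom_ideal_rsub[OF p]], rule row_exchange[OF p f g k]) auto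
  moreover have "(\<Sum>a\<in>{1..<f k}. \<Sum>j\<in>{j\<in>{1..n}. f j = a}. Y j) = sum Y A3 + sum Y A4"
  proof -
    have "(\<Sum>a\<in>{1..<f k}. \<Sum>j\<in>{j\<in>{1..n}. f j = a}. Y j) = sum Y (\<Union>a\<in>{1..<f k}. {j\<in>{1..n}. f j = a})"
      by (rule sum.UNION_disjoint[symmetric]) auto
    also have "(\<Union>a\<in>{1..<f k}. {j\<in>{1..n}. f j = a}) = A3 \<union> A4"
    proof (intro equalityI subsetI)
      fix j assume "j \<in> (\<Union>a\<in>{1..<f k}. {j\<in>{1..n}. f j = a})"
      then have "j \<in> {1..n}" "f j < f k" by auto
      then show "j \<in> A3 \<union> A4" unfolding A by (cases j k rule: linorder_cases) auto
    next
      fix j assume "j \<in> A3 \<union> A4"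
      then have j: "j \<in> {1..n}" "f j < f k" using k by (auto simp: A)
      then show "j \<in> (\<Union>a\<in>{1..<f k}. {j\<in>{1..n}. f j = a})"
        using words_range(1)[OF f j(1)] by auto
    qed
    also have "sum Y (A3 \<union> A4) = sum Y A3 + sum Y A4" by (rule sum.union_disjoint) (auto simp: A)
    finally show ?thesis .
  qed
  ultimately have "(\<Sum>a\<in>{1..<f k}. rmatch n f g) + (sum Y A3 + sum Y A4) \<in> dom_ideal p n lam"
    by (simp only: sum.distrib)
  moreover have 3: "(\<Sum>a\<in>{1..<f k}. rmatch n f g) \<sigma> = (of_nat (f k) - 1) * rmatch n f g \<sigma>" for \<sigma>
    unfolding sum_fun_apply using words_range(1)[OF f k] by (simp add: of_nat_diff)
  have "ga_mult n (JM k) (rmatch n f g) - ga_smult (of_int (wcont f k)) (rmatch n f g) - sum Y A2 + sum Y A4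
      = (\<Sum>a\<in>{1..<f k}. rmatch n f g) + (sum Y A3 + sum Y A4)"
  proof
    fix \<sigma>
    have c: "of_int (wcont f k) = (of_nat (card A1) - (of_nat (f k) - 1) :: rat)"
      by (simp add: wcont_def A)
    show "(ga_mult n (JM k) (rmatch n f g) - ga_smult (of_int (wcont f k)) (rmatch n f g) - sum Y A2 + sum Y A4) \<sigma>
      = ((\<Sum>a\<in>{1..<f k}. rmatch n f g) + (sum Y A3 + sum Y A4)) \<sigma>"
      unfolding 1 c plus_fun_apply minus_apply ga_smult_apply 2 3 by (simp only: algebra_simps)
  qed
  ultimately show ?thesis unfolding A Y_def by (simp only:)
qed

section \<open>Triangularity of Jucys--Murphy elements\<close>

lemma wt_swap:
  assumes f: "f \<in> words n lam" and ij: "i \<in> {1..n}" "j \<in> {1..n}" "i < j" "f j < f i"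
  shows "wt n f < wt n (f \<circ> tr i j)"
proof (rule wt_less[OF f words_comp[OF f transpose_perms[OF ij(1,2)]], where m=i])
  show "f \<circ> tr i j \<noteq> f"
  proof
    assume eq: "f \<circ> tr i j = f"
    show False using fun_cong[OF eq, of i] ij by simp
  qed
qed (use ij in \<open>auto simp: Transposition.transpose_def\<close>)

text \<open>Both error sums of \<open>JM_mod_dom_ideal\<close> move the larger of the two letters to
  the right, so they consist of heavier words.\<close>

lemma JM_triangular_left:
  assumes p: "prime p" and f: "f \<in> words n lam" and g: "g \<in> words n lam" and k: "k \<in> {1..n}"
    and T: "rsub p T" "dom_ideal p n lam \<subseteq> T"
    and up: "\<And>f'. f' \<in> words n lam \<Longrightarrow> wt n f < wt n f' \<Longrightarrow> rmatch n f' g \<in> T"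
  shows "ga_mult n (JM k) (rmatch n f g) - ga_smult (of_int (wcont f k)) (rmatch n f g) \<in> T"
proof -
  have "rmatch n (f \<circ> tr j k) g \<in> T" if "j \<in> {1..<k}" "f k < f j" for j
  proof (rule up)
    show "f \<circ> tr j k \<in> words n lam" using that k by (intro words_comp[OF f] transpose_perms) auto
    show "wt n f < wt n (f \<circ> tr j k)" using that k by (intro wt_swap[OF f]) auto
  qed
  then have 1: "(\<Sum>j\<in>{j\<in>{1..<k}. f k < f j}. rmatch n (f \<circ> tr j k) g) \<in> T" (is "?A \<in> T")
    by (intro rsub_sum[OF T(1)]) auto
  have "rmatch n (f \<circ> tr j k) g \<in> T" if "j \<in> {k<..n}" "f j < f k" for j
  proof (rule up)
    show "f \<circ> tr j k \<in> words n lam" using that k by (intro words_comp[OF f] transpose_perms) auto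
    show "wt n f < wt n (f \<circ> tr j k)"
      unfolding transpose_commute[of j k] using that k by (intro wt_swap[OF f]) auto
  qed
  then have 2: "(\<Sum>j\<in>{j\<in>{k<..n}. f j < f k}. rmatch n (f \<circ> tr j k) g) \<in> T" (is "?B \<in> T")
    by (intro rsub_sum[OF T(1)]) auto
  have 3: "ga_mult n (JM k) (rmatch n f g) - ga_smult (of_int (wcont f k)) (rmatch n f g) - ?A + ?B \<in> T" (is "?L - ?A + ?B \<in> T")
    using JM_mod_dom_ideal[OF p f g k] T(2) by blast
  have "?L = (?L - ?A + ?B) + (?A - ?B)" by simp
  then show ?thesis using rsub_add[OF T(1) 3 rsub_diff[OF p T(1) 1 2]] by metis
qed

text \<open>The left version, applied to the preimage of T under \<open>ga_star\<close>.\<close>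

lemma JM_triangular_right:
  assumes p: "prime p" and f: "f \<in> words n lam" and g: "g \<in> words n lam" and k: "k \<in> {1..n}"
    and T: "rsub p T" "dom_ideal p n lam \<subseteq> T"
    and up: "\<And>f'. f' \<in> words n lam \<Longrightarrow> wt n f < wt n f' \<Longrightarrow> rmatch n g f' \<in> T"
  shows "ga_mult n (rmatch n g f) (JM k) - ga_smult (of_int (wcont f k)) (rmatch n g f) \<in> T"
proof -
  have "ga_mult n (JM k) (rmatch n f g) - ga_smult (of_int (wcont f k)) (rmatch n f g) \<in> {a. ga_star a \<in> T}"
    using dom_ideal_star[OF p] T up
    by (intro JM_triangular_left[OF p f g k rsub_vimage_star]) (auto simp: rmatch_star)
  then show ?thesis by (simp only: mem_Collect_eq ga_star_diff JM_star[OF k] ga_star_smult rmatch_star)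
qed

text \<open>Once all letters before k agree, the content of k depends on its row r through h r - r.
  The counts h decrease weakly because t is a ballot word, so this is strictly decreasing in r: the
  addable nodes of a partition have distinct contents. The word f itself is any word with positive
  letters.\<close>

lemma wcont_determines:
  assumes y: "lattice n t" and t: "\<And>k. k \<in> {1..n} \<Longrightarrow> 1 \<le> t k" and f: "\<And>k. k \<in> {1..n} \<Longrightarrow> 1 \<le> f k"
    and eq: "\<And>k. k \<in> {1..n} \<Longrightarrow> wcont f k = wcont t k"
  shows "k \<in> {1..n} \<Longrightarrow> f k = t k"
proof (induction k rule: less_induct)
  case (less k)
  define h where "h i = card {j\<in>{1..<k}. t j = i}" for i
  have anti: "h b \<le> h a" if "1 \<le> a" "a \<le> b" for a b
    using that(2)
  proof (induction b rule: dec_induct)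
    case (step b)
    have "{1..k-1} = {1..<k}" using less.prems by auto
    then have "h (Suc b) \<le> h b"
      using y[unfolded lattice_def, rule_format, of "k - 1" b] step that less.prems by (auto simp: h_def)
    then show ?case using step by linarith
  qed simp
  have "{j\<in>{1..<k}. f j = f k} = {j\<in>{1..<k}. t j = f k}" using less by auto
  then have "int (h (f k)) - int (f k) = int (h (t k)) - int (t k)"
    using eq[OF less.prems] by (simp add: wcont_def h_def)
  moreover have "f k < t k \<Longrightarrow> h (t k) \<le> h (f k)" "t k < f k \<Longrightarrow> h (f k) \<le> h (t k)"
    using anti[of "f k" "t k"] anti[of "t k" "f k"] t f less.prems by auto
  ultimately show ?case by linarith
qed

section \<open>Standard tableaux\<close>

lemma psum_eq: "psum lam k = sum_list (take k lam)"
proof (induction k)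
  case (Suc k)
  have "psum lam (Suc k) = psum lam k + part lam (Suc k)" by (simp add: psum_def)
  then show ?case using Suc by (cases "k < length lam") (auto simp: part_def take_Suc_conv_app_nth)
qed (simp add: psum_def)

lemma psum_mono: "i \<le> j \<Longrightarrow> psum lam i \<le> psum lam j"
  unfolding psum_def by (rule sum_mono2) auto

lemma psum_le: "psum lam k \<le> sum_list lam"
  using append_take_drop_id[of k lam] sum_list_append[of "take k lam" "drop k lam"] by (simp add: psum_eq)

lemma nodes_eq: "nodes lam = (SIGMA i:{1..length lam}. {1..part lam i})"
  by (auto simp: nodes_def part_def)

lemma mem_nodes: "(i, j) \<in> nodes lam \<longleftrightarrow> 1 \<le> i \<and> 1 \<le> j \<and> j \<le> part lam i"
  by (auto simp: nodes_def part_def)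

lemma finite_nodes: "finite (nodes lam)" unfolding nodes_eq by auto

lemma card_nodes: "is_partition n lam \<Longrightarrow> card (nodes lam) = n"
  unfolding nodes_eq using psum_eq[of lam "length lam"] by (simp add: psum_def is_partition_def)

lemma part_antimono: "is_partition n lam \<Longrightarrow> 1 \<le> i \<Longrightarrow> i \<le> j \<Longrightarrow> part lam j \<le> part lam i"
  by (cases "i = j") (auto simp: part_def is_partition_def sorted_wrt_iff_nth_less)

lemma part_pos: "is_partition n lam \<Longrightarrow> 1 \<le> i \<Longrightarrow> 0 < part lam i \<longleftrightarrow> i \<le> length lam"
  unfolding is_partition_def part_def by (auto simp: in_set_conv_nth)

lemma tlam_eq: "(i, j) \<in> nodes lam \<Longrightarrow> tlam lam (i, j) = psum lam (i - 1) + j"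
  by (simp add: tlam_def psum_eq)

lemma tlam_le: "(i, j) \<in> nodes lam \<Longrightarrow> tlam lam (i, j) \<le> psum lam i"
proof -
  assume ij: "(i, j) \<in> nodes lam"
  then obtain i' where "i = Suc i'" by (cases i) (auto simp: mem_nodes)
  then show ?thesis using tlam_eq[OF ij] ij by (simp add: psum_def mem_nodes)
qed

lemma tlam_row_less:
  assumes "(i, j) \<in> nodes lam" "(i', j') \<in> nodes lam" "i < i'"
  shows "tlam lam (i, j) < tlam lam (i', j')"
proof -
  have "psum lam i \<le> psum lam (i' - 1)" using assms by (intro psum_mono) auto
  then show ?thesis using tlam_le[OF assms(1)] tlam_eq[OF assms(2)] assms(2) by (simp add: mem_nodes)
qed

lemma tlam_standard:
  assumes lam: "is_partition n lam" shows "standard n lam (tlam lam)"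
proof -
  have inj: "inj_on (tlam lam) (nodes lam)"
  proof (rule inj_onI, clarify)
    fix i j i' j' assume h: "(i, j) \<in> nodes lam" "(i', j') \<in> nodes lam" "tlam lam (i, j) = tlam lam (i', j')"
    have "i = i'" using tlam_row_less[OF h(1,2)] tlam_row_less[OF h(2,1)] h(3) by (cases i i' rule: linorder_cases) auto
    then show "i = i' \<and> j = j'" using h tlam_eq by simp
  qed
  have "tlam lam ` nodes lam \<subseteq> {1..n}"
  proof clarify
    fix i j assume ij: "(i, j) \<in> nodes lam"
    have "tlam lam (i, j) \<le> n" using tlam_le[OF ij] psum_le[of lam i] lam by (simp add: is_partition_def)
    moreover have "1 \<le> tlam lam (i, j)" using tlam_eq[OF ij] ij by (simp add: mem_nodes)
    ultimately show "tlam lam (i, j) \<in> {1..n}" by simp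
  qed
  then have "tlam lam ` nodes lam = {1..n}"
    using card_image[OF inj] card_nodes[OF lam] by (intro card_subset_eq) auto
  then have "is_tableau n lam (tlam lam)" using inj by (simp add: is_tableau_def bij_betw_def)
  moreover have "tlam lam (i, j) < tlam lam (i, Suc j)" if "(i, j) \<in> nodes lam" "(i, Suc j) \<in> nodes lam" for i j
    using that by (simp add: tlam_eq)
  moreover have "tlam lam (i, j) < tlam lam (Suc i, j)" if "(i, j) \<in> nodes lam" "(Suc i, j) \<in> nodes lam" for i j
    using tlam_row_less[OF that] by simp
  ultimately show ?thesis unfolding standard_def by blast
qed

section \<open>Standard tableaux correspond to lattice words\<close>

definition rword :: "nat \<Rightarrow> nat list \<Rightarrow> (nat \<times> nat \<Rightarrow> nat) \<Rightarrow> nat \<Rightarrow> nat" where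
  "rword n lam t = (\<lambda>k. if k \<in> {1..n} then fst (inv_into (nodes lam) t k) else 0)"

text \<open>Counting along columns. The predicate P admits truncated rows, as needed for prefixes of
  words and for contents.\<close>

lemma tableau_fibre:
  assumes t: "is_tableau n lam t" and i: "1 \<le> i"
  shows "card {k\<in>{1..n}. rword n lam t k = i \<and> P k} = card {c\<in>{1..part lam i}. P (t (i, c))}"
proof -
  have b: "bij_betw t (nodes lam) {1..n}" using t by (simp add: is_tableau_def)
  have "bij_betw (\<lambda>c. t (i, c)) {c\<in>{1..part lam i}. P (t (i, c))} {k\<in>{1..n}. rword n lam t k = i \<and> P k}"
    unfolding bij_betw_def
  proof
    show "inj_on (\<lambda>c. t (i, c)) {c \<in> {1..part lam i}. P (t (i, c))}"
    proof (rule inj_onI)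
      fix x y assume "x \<in> {c \<in> {1..part lam i}. P (t (i, c))}" "y \<in> {c \<in> {1..part lam i}. P (t (i, c))}"
        and eq: "t (i, x) = t (i, y)"
      then have "(i, x) \<in> nodes lam" "(i, y) \<in> nodes lam" using i by (auto simp: mem_nodes)
      then show "x = y" using inj_onD[OF bij_betw_imp_inj_on[OF b] eq] by simp
    qed
    show "(\<lambda>c. t (i, c)) ` {c\<in>{1..part lam i}. P (t (i, c))} = {k\<in>{1..n}. rword n lam t k = i \<and> P k}"
    proof (intro equalityI subsetI)
      fix k assume "k \<in> (\<lambda>c. t (i, c)) ` {c\<in>{1..part lam i}. P (t (i, c))}"
      then obtain c where c: "k = t (i, c)" "c \<in> {1..part lam i}" "P k" by auto
      then have m: "(i, c) \<in> nodes lam" using i by (simp add: mem_nodes)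
      then have "inv_into (nodes lam) t k = (i, c)" using bij_betw_inv_into_left[OF b m] c by simp
      moreover have "k \<in> {1..n}" using bij_betw_apply[OF b m] c by simp
      ultimately show "k \<in> {k\<in>{1..n}. rword n lam t k = i \<and> P k}" using c by (simp add: rword_def)
    next
      fix k assume "k \<in> {k\<in>{1..n}. rword n lam t k = i \<and> P k}"
      then have k: "k \<in> {1..n}" "fst (inv_into (nodes lam) t k) = i" "P k" by (auto simp: rword_def split: if_splits)
      then have c: "inv_into (nodes lam) t k = (i, snd (inv_into (nodes lam) t k))" (is "_ = (i, ?c)")
        by (simp add: prod_eq_iff)
      have "t (i, ?c) = k" using bij_betw_inv_into_right[OF b k(1)] unfolding c[symmetric] .
      moreover have "(i, ?c) \<in> nodes lam"
        using bij_betw_apply[OF bij_betw_inv_into[OF b] k(1)] unfolding c[symmetric] .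
      ultimately show "k \<in> (\<lambda>c. t (i, c)) ` {c\<in>{1..part lam i}. P (t (i, c))}"
        using k by (intro image_eqI[of _ _ ?c]) (auto simp: mem_nodes)
    qed
  qed
  from bij_betw_same_card[OF this] show ?thesis by (rule sym)
qed

lemma rword_pos: "is_tableau n lam t \<Longrightarrow> k \<in> {1..n} \<Longrightarrow> 1 \<le> rword n lam t k"
  using bij_betw_apply[OF bij_betw_inv_into, of t "nodes lam" "{1..n}" k]
  by (cases "inv_into (nodes lam) t k") (simp add: is_tableau_def rword_def mem_nodes)

lemma rword_words: "is_tableau n lam t \<Longrightarrow> rword n lam t \<in> words n lam"
proof -
  assume t: "is_tableau n lam t"
  have "card {k\<in>{1..n}. rword n lam t k = i} = part lam i" for i
  proof (cases "1 \<le> i")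
    case True
    have "{c\<in>{1..part lam i}. True} = {1..part lam i}" by auto
    then show ?thesis using tableau_fibre[OF t True, of "\<lambda>_. True"] by (simp only: card_atLeastAtMost) simp
  next
    case False
    then have "{k\<in>{1..n}. rword n lam t k = i} = {}" using rword_pos[OF t] by fastforce
    then show ?thesis using False by (simp only: part_def card.empty) simp
  qed
  then show ?thesis by (simp add: words_def rword_def)
qed

text \<open>In a standard tableau the node above an entry that is at most m again carries an entry
  at most m.\<close>

lemma rword_lattice:
  assumes lam: "is_partition n lam" and t: "standard n lam t" shows "lattice n (rword n lam t)"
  unfolding lattice_def
proof (intro allI impI)
  fix m i :: nat assume m: "m \<le> n" and i: "1 \<le> i"
  have tab: "is_tableau n lam t" using t by (simp add: standard_def)
  have "{k\<in>{1..m}. rword n lam t k = i'} = {k\<in>{1..n}. rword n lam t k = i' \<and> k \<le> m}" for i' using m by auto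
  then have *: "card {k\<in>{1..m}. rword n lam t k = i'} = card {c\<in>{1..part lam i'}. t (i', c) \<le> m}" if "1 \<le> i'" for i'
    using tableau_fibre[OF tab that] by simp
  have "{c\<in>{1..part lam (Suc i)}. t (Suc i, c) \<le> m} \<subseteq> {c\<in>{1..part lam i}. t (i, c) \<le> m}"
  proof clarify
    fix c assume c: "c \<in> {1..part lam (Suc i)}" "t (Suc i, c) \<le> m"
    then have c': "c \<in> {1..part lam i}" using part_antimono[OF lam i, of "Suc i"] by auto
    then have "t (i, c) < t (Suc i, c)" using t c i by (auto simp: standard_def mem_nodes)
    then show "c \<in> {1..part lam i} \<and> t (i, c) \<le> m" using c c' by simp
  qed
  then show "card {k\<in>{1..m}. rword n lam t k = Suc i} \<le> card {k\<in>{1..m}. rword n lam t k = i}"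
    using *[of "Suc i"] *[OF i] by (simp add: card_mono)
qed

text \<open>The rows are filled from the left in the order of the word: k goes to row
  \<open>f k\<close>, in the column that counts the occurrences of this letter so far.\<close>

lemma lattice_standard:
  assumes lam: "is_partition n lam" and f: "f \<in> words n lam" and y: "lattice n f"
  obtains t where "standard n lam t" "rword n lam t = f"
proof -
  define c where "c k = card {j\<in>{1..k}. f j = f k}" for k
  define pos where "pos k = (f k, c k)" for k
  have c_less: "c k < c l" if "k < l" "f k = f l" "1 \<le> k" for k l
  proof -
    have "l \<in> {j\<in>{1..l}. f j = f l} - {j\<in>{1..k}. f j = f k}" using that by auto
    moreover have "{j\<in>{1..k}. f j = f k} \<subseteq> {j\<in>{1..l}. f j = f l}" using that by auto
    ultimately show ?thesis unfolding c_def by (intro psubset_card_mono) auto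
  qed
  have inj: "inj_on pos {1..n}"
  proof (rule inj_onI)
    fix k l assume "k \<in> {1..n}" "l \<in> {1..n}" "pos k = pos l"
    then show "k = l" using c_less[of k l] c_less[of l k] by (cases k l rule: linorder_cases) (auto simp: pos_def)
  qed
  have "pos ` {1..n} \<subseteq> nodes lam"
  proof (rule image_subsetI)
    fix k assume k: "k \<in> {1..n}"
    have "1 \<le> c k" 
      unfolding c_def One_nat_def Suc_le_eq using k by (intro card_gt_0_iff[THEN iffD2]) auto
    moreover have "c k \<le> part lam (f k)"
      unfolding c_def words_D(1)[OF f, symmetric] using k by (intro card_mono) auto
    ultimately show "pos k \<in> nodes lam" unfolding pos_def using words_range(1)[OF f k] by (simp add: mem_nodes)
  qed
  then have "pos ` {1..n} = nodes lam"
    using card_image[OF inj] card_nodes[OF lam] finite_nodes by (intro card_subset_eq) auto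
  then have b: "bij_betw pos {1..n} (nodes lam)" using inj by (simp add: bij_betw_def)
  define t where "t = inv_into {1..n} pos"
  have tb: "bij_betw t (nodes lam) {1..n}" unfolding t_def by (rule bij_betw_inv_into[OF b])
  have part: "pos (t x) = x" if "x \<in> nodes lam" for x unfolding t_def using bij_betw_inv_into_right[OF b that] .
  have fc: "f (t (i, j)) = i" "c (t (i, j)) = j" "t (i, j) \<in> {1..n}" if "(i, j) \<in> nodes lam" for i j
    using part[OF that] bij_betw_apply[OF tb that] by (auto simp: pos_def)
  have "standard n lam t"
    unfolding standard_def is_tableau_def
  proof (intro conjI allI impI tb)
    fix i j assume ij: "(i, j) \<in> nodes lam \<and> (i, Suc j) \<in> nodes lam"
    show "t (i, j) < t (i, Suc j)"
    proof (rule ccontr)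
      assume "\<not> ?thesis"
      then consider "t (i, Suc j) = t (i, j)" | "t (i, Suc j) < t (i, j)" by linarith
      then show False using fc[of i j] fc[of i "Suc j"] ij c_less[of "t (i, Suc j)" "t (i, j)"] by cases auto
    qed
  next
    fix i j assume ij: "(i, j) \<in> nodes lam \<and> (Suc i, j) \<in> nodes lam"
    define k l where "k = t (i, j)" and "l = t (Suc i, j)"
    have kl: "f k = i" "c k = j" "k \<in> {1..n}" "f l = Suc i" "c l = j" "l \<in> {1..n}"
      using fc[of i j] fc[of "Suc i" j] ij by (auto simp: k_def l_def)
    have "card {q\<in>{1..l}. f q = Suc i} \<le> card {q\<in>{1..l}. f q = i}"
      using y kl ij by (simp add: lattice_def mem_nodes)
    then have "c k \<le> card {q\<in>{1..l}. f q = i}" using kl by (simp add: c_def)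
    \<comment> \<open>If l came before k, row i + 1 would reach length j earlier than row i, against
      the ballot condition at l.\<close>
    moreover have "card {q\<in>{1..l}. f q = i} < c k" if "l < k"
    proof -
      have "k \<in> {q\<in>{1..k}. f q = i} - {q\<in>{1..l}. f q = i}" using that kl by auto
      moreover have "{q\<in>{1..l}. f q = i} \<subseteq> {q\<in>{1..k}. f q = i}" using that by auto
      ultimately show ?thesis unfolding c_def kl(1) by (intro psubset_card_mono) auto
    qed
    moreover have "k \<noteq> l" using kl by auto
    ultimately show "t (i, j) < t (Suc i, j)" unfolding k_def[symmetric] l_def[symmetric] by linarith
  qed
  moreover have "rword n lam t = f"
  proof
    fix k
    show "rword n lam t k = f k"
      using inv_into_inv_into_eq[OF b, of k] words_D(2)[OF f, of k] by (simp add: rword_def t_def pos_def)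
  qed
  ultimately show thesis by (rule that)
qed

section \<open>Dominance\<close>

text \<open>Rows of K beyond k have length at most \<open>part mu k\<close>, rows up to k missing
  from K have at least this length, and there are no fewer of the latter. Hence for words of
  partition type no set K in \<open>sdom\<close> does better than {1..k}.\<close>

lemma sum_part_le_psum:
  assumes mu: "is_partition n mu" and K: "finite K" "card K \<le> k"
  shows "(\<Sum>i\<in>K. part mu i) \<le> psum mu k"
proof (cases "k = 0")
  case False
  let ?I = "{1..k}"
  \<comment> \<open>Row 0 is empty, and the lengths decrease only from row 1 on.\<close>
  define K' where "K' = K - {0}"
  have K': "finite K'" "card K' \<le> k" "0 \<notin> K'"
    using K card_mono[of K K'] by (auto simp: K'_def)
  have "(\<Sum>i\<in>K. part mu i) = (\<Sum>i\<in>K'. part mu i)"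
    using K by (intro sum.mono_neutral_right) (auto simp: K'_def part_def)
  also have "\<dots> = (\<Sum>i\<in>K' \<inter> ?I. part mu i) + (\<Sum>i\<in>K' - ?I. part mu i)"
    using K' by (metis Int_Diff_Un Int_Diff_disjoint finite_Diff finite_Int sum.union_disjoint)
  also have "(\<Sum>i\<in>K' - ?I. part mu i) \<le> card (K' - ?I) * part mu k"
  proof -
    have "part mu i \<le> part mu k" if "i \<in> K' - ?I" for i
    proof (rule part_antimono[OF mu])
      have "i \<noteq> 0" using K' that by (cases "i = 0") auto
      then show "k \<le> i" using that by auto
    qed (use False in simp)
    then show ?thesis using sum_bounded_above[of "K' - ?I" "part mu" "part mu k"] by simp
  qed
  also have "card (K' - ?I) * part mu k \<le> card (?I - K') * part mu k"
  proof -
    have "card (K' - ?I) + card (K' \<inter> ?I) = card K'" "card (?I - K') + card (K' \<inter> ?I) = card ?I"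
      using K' by (metis add.commute card_Int_Diff) (metis add.commute card_Int_Diff finite_atLeastAtMost inf_commute)
    then show ?thesis using K' by (intro mult_right_mono) auto
  qed
  also have "card (?I - K') * part mu k \<le> (\<Sum>i\<in>?I - K'. part mu i)"
    using sum_bounded_below[of "?I - K'" "part mu k" "part mu"] part_antimono[OF mu] by simp
  also have "(\<Sum>i\<in>K' \<inter> ?I. part mu i) + (\<Sum>i\<in>?I - K'. part mu i) = psum mu k"
    unfolding psum_def using sum.Int_Diff[of ?I "part mu" K'] by (simp add: inf_commute)
  finally show ?thesis by simp
qed (use K in auto)

lemma words_card_le_psum:
  assumes "is_partition n mu" "w \<in> words n mu" "finite K" "card K \<le> k"
  shows "card {x\<in>{1..n}. w x \<in> K} \<le> psum mu k"
  using sum_part_le_psum[OF assms(1,3,4)] words_D(1)[OF assms(2)] by (subst card_fibres[OF assms(3)]) auto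

lemma psum_inj:
  assumes "is_partition n lam" "is_partition n mu" "\<And>k. psum lam k = psum mu k" shows "lam = mu"
proof -
  have part: "part lam k = part mu k" if "1 \<le> k" for k
    using assms(3)[of k] assms(3)[of "k - 1"] that by (cases k) (auto simp: psum_def)
  have "length lam = length mu"
  proof (rule ccontr)
    assume ne: "length lam \<noteq> length mu"
    define i where "i = max (length lam) (length mu)"
    have "1 \<le> i" using ne by (auto simp: i_def)
    then have "i \<le> length lam \<longleftrightarrow> i \<le> length mu"
      using part[of i] part_pos[OF assms(1), of i] part_pos[OF assms(2), of i] by simp
    then show False using ne by (auto simp: i_def)
  qed
  then show ?thesis
  proof (rule nth_equalityI)
    fix i assume "i < length lam"
    then show "lam ! i = mu ! i" using part[of "Suc i"] \<open>length lam = length mu\<close> by (simp add: part_def)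
  qed
qed

lemma dominates_iff: "dominates mu lam \<longleftrightarrow> (\<forall>k. psum lam k \<le> psum mu k)"
  by (simp add: dominates_def psum_eq)

lemma sdominates_strict:
  assumes "is_partition n lam" "is_partition n mu" "sdominates mu lam"
  obtains k where "psum lam k < psum mu k"
proof -
  have le: "psum lam k \<le> psum mu k" for k using assms(3) by (simp add: sdominates_def dominates_iff)
  have "\<not> (\<forall>k. psum lam k = psum mu k)"
    using psum_inj[OF assms(1,2)] assms(3) by (auto simp: sdominates_def)
  then obtain k where "psum lam k \<noteq> psum mu k" by blast
  then show thesis using that[of k] le[of k] by simp
qed

lemma sdominates_trans:
  assumes "is_partition n lam" "is_partition n mu" "sdominates kap mu" "sdominates mu lam"
  shows "sdominates kap lam"
proof -
  obtain k where "psum lam k < psum mu k" by (rule sdominates_strict[OF assms(1,2,4)])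
  then have "psum lam k < psum kap k" using assms(3) by (auto simp: sdominates_def dominates_iff intro: less_le_trans)
  then show ?thesis using assms(3,4) by (auto simp: sdominates_def dominates_iff intro: order_trans)
qed

lemma sdominates_sdom:
  assumes "is_partition n lam" "is_partition n mu" "sdominates mu lam" "w \<in> words n mu"
  shows "sdom n w lam"
proof -
  obtain k where k: "psum lam k < psum mu k" by (rule sdominates_strict[OF assms(1,2,3)])
  have le: "psum lam k \<le> psum mu k" for k using assms(3) by (simp add: sdominates_def dominates_iff)
  show ?thesis unfolding sdom_def
  proof (intro conjI allI)
    show "\<exists>K. finite K \<and> card K \<le> k \<and> psum lam k \<le> card {x\<in>{1..n}. w x \<in> K}" for k
      by (rule exI[of _ "{1..k}"]) (simp only: words_psum[OF assms(4)] le, simp)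
    show "\<exists>k K. finite K \<and> card K \<le> k \<and> psum lam k < card {x\<in>{1..n}. w x \<in> K}"
      by (rule exI[of _ k], rule exI[of _ "{1..k}"]) (simp only: words_psum[OF assms(4)] k, simp)
  qed
qed

lemma sdom_sdominates:
  assumes "is_partition n mu" "w \<in> words n mu" "sdom n w lam" shows "sdominates mu lam"
proof -
  have "psum lam k \<le> psum mu k" for k
  proof -
    obtain K where "finite K" "card K \<le> k" "psum lam k \<le> card {x\<in>{1..n}. w x \<in> K}"
      using assms(3) unfolding sdom_def by blast
    then show ?thesis using words_card_le_psum[OF assms(1,2), of K k] by linarith
  qed
  moreover obtain k K where "finite K" "card K \<le> k" "psum lam k < card {x\<in>{1..n}. w x \<in> K}"
    using assms(3) unfolding sdom_def by blast
  then have "psum lam k < psum mu k" using words_card_le_psum[OF assms(1,2), of K k] by linarith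
  ultimately show ?thesis unfolding sdominates_def dominates_iff by auto
qed

lemma psum_eq_n:
  assumes "is_partition n lam" "n \<le> k" shows "psum lam k = n"
proof -
  have "length xs \<le> sum_list xs" if "0 \<notin> set xs" for xs :: "nat list"
    using that by (induction xs) auto
  then have "length lam \<le> n" using assms(1) by (auto simp: is_partition_def)
  then show ?thesis using assms by (simp add: psum_eq is_partition_def)
qed

text \<open>Induction from more dominant to less dominant partitions. Partial sums equal n from k =
  n on, so a strict inequality occurs below n, where each partial sum is at most n.\<close>

lemma dominance_induct [consumes 1]:
  assumes "is_partition n mu"
    and step: "\<And>mu. is_partition n mu \<Longrightarrow>
      (\<And>kap. is_partition n kap \<Longrightarrow> sdominates kap mu \<Longrightarrow> P kap) \<Longrightarrow> P mu"
  shows "P mu"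
  using assms(1)
proof (induction "n * n - (\<Sum>k<n. psum mu k)" arbitrary: mu rule: less_induct)
  case less
  show ?case
  proof (rule step[OF less.prems])
    fix kap assume kap: "is_partition n kap" "sdominates kap mu"
    obtain k where k: "psum mu k < psum kap k" by (rule sdominates_strict[OF less.prems kap])
    then have "k < n" using psum_eq_n[OF less.prems, of k] psum_eq_n[OF kap(1), of k] by (cases "k < n") auto
    then have "(\<Sum>k<n. psum mu k) < (\<Sum>k<n. psum kap k)"
      using k kap(2) by (intro sum_strict_mono_ex1) (auto simp: sdominates_def dominates_iff)
    moreover have "(\<Sum>k<n. psum kap k) \<le> n * n"
      using sum_bounded_above[of "{..<n}" "psum kap" n] psum_le[of kap] kap(1) by (simp add: is_partition_def)
    ultimately have "n * n - (\<Sum>k<n. psum kap k) < n * n - (\<Sum>k<n. psum mu k)" by linarith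
    then show "P kap" using less.hyps kap(1) by blast
  qed
qed

section \<open>Reduction of arbitrary types to partitions\<close>

text \<open>The letters that occur are listed by decreasing multiplicity; h is the place in this
  list, counted from 1.\<close>

lemma sort_rows:
  fixes g :: "nat \<Rightarrow> nat"
  obtains h mu where "inj_on h (g ` {1..n})" "is_partition n mu"
    "(\<lambda>k. if k \<in> {1..n} then h (g k) else 0) \<in> words n mu"
proof -
  define V where "V = g ` {1..n}"
  define c where "c i = card {k\<in>{1..n}. g k = i}" for i
  define xs where "xs = rev (sort_key c (sorted_list_of_set V))"
  define h where "h v = Suc (inv_into {..<length xs} ((!) xs) v)" for v
  define mu where "mu = map c xs"
  have xs: "distinct xs" "set xs = V" by (auto simp: xs_def V_def)
  have b: "bij_betw ((!) xs) {..<length xs} V" using bij_betw_nth[OF xs(1)] xs(2) by simp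
  have "inj_on h V" unfolding h_def using bij_betw_imp_inj_on[OF bij_betw_inv_into[OF b]] by (auto simp: inj_on_def)
  moreover have "is_partition n mu"
    unfolding is_partition_def
  proof (intro conjI)
    have "sorted (map c (sort_key c (sorted_list_of_set V)))" by simp
    then show "sorted_wrt (\<ge>) mu" unfolding mu_def xs_def rev_map[symmetric] sorted_wrt_rev by simp
    show "0 \<notin> set mu" by (auto simp: mu_def xs c_def V_def)
    have "sum_list mu = (\<Sum>v\<in>V. c v)" using xs by (simp add: mu_def sum_list_distinct_conv_sum_set)
    also have "\<dots> = card {k\<in>{1..n}. g k \<in> V}" unfolding c_def by (rule card_fibres[symmetric]) (auto simp: V_def)
    also have "{k\<in>{1..n}. g k \<in> V} = {1..n}" by (auto simp: V_def)
    finally show "sum_list mu = n" by simp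
  qed
  moreover have "(\<lambda>k. if k \<in> {1..n} then h (g k) else 0) \<in> words n mu"
  proof -
    have h: "h v \<le> length xs" "1 \<le> h v" "xs ! (h v - 1) = v" if "v \<in> V" for v
      using bij_betw_apply[OF bij_betw_inv_into[OF b] that] bij_betw_inv_into_right[OF b that] by (auto simp: h_def)
    have h2: "h (xs ! i) = Suc i" if "i < length xs" for i
      using bij_betw_inv_into_left[OF b, of i] that by (simp add: h_def)
    have "card {k\<in>{1..n}. (if k \<in> {1..n} then h (g k) else 0) = i} = part mu i" for i
    proof (cases "1 \<le> i \<and> i \<le> length xs")
      case True
      have "h (g k) = i \<longleftrightarrow> g k = xs ! (i - 1)" if "k \<in> {1..n}" for k
        using h[of "g k"] h2[of "i - 1"] True that by (auto simp: V_def)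
      then have "{k\<in>{1..n}. (if k \<in> {1..n} then h (g k) else 0) = i} = {k\<in>{1..n}. g k = xs ! (i - 1)}" by auto
      moreover have "i - 1 < length xs" using True by linarith
      ultimately show ?thesis using True by (simp add: part_def mu_def c_def nth_map)
    next
      case False
      then have "h (g k) \<noteq> i" if "k \<in> {1..n}" for k using h[of "g k"] that by (auto simp: V_def)
      then have "{k\<in>{1..n}. (if k \<in> {1..n} then h (g k) else 0) = i} = {}" by auto
      then show ?thesis using False by (simp only: card.empty) (auto simp: part_def mu_def)
    qed
    then show ?thesis unfolding words_def by simp
  qed
  ultimately show thesis using that unfolding V_def by blast
qed

text \<open>Renumbering turns the type into a partition and carries each K to its image, which need
  not be an initial segment; \<open>sdom\<close> allows arbitrary K for this purpose.\<close>

lemma sdom_words: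
  assumes X: "rmatch n f g \<noteq> 0" and g: "sdom n g lam"
  obtains mu f' g' where "is_partition n mu" "sdominates mu lam" "f' \<in> words n mu" "g' \<in> words n mu"
    "rmatch n f g = rmatch n f' g'"
proof -
  obtain h mu where h: "inj_on h (g ` {1..n})" and mu: "is_partition n mu"
    and g': "(\<lambda>k. if k \<in> {1..n} then h (g k) else 0) \<in> words n mu" (is "?g \<in> _") by (rule sort_rows)
  let ?f = "\<lambda>k. if k \<in> {1..n} then h (f k) else 0"
  have "f k \<in> g ` {1..n}" if "k \<in> {1..n}" for k
  proof -
    have "card {j\<in>{1..n}. g j = f k} = card {j\<in>{1..n}. f j = f k}" using rmatch_type[OF X, of "\<lambda>x. x = f k"] by simp
    also have "\<dots> > 0" using that by (auto simp: card_gt_0_iff)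
    finally obtain j where "j \<in> {1..n}" "g j = f k" by (auto simp: card_gt_0_iff)
    then show ?thesis by (metis imageI)
  qed
  then have "f ` {1..n} \<union> g ` {1..n} = g ` {1..n}" by auto
  then have "rmatch n (h \<circ> f) (h \<circ> g) = rmatch n f g" using h by (intro rmatch_rename) (simp only:)
  moreover have "rmatch n (h \<circ> f) (h \<circ> g) = rmatch n ?f ?g" by (rule rmatch_cong) auto
  ultimately have eq: "rmatch n f g = rmatch n ?f ?g" by (simp only:)
  have "card {k\<in>{1..n}. ?f k = i} = card {k\<in>{1..n}. ?g k = i}" for i
    by (rule rmatch_type[of n ?f ?g "\<lambda>x. x = i"]) (use X eq in \<open>simp only: not_False_eq_True\<close>)
  then have f': "?f \<in> words n mu" using g' unfolding words_def by auto
  have "sdom n ?g lam"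
  proof -
    have *: "\<exists>K'. finite K' \<and> card K' \<le> k \<and> card {x\<in>{1..n}. g x \<in> K} \<le> card {x\<in>{1..n}. ?g x \<in> K'}"
      if "finite K" "card K \<le> k" for K k
    proof (intro exI[of _ "h ` K"] conjI)
      show "card (h ` K) \<le> k" using card_image_le[OF that(1), of h] that(2) by linarith
      show "card {x\<in>{1..n}. g x \<in> K} \<le> card {x\<in>{1..n}. ?g x \<in> h ` K}" by (intro card_mono) auto
    qed (use that in simp)
    show ?thesis unfolding sdom_def
    proof (intro conjI allI)
      fix k
      obtain K where K: "finite K" "card K \<le> k" "psum lam k \<le> card {x\<in>{1..n}. g x \<in> K}"
        using g unfolding sdom_def by blast
      then show "\<exists>K. finite K \<and> card K \<le> k \<and> psum lam k \<le> card {x\<in>{1..n}. ?g x \<in> K}"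
        using *[OF K(1,2)] le_trans by blast
    next
      obtain k K where K: "finite K" "card K \<le> k" "psum lam k < card {x\<in>{1..n}. g x \<in> K}"
        using g unfolding sdom_def by blast
      then show "\<exists>k K. finite K \<and> card K \<le> k \<and> psum lam k < card {x\<in>{1..n}. ?g x \<in> K}"
        using *[OF K(1,2)] less_le_trans by blast
    qed
  qed
  then have "sdominates mu lam" by (rule sdom_sdominates[OF mu g'])
  then show thesis using that mu f' g' eq by blast
qed

text \<open>In this form the ideal is accessible to dominance induction.\<close>

lemma dom_ideal_minimal_words:
  assumes T: "rsub p T"
    and X: "\<And>mu f g. is_partition n mu \<Longrightarrow> sdominates mu lam \<Longrightarrow> f \<in> words n mu \<Longrightarrow> g \<in> words n mu \<Longrightarrow> rmatch n f g \<in> T"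
  shows "dom_ideal p n lam \<subseteq> T"
proof (rule dom_ideal_minimal[OF T])
  fix f g assume g: "sdom n g lam"
  show "rmatch n f g \<in> T"
  proof (cases "rmatch n f g = 0")
    case True
    then show ?thesis using rsub_0[OF T] by (simp only:)
  next
    case False
    obtain mu f' g' where "is_partition n mu" "sdominates mu lam" "f' \<in> words n mu" "g' \<in> words n mu"
      "rmatch n f g = rmatch n f' g'" by (rule sdom_words[OF False g])
    then show ?thesis using X[of mu f' g'] by (simp only:)
  qed
qed

section \<open>The Murphy basis in terms of words\<close>

abbreviation tword :: "nat \<Rightarrow> nat list \<Rightarrow> nat \<Rightarrow> nat" where "tword n lam \<equiv> rword n lam (tlam lam)"

lemma tlam_bij: "is_partition n lam \<Longrightarrow> bij_betw (tlam lam) (nodes lam) {1..n}"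
  using tlam_standard by (auto simp: standard_def is_tableau_def)

lemma node_of_eq:
  assumes lam: "is_partition n lam" and k: "k \<in> {1..n}"
  shows "node_of lam k = inv_into (nodes lam) (tlam lam) k"
  unfolding node_of_def
proof (rule the_equality)
  show "inv_into (nodes lam) (tlam lam) k \<in> nodes lam \<and> tlam lam (inv_into (nodes lam) (tlam lam) k) = k"
    using bij_betw_apply[OF bij_betw_inv_into[OF tlam_bij[OF lam]] k] bij_betw_inv_into_right[OF tlam_bij[OF lam] k] by blast
next
  fix x assume "x \<in> nodes lam \<and> tlam lam x = k"
  then show "x = inv_into (nodes lam) (tlam lam) k"
    using bij_betw_inv_into_left[OF tlam_bij[OF lam], of x] by auto
qed

lemma tword_eq: "is_partition n lam \<Longrightarrow> k \<in> {1..n} \<Longrightarrow> tword n lam k = fst (node_of lam k)"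
  by (simp add: rword_def node_of_eq)

lemma node_of_props:
  assumes "is_partition n lam" "k \<in> {1..n}"
  shows "node_of lam k \<in> nodes lam" "tlam lam (node_of lam k) = k"
  using bij_betw_apply[OF bij_betw_inv_into[OF tlam_bij[OF assms(1)]] assms(2)]
    bij_betw_inv_into_right[OF tlam_bij[OF assms(1)] assms(2)] node_of_eq[OF assms] by auto

lemma tword_words: "is_partition n lam \<Longrightarrow> tword n lam \<in> words n lam"
  using tlam_standard by (intro rword_words) (auto simp: standard_def)

lemma tword_lattice: "is_partition n lam \<Longrightarrow> lattice n (tword n lam)"
  using tlam_standard by (intro rword_lattice) auto

lemma tword_mono:
  assumes lam: "is_partition n lam" and jk: "j \<in> {1..n}" "k \<in> {1..n}" "j < k"
  shows "tword n lam j \<le> tword n lam k"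
proof (rule ccontr)
  assume "\<not> ?thesis"
  then have "fst (node_of lam k) < fst (node_of lam j)" using tword_eq[OF lam] jk by simp
  then have "tlam lam (node_of lam k) < tlam lam (node_of lam j)"
    using node_of_props(1)[OF lam] jk tlam_row_less by (metis prod.collapse)
  then show False using node_of_props(2)[OF lam] jk by simp
qed

lemma wcont_tword:
  assumes lam: "is_partition n lam" and k: "k \<in> {1..n}" shows "wcont (tword n lam) k = content lam k"
proof -
  obtain i c where ic: "node_of lam k = (i, c)" by fastforce
  have nd: "(i, c) \<in> nodes lam" "tlam lam (i, c) = k" using node_of_props[OF lam k] ic by auto
  have i: "1 \<le> i" using nd by (simp add: mem_nodes)
  have row: "tword n lam k = i" using tword_eq[OF lam k] ic by simp
  have tab: "is_tableau n lam (tlam lam)" using tlam_bij[OF lam] by (simp add: is_tableau_def)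
  have "{j\<in>{1..<k}. tword n lam j = tword n lam k} = {j\<in>{1..n}. tword n lam j = i \<and> j < k}" using k row by auto
  also have "card \<dots> = card {d\<in>{1..part lam i}. tlam lam (i, d) < k}" by (rule tableau_fibre[OF tab i])
  also have "{d\<in>{1..part lam i}. tlam lam (i, d) < k} = {1..<c}"
  proof -
    have "tlam lam (i, d) < k \<longleftrightarrow> d < c" if "d \<in> {1..part lam i}" for d
      using nd that i tlam_eq[of i d lam] tlam_eq[of i c lam] by (auto simp: mem_nodes)
    then show ?thesis using nd by (auto simp: mem_nodes)
  qed
  finally have "card {j\<in>{1..<k}. tword n lam j = tword n lam k} = c - 1" by simp
  then show ?thesis using nd row ic by (simp add: wcont_def content_def mem_nodes)
qed

lemma xlam_eq: "is_partition n lam \<Longrightarrow> xlam n lam = rmatch n (tword n lam) (tword n lam)"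
proof
  fix \<sigma> assume lam: "is_partition n lam"
  have "fst (node_of lam (\<sigma> k)) = fst (node_of lam k) \<longleftrightarrow> tword n lam (\<sigma> k) = tword n lam k"
    if "\<sigma> \<in> perms n" "k \<in> {1..n}" for k
    using tword_eq[OF lam] that perms_in[OF that(1), of k] by simp
  then show "xlam n lam \<sigma> = rmatch n (tword n lam) (tword n lam) \<sigma>"
    unfolding xlam_def rmatch_def row_stab_def by auto
qed

lemma dperm_perms:
  assumes lam: "is_partition n lam" and t: "is_tableau n lam t" shows "dperm n lam t \<in> perms n"
proof -
  have "bij_betw (t \<circ> inv_into (nodes lam) (tlam lam)) {1..n} {1..n}"
    using bij_betw_trans[OF bij_betw_inv_into[OF tlam_bij[OF lam]]] t by (auto simp: is_tableau_def)
  then have "bij_betw (dperm n lam t) {1..n} {1..n}"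
    by (rule bij_betw_cong[THEN iffD1, rotated]) (simp add: dperm_def node_of_eq[OF lam])
  then show ?thesis unfolding perms_def mem_Collect_eq
    by (rule bij_imp_permutes) (auto simp: dperm_def)
qed

text \<open>d(t) carries the entry of t^lambda at a node to the entry of t there, so the row of k in
  t is the row of its preimage in t^lambda.\<close>

lemma tword_dperm:
  assumes lam: "is_partition n lam" and t: "is_tableau n lam t" and k: "k \<in> {1..n}"
  shows "tword n lam (inv (dperm n lam t) k) = rword n lam t k"
proof -
  define d where "d = dperm n lam t"
  have d: "d \<in> perms n" unfolding d_def by (rule dperm_perms[OF lam t])
  define l where "l = inv d k"
  have l: "l \<in> {1..n}" "d l = k" using perms_in[OF perms_inv[OF d], of k] k d by (auto simp: l_def)
  then have "t (node_of lam l) = k" by (simp add: d_def dperm_def)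
  then have "inv_into (nodes lam) t k = node_of lam l"
    using bij_betw_inv_into_left[OF t[unfolded is_tableau_def] node_of_props(1)[OF lam l(1)]] by simp
  then show ?thesis using tword_eq[OF lam l(1)] k by (simp add: rword_def l_def d_def)
qed

lemma xst_eq:
  assumes lam: "is_partition n lam" and s: "standard n lam s" and t: "standard n lam t"
  shows "xst n lam s t = rmatch n (rword n lam s) (rword n lam t)"
proof -
  have tab: "is_tableau n lam s" "is_tableau n lam t" using s t by (auto simp: standard_def)
  note d = dperm_perms[OF lam tab(1)] dperm_perms[OF lam tab(2)]
  have "xst n lam s t = rmatch n (tword n lam \<circ> inv (dperm n lam s)) (tword n lam \<circ> inv (dperm n lam t))"
    unfolding xst_def xlam_eq[OF lam] rmatch_left[OF perms_inv[OF d(1)]] rmatch_right[OF d(2)] ..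
  also have "\<dots> = rmatch n (rword n lam s) (rword n lam t)"
    by (rule rmatch_cong) (simp_all only: comp_apply tword_dperm[OF lam tab(1)] tword_dperm[OF lam tab(2)])
  finally show ?thesis .
qed

lemma ideal_above_subset_dom_ideal:
  assumes p: "prime p" and lam: "is_partition n lam" shows "ideal_above p n lam \<subseteq> dom_ideal p n lam"
  unfolding ideal_above_def
proof (rule rspan_minimal[OF dom_ideal_rsub[OF p]], clarify)
  fix mu u v assume h: "is_partition n mu" "sdominates mu lam" "standard n mu u" "standard n mu v"
  then have "rword n mu v \<in> words n mu" by (auto simp: standard_def intro: rword_words)
  then have "sdom n (rword n mu v) lam" by (rule sdominates_sdom[OF lam h(1,2)])
  then show "xst n mu u v \<in> dom_ideal p n lam" unfolding xst_eq[OF h(1,3,4)] by (rule dom_ideal_base[OF p])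
qed

text \<open>Straightening one word, and the other one after inversion, ends at pairs of standard
  tableaux. The errors lie in the ideal above mu and are covered by the dominance induction.\<close>

lemma words_in_ideal_above:
  assumes p: "prime p" and lam: "is_partition n lam" and mu: "is_partition n mu"
  shows "sdominates mu lam \<Longrightarrow> f \<in> words n mu \<Longrightarrow> g \<in> words n mu \<Longrightarrow> rmatch n f g \<in> ideal_above p n lam"
  using mu
proof (induction mu arbitrary: f g rule: dominance_induct)
  case (1 mu)
  let ?T = "ideal_above p n lam"
  have T: "rsub p ?T" unfolding ideal_above_def by (rule rspan_rsub[OF p])
  have JT: "dom_ideal p n mu \<subseteq> ?T"
  proof (rule dom_ideal_minimal_words[OF T])
    fix kap f g
    assume h: "is_partition n kap" "sdominates kap mu" "f \<in> words n kap" "g \<in> words n kap"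
    show "rmatch n f g \<in> ?T" by (rule 1(2)[OF h(1,2) sdominates_trans[OF lam 1(1) h(2) 1(3)] h(3,4)])
  qed
  show ?case
  proof (rule straighten[OF p 1(4,5) T JT])
    fix f assume f: "f \<in> words n mu" "lattice n f"
    have "rmatch n g f \<in> {a. ga_star a \<in> ?T}"
    proof (rule straighten[OF p 1(5) f(1) rsub_vimage_star[OF T]])
      show "dom_ideal p n mu \<subseteq> {a. ga_star a \<in> ?T}" using dom_ideal_star[OF p] JT by blast
      fix g assume g: "g \<in> words n mu" "lattice n g"
      obtain s t where "standard n mu s" "rword n mu s = f" "standard n mu t" "rword n mu t = g"
        using lattice_standard[OF 1(1) f] lattice_standard[OF 1(1) g] by metis
      then have "rmatch n f g = xst n mu s t" "standard n mu s" "standard n mu t" using xst_eq[OF 1(1), of s t] by auto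
      then have "rmatch n f g \<in> ?T"
        unfolding ideal_above_def using 1(1,3) by (intro rspan_base[OF p]) blast
      then show "rmatch n g f \<in> {a. ga_star a \<in> ?T}" by (simp only: mem_Collect_eq rmatch_star)
    qed
    then show "rmatch n f g \<in> ?T" by (simp only: mem_Collect_eq rmatch_star)
  qed
qed

lemma ideal_above_eq_dom_ideal:
  assumes p: "prime p" and lam: "is_partition n lam" shows "ideal_above p n lam = dom_ideal p n lam"
proof
  have T: "rsub p (ideal_above p n lam)" unfolding ideal_above_def by (rule rspan_rsub[OF p])
  show "dom_ideal p n lam \<subseteq> ideal_above p n lam"
    using words_in_ideal_above[OF p lam] by (intro dom_ideal_minimal_words[OF T])
qed (rule ideal_above_subset_dom_ideal[OF p lam])

text \<open>The word of t^lambda is weakly increasing, so both error sums of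
  \<open>JM_mod_dom_ideal\<close> are empty.\<close>

lemma JM_xlam:
  assumes p: "prime p" and lam: "is_partition n lam" and k: "k \<in> {1..n}"
  shows "ga_mult n (JM k) (xlam n lam) - ga_smult (of_int (content lam k)) (xlam n lam) \<in> dom_ideal p n lam"
proof -
  have "\<not> tword n lam k < tword n lam j" if "j \<in> {1..<k}" for j
    using tword_mono[OF lam, of j k] k that by auto
  moreover have "\<not> tword n lam j < tword n lam k" if "j \<in> {k<..n}" for j
    using tword_mono[OF lam, of k j] k that by auto
  ultimately have "{j\<in>{1..<k}. tword n lam k < tword n lam j} = {}" "{j\<in>{k<..n}. tword n lam j < tword n lam k} = {}"
    by blast+
  then show ?thesis
    using JM_mod_dom_ideal[OF p tword_words[OF lam] tword_words[OF lam] k]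
    unfolding xlam_eq[OF lam] wcont_tword[OF lam k] by (simp only: sum.empty diff_0_right add_0_right)
qed

section \<open>Linear independence\<close>

lemma standard_col_mono:
  assumes lam: "is_partition n lam" and s: "standard n lam s"
    and x: "(i, c) \<in> nodes lam" "1 \<le> i'" "i' \<le> i"
  shows "(i', c) \<in> nodes lam" "s (i', c) \<le> s (i, c)"
proof -
  have nd: "(j, c) \<in> nodes lam" if "1 \<le> j" "j \<le> i" for j
    using part_antimono[OF lam that] x that by (simp add: mem_nodes)
  show "(i', c) \<in> nodes lam" using nd x by simp
  have "j \<le> i \<longrightarrow> s (i', c) \<le> s (j, c)" if "i' \<le> j" for j
    using that
  proof (induction j rule: dec_induct)
    case (step j)
    have "s (j, c) < s (Suc j, c)" if "Suc j \<le> i"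
      using s nd[of j] nd[of "Suc j"] that step x by (simp add: standard_def)
    then show ?case using step by fastforce
  qed simp
  then show "s (i', c) \<le> s (i, c)" using x by blast
qed

text \<open>The comparison is made column by column. The entries up to m form a top segment D of a
  column; the first r rows contain all of D or r of its nodes, whereas f, being injective on the
  column, takes at most r values in K. With \<open>tlam lam\<close> and m = n this bounds types;
  with K = {1..r} it compares words.\<close>

lemma column_dominance:
  assumes lam: "is_partition n lam" and s: "standard n lam s"
    and inj: "\<And>i i' c. (i, c) \<in> nodes lam \<Longrightarrow> (i', c) \<in> nodes lam \<Longrightarrow> f (s (i, c)) = f (s (i', c)) \<Longrightarrow> i = i'"
    and K: "finite K" "card K \<le> r" and m: "m \<le> n"
  shows "card {k\<in>{1..m}. f k \<in> K} \<le> card {k\<in>{1..m}. rword n lam s k \<in> {1..r}}"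
proof -
  have b: "bij_betw s (nodes lam) {1..n}" using s by (simp add: standard_def is_tableau_def)
  have rword: "rword n lam s (s x) = fst x" if "x \<in> nodes lam" for x
    using bij_betw_inv_into_left[OF b that] bij_betw_apply[OF b that] by (simp add: rword_def)
  have count: "card {k\<in>{1..m}. P k} = card {x\<in>nodes lam. s x \<le> m \<and> P (s x)}" for P
  proof -
    have img: "s ` {x\<in>nodes lam. s x \<le> m \<and> P (s x)} = {k\<in>{1..m}. P k}"
    proof (intro equalityI subsetI)
      fix k assume "k \<in> s ` {x\<in>nodes lam. s x \<le> m \<and> P (s x)}"
      then obtain x where x: "x \<in> nodes lam" "s x \<le> m" "P (s x)" "k = s x" by blast
      then show "k \<in> {k\<in>{1..m}. P k}" using bij_betw_apply[OF b x(1)] by simp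
    next
      fix k assume k: "k \<in> {k\<in>{1..m}. P k}"
      then have kn: "k \<in> {1..n}" using m by simp
      have "s (inv_into (nodes lam) s k) = k" by (rule bij_betw_inv_into_right[OF b kn])
      moreover have "inv_into (nodes lam) s k \<in> nodes lam" by (rule bij_betw_apply[OF bij_betw_inv_into[OF b] kn])
      ultimately show "k \<in> s ` {x\<in>nodes lam. s x \<le> m \<and> P (s x)}"
        using k by (intro image_eqI[of _ _ "inv_into (nodes lam) s k"]) auto
    qed
    have "inj_on s {x\<in>nodes lam. s x \<le> m \<and> P (s x)}"
      using bij_betw_imp_inj_on[OF b] by (rule inj_on_subset) blast
    from card_image[OF this] show ?thesis unfolding img .
  qed
  define A where "A = {x\<in>nodes lam. s x \<le> m \<and> f (s x) \<in> K}"
  define B where "B = {x\<in>nodes lam. s x \<le> m \<and> rword n lam s (s x) \<in> {1..r}}"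
  define Cs where "Cs = snd ` nodes lam"
  have fin: "finite A" "finite B" "finite Cs" using finite_nodes by (auto simp: A_def B_def Cs_def)
  have col: "card {x\<in>A. snd x = c} \<le> card {x\<in>B. snd x = c}" for c
  proof -
    define D where "D = {i. (i, c) \<in> nodes lam \<and> s (i, c) \<le> m}"
    have finD: "finite D"
    proof (rule finite_subset)
      show "D \<subseteq> fst ` nodes lam" by (auto simp: D_def intro: rev_image_eqI)
    qed (use finite_nodes in simp)
    have down: "i' \<in> D" if "i \<in> D" "1 \<le> i'" "i' \<le> i" for i i'
      using standard_col_mono[OF lam s, of i c i'] that by (auto simp: D_def)
    have inj_c: "inj_on (\<lambda>i. (i, c)) S" for S :: "nat set" by (simp add: inj_on_def)
    have "{x\<in>A. snd x = c} = (\<lambda>i. (i, c)) ` {i\<in>D. f (s (i, c)) \<in> K}"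
      unfolding A_def D_def by (auto simp: image_iff)
    with card_image[OF inj_c] have A: "card {x\<in>A. snd x = c} = card {i\<in>D. f (s (i, c)) \<in> K}"
      by (simp only:)
    have "{x\<in>B. snd x = c} = (\<lambda>i. (i, c)) ` {i\<in>D. i \<le> r}"
      unfolding B_def D_def by (auto simp: image_iff rword mem_nodes)
    with card_image[OF inj_c] have B: "card {x\<in>B. snd x = c} = card {i\<in>D. i \<le> r}"
      by (simp only:)
    show ?thesis
    proof (cases "\<exists>i\<in>D. r < i")
      case True
      then obtain i where i: "i \<in> D" "r < i" by blast
      have "{1..r} \<subseteq> {i\<in>D. i \<le> r}" using down[OF i(1)] i(2) by auto
      then have "r \<le> card {i\<in>D. i \<le> r}" using card_mono[of "{i\<in>D. i \<le> r}" "{1..r}"] finD by simp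
      moreover have "card {i\<in>D. f (s (i, c)) \<in> K} \<le> card K"
        by (rule card_inj_on_le[of "\<lambda>i. f (s (i, c))"]) (use K inj in \<open>auto simp: inj_on_def D_def\<close>)
      ultimately show ?thesis using A B K by linarith
    next
      case False
      then have "{i\<in>D. f (s (i, c)) \<in> K} \<subseteq> {i\<in>D. i \<le> r}" by auto
      then show ?thesis unfolding A B using finD by (intro card_mono) auto
    qed
  qed
  have "card {x\<in>A. snd x \<in> Cs} = (\<Sum>c\<in>Cs. card {x\<in>A. snd x = c})" by (rule card_fibres[OF fin(3,1)])
  also have "\<dots> \<le> (\<Sum>c\<in>Cs. card {x\<in>B. snd x = c})" by (rule sum_mono[OF col])
  also have "\<dots> = card {x\<in>B. snd x \<in> Cs}" by (rule card_fibres[OF fin(3,2), symmetric])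
  also have "{x\<in>A. snd x \<in> Cs} = A" by (auto simp: A_def Cs_def intro: rev_image_eqI)
  also have "{x\<in>B. snd x \<in> Cs} = B" by (auto simp: B_def Cs_def intro: rev_image_eqI)
  finally show ?thesis unfolding count A_def B_def .
qed

section \<open>The signed column pairing\<close>

definition col_stab :: "nat \<Rightarrow> nat list \<Rightarrow> (nat \<Rightarrow> nat) set" where
  "col_stab n lam = {c\<in>perms n. \<forall>k\<in>{1..n}. snd (node_of lam (c k)) = snd (node_of lam k)}"

text \<open>Pairing with the signed column sum of \<open>t\<^sup>\<lambda>\<close>, moved to the tableau \<open>s\<close>.\<close>

definition cpair :: "nat \<Rightarrow> nat list \<Rightarrow> (nat \<times> nat \<Rightarrow> nat) \<Rightarrow> ga \<Rightarrow> rat" where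
  "cpair n lam s a = (\<Sum>c\<in>col_stab n lam. of_int (sign c) * a (c \<circ> inv (dperm n lam s)))"

lemma cpair_add: "cpair n lam s (a + b) = cpair n lam s a + cpair n lam s b"
  by (simp add: cpair_def algebra_simps sum.distrib)

lemma cpair_smult: "cpair n lam s (ga_smult r a) = r * cpair n lam s a"
  by (simp add: cpair_def algebra_simps sum_distrib_left)

lemma cpair_0: "cpair n lam s 0 = 0"
  by (simp add: cpair_def)

lemma cpair_diff: "cpair n lam s (a - b) = cpair n lam s a - cpair n lam s b"
  by (simp add: cpair_def algebra_simps sum_subtractf)

lemma cpair_sum: "cpair n lam s (\<Sum>i\<in>I. F i) = (\<Sum>i\<in>I. cpair n lam s (F i))"
  by (induction I rule: infinite_finite_induct)
     (simp_all only: cpair_add cpair_0 sum.infinite sum.empty sum.insert not_False_eq_True)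

lemma cpair_rsub: "rsub p {a. cpair n lam s a = 0}"
  unfolding rsub_def by (auto simp only: mem_Collect_eq cpair_0 cpair_add cpair_smult)

lemma finite_col_stab: "finite (col_stab n lam)"
  unfolding col_stab_def using finite_perms by simp

lemma perm_sign_comp:
  assumes "c \<in> perms n" "d \<in> perms n" shows "sign (c \<circ> d) = sign c * sign d"
  using assms by (auto simp: perms_def intro!: sign_compose permutes_imp_permutation[of "{1..n}"])

lemma col_stab_comp: "c \<in> col_stab n lam \<Longrightarrow> d \<in> col_stab n lam \<Longrightarrow> c \<circ> d \<in> col_stab n lam"
  using perms_in by (auto simp: col_stab_def perms_comp)

lemma col_stab_tr:
  assumes "j \<in> {1..n}" "k \<in> {1..n}" "snd (node_of lam j) = snd (node_of lam k)"
  shows "tr j k \<in> col_stab n lam"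
  using assms transpose_perms[OF assms(1,2)] by (auto simp: col_stab_def Transposition.transpose_def)

text \<open>A sign-reversing bijection that preserves h makes the sum its own negative.\<close>

lemma sum_antisym_0:
  fixes h :: "(nat \<Rightarrow> nat) \<Rightarrow> rat"
  assumes bij: "bij_betw F (col_stab n lam) (col_stab n lam)"
    and sgn: "\<And>c. c \<in> col_stab n lam \<Longrightarrow> sign (F c) = - sign c"
    and h: "\<And>c. c \<in> col_stab n lam \<Longrightarrow> h (F c) = h c"
  shows "(\<Sum>c\<in>col_stab n lam. of_int (sign c) * h c) = 0"
proof -
  have "(\<Sum>c\<in>col_stab n lam. of_int (sign c) * h c) = (\<Sum>c\<in>col_stab n lam. of_int (sign (F c)) * h (F c))"
    by (rule sum.reindex_bij_betw[OF bij, symmetric])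
  also have "\<dots> = (\<Sum>c\<in>col_stab n lam. - (of_int (sign c) * h c))"
    by (rule sum.cong) (use sgn h in auto)
  finally show ?thesis by (simp add: sum_negf)
qed

text \<open>A final swap of j and k stays in the column group and preserves the matching condition,
  but flips the sign.\<close>

lemma cpair_vanish_right:
  assumes jk: "j \<in> {1..n}" "k \<in> {1..n}" "j \<noteq> k" "snd (node_of lam j) = snd (node_of lam k)" "g j = g k"
  shows "cpair n lam s (rmatch n f g) = 0"
  unfolding cpair_def
proof (rule sum_antisym_0[where F="\<lambda>c. tr j k \<circ> c"])
  have t: "tr j k \<in> col_stab n lam" by (rule col_stab_tr[OF jk(1,2,4)])
  have tt: "tr j k \<circ> (tr j k \<circ> c) = c" for c by (simp add: o_assoc)
  show "bij_betw (\<lambda>c. tr j k \<circ> c) (col_stab n lam) (col_stab n lam)"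
    by (rule bij_betw_byWitness[where f'="\<lambda>c. tr j k \<circ> c"]) (use tt col_stab_comp[OF t] in auto)
  fix c assume c: "c \<in> col_stab n lam"
  have tp: "tr j k \<in> perms n" by (rule transpose_perms[OF jk(1,2)])
  have cp: "c \<in> perms n" using c by (simp add: col_stab_def)
  show "sign (tr j k \<circ> c) = - sign c" unfolding perm_sign_comp[OF tp cp] using jk by (simp add: sign_swap_id)
  have g: "g (tr j k x) = g x" for x using jk by (simp add: Transposition.transpose_def)
  let ?d = "inv (dperm n lam s)"
  have "tr j k \<circ> c \<circ> ?d \<in> perms n \<longleftrightarrow> c \<circ> ?d \<in> perms n"
    using perms_comp[OF tp] tt[of "c \<circ> ?d"] by (metis comp_assoc)
  then show "rmatch n f g (tr j k \<circ> c \<circ> ?d) = rmatch n f g (c \<circ> ?d)"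
    unfolding rmatch_def by (simp add: g)
qed

text \<open>Here the swap is performed first. It is transported by d(s), because f is read along the
  columns of s and not of t^lambda.\<close>

lemma cpair_vanish_left:
  assumes d: "dperm n lam s \<in> perms n"
    and jk: "j \<in> {1..n}" "k \<in> {1..n}" "j \<noteq> k" "f j = f k"
    and col: "snd (node_of lam (inv (dperm n lam s) j)) = snd (node_of lam (inv (dperm n lam s) k))"
  shows "cpair n lam s (rmatch n f g) = 0"
  unfolding cpair_def
proof -
  let ?d = "inv (dperm n lam s)"
  let ?t = "tr (?d j) (?d k)"
  have dj: "?d j \<in> {1..n}" "?d k \<in> {1..n}" using perms_in[OF perms_inv[OF d]] jk by auto
  have inj: "inj ?d" using perms_bij[OF perms_inv[OF d]] bij_is_inj by blast
  show "(\<Sum>c\<in>col_stab n lam. of_int (sign c) * rmatch n f g (c \<circ> ?d)) = 0"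
  proof (rule sum_antisym_0[where F="\<lambda>c. c \<circ> ?t"])
    have t: "?t \<in> col_stab n lam" by (rule col_stab_tr[OF dj col])
    have tt: "c \<circ> ?t \<circ> ?t = c" for c by (simp add: comp_assoc)
    show "bij_betw (\<lambda>c. c \<circ> ?t) (col_stab n lam) (col_stab n lam)"
      by (rule bij_betw_byWitness[where f'="\<lambda>c. c \<circ> ?t"]) (use tt col_stab_comp[OF _ t] in auto)
    fix c assume c: "c \<in> col_stab n lam"
    have tp: "?t \<in> perms n" by (rule transpose_perms[OF dj])
    have cp: "c \<in> perms n" using c by (simp add: col_stab_def)
    have "?d j \<noteq> ?d k" using inj jk by (auto dest: injD)
    then show "sign (c \<circ> ?t) = - sign c" unfolding perm_sign_comp[OF cp tp] by (simp add: sign_swap_id)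
    have td: "?t (?d x) = ?d (tr j k x)" for x using inj by (auto simp: Transposition.transpose_def dest: injD)
    have in_p: "c \<circ> ?t \<circ> ?d \<in> perms n" "c \<circ> ?d \<in> perms n" using perms_comp cp tp perms_inv[OF d] by auto
    have tr_in: "tr j k x \<in> {1..n} \<longleftrightarrow> x \<in> {1..n}" for x using jk by (auto simp: Transposition.transpose_def)
    have ft: "f (tr j k x) = f x" for x using jk by (simp add: Transposition.transpose_def)
    have "(\<forall>x\<in>{1..n}. g (c (?d (tr j k x))) = f x) \<longleftrightarrow> (\<forall>x\<in>{1..n}. g (c (?d x)) = f x)"
      using tr_in ft by (metis transpose_involutory)
    then show "rmatch n f g (c \<circ> ?t \<circ> ?d) = rmatch n f g (c \<circ> ?d)"
      using in_p by (simp add: rmatch_def td)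
  qed
qed

lemma node_of_tlam: "is_partition n lam \<Longrightarrow> x \<in> nodes lam \<Longrightarrow> node_of lam (tlam lam x) = x"
proof -
  assume lam: "is_partition n lam" and x: "x \<in> nodes lam"
  show ?thesis
    unfolding node_of_eq[OF lam bij_betw_apply[OF tlam_bij[OF lam] x]]
    by (rule bij_betw_inv_into_left[OF tlam_bij[OF lam] x])
qed

text \<open>A nonzero pairing forces distinct letters of g in each column of t^lambda; then k rows
  of g hold at most \<open>psum lam k\<close> entries.\<close>

lemma cpair_rmatch_dom_ideal:
  assumes lam: "is_partition n lam" and g: "sdom n g lam" shows "cpair n lam s (rmatch n f g) = 0"
proof (rule ccontr)
  assume nz: "cpair n lam s (rmatch n f g) \<noteq> 0"
  obtain k K where K: "finite K" "card K \<le> k" "psum lam k < card {x\<in>{1..n}. g x \<in> K}"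
    using g unfolding sdom_def by blast
  have "card {x\<in>{1..n}. g x \<in> K} \<le> card {x\<in>{1..n}. tword n lam x \<in> {1..k}}"
  proof (rule column_dominance[OF lam tlam_standard[OF lam] _ K(1,2)])
    fix i i' c assume h: "(i, c) \<in> nodes lam" "(i', c) \<in> nodes lam" "g (tlam lam (i, c)) = g (tlam lam (i', c))"
    have "tlam lam (i, c) = tlam lam (i', c)"
    proof (rule ccontr)
      assume ne: "\<not> ?thesis"
      have "cpair n lam s (rmatch n f g) = 0"
        by (rule cpair_vanish_right[OF bij_betw_apply[OF tlam_bij[OF lam] h(1)]
              bij_betw_apply[OF tlam_bij[OF lam] h(2)] ne _ h(3)])
           (simp only: node_of_tlam[OF lam h(1)] node_of_tlam[OF lam h(2)] snd_conv)
      then show False using nz by simp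
    qed
    then have "node_of lam (tlam lam (i, c)) = node_of lam (tlam lam (i', c))" by (rule arg_cong)
    then show "i = i'" unfolding node_of_tlam[OF lam h(1)] node_of_tlam[OF lam h(2)] by simp
  qed simp
  then show False using K(3) words_psum[OF tword_words[OF lam], of k] by linarith
qed

lemma cpair_dom_ideal:
  assumes lam: "is_partition n lam" and a: "a \<in> dom_ideal p n lam" shows "cpair n lam s a = 0"
proof -
  have "dom_ideal p n lam \<subseteq> {a. cpair n lam s a = 0}"
    by (rule dom_ideal_minimal[OF cpair_rsub]) (simp only: mem_Collect_eq cpair_rmatch_dom_ideal[OF lam])
  then show ?thesis using a by blast
qed

text \<open>A numerical refinement of the dominance order on tableaux, which compares the row counts
  of all truncations: comparable words with the same measure have the same counts.\<close>

definition dmeas :: "nat \<Rightarrow> nat \<Rightarrow> (nat \<Rightarrow> nat) \<Rightarrow> nat" where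
  "dmeas n R f = (\<Sum>m\<in>{1..n}. \<Sum>r\<in>{1..R}. card {k\<in>{1..m}. f k \<in> {1..r}})"

lemma inv_dperm:
  assumes lam: "is_partition n lam" and s: "is_tableau n lam s" and x: "x \<in> nodes lam"
  shows "node_of lam (inv (dperm n lam s) (s x)) = x"
proof -
  note d = dperm_perms[OF lam s]
  have "tlam lam x \<in> {1..n}" using bij_betw_apply[OF tlam_bij[OF lam] x] .
  then have "dperm n lam s (tlam lam x) = s x" using node_of_tlam[OF lam x] by (simp add: dperm_def)
  then have "inv (dperm n lam s) (s x) = tlam lam x" using perms_inv_apply(2)[OF d, of "tlam lam x"] by simp
  then show ?thesis using node_of_tlam[OF lam x] by simp
qed

text \<open>A nonzero pairing forces distinct letters of f in each column of s, so every truncated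
  count of f is bounded by that of s. If the measures agree, so do all counts, and their increments
  in m recover the letters.\<close>

lemma cpair_triangular:
  assumes lam: "is_partition n lam" and s: "standard n lam s" and f: "f \<in> words n lam"
    and nz: "cpair n lam s (rmatch n f g) \<noteq> 0"
  shows "f = rword n lam s \<or> dmeas n (length lam) f < dmeas n (length lam) (rword n lam s)"
proof -
  let ?u = "rword n lam s"
  have tab: "is_tableau n lam s" using s by (simp add: standard_def)
  then have sb: "bij_betw s (nodes lam) {1..n}" by (simp add: is_tableau_def)
  have u: "?u \<in> words n lam" by (rule rword_words[OF tab])
  have le: "card {k\<in>{1..m}. f k \<in> {1..r}} \<le> card {k\<in>{1..m}. ?u k \<in> {1..r}}" if "m \<le> n" for m r
  proof (rule column_dominance[OF lam s _ _ _ that])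
    fix i i' c assume h: "(i, c) \<in> nodes lam" "(i', c) \<in> nodes lam" "f (s (i, c)) = f (s (i', c))"
    have "s (i, c) = s (i', c)"
    proof (rule ccontr)
      assume ne: "\<not> ?thesis"
      have "cpair n lam s (rmatch n f g) = 0"
        by (rule cpair_vanish_left[OF dperm_perms[OF lam tab] bij_betw_apply[OF sb h(1)]
              bij_betw_apply[OF sb h(2)] ne h(3)])
           (simp only: inv_dperm[OF lam tab h(1)] inv_dperm[OF lam tab h(2)] snd_conv)
      then show False using nz by simp
    qed
    then have "(i, c) = (i', c)" by (rule inj_onD[OF bij_betw_imp_inj_on[OF sb] _ h(1,2)])
    then show "i = i'" by simp
  qed auto
  show ?thesis
  proof (rule disjCI)
    assume nlt: "\<not> dmeas n (length lam) f < dmeas n (length lam) ?u"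
    have eq: "card {k\<in>{1..m}. f k \<in> {1..r}} = card {k\<in>{1..m}. ?u k \<in> {1..r}}"
      if m: "m \<in> {1..n}" and r: "r \<in> {1..length lam}" for m r
    proof (rule ccontr)
      assume ne: "\<not> ?thesis"
      have "(\<Sum>r\<in>{1..length lam}. card {k\<in>{1..m}. f k \<in> {1..r}}) < (\<Sum>r\<in>{1..length lam}. card {k\<in>{1..m}. ?u k \<in> {1..r}})"
      proof (rule sum_strict_mono_ex1)
        show "\<exists>r\<in>{1..length lam}. card {k\<in>{1..m}. f k \<in> {1..r}} < card {k\<in>{1..m}. ?u k \<in> {1..r}}"
        proof (rule bexI[OF _ r])
          have "m \<le> n" using m by simp
          then show "card {k\<in>{1..m}. f k \<in> {1..r}} < card {k\<in>{1..m}. ?u k \<in> {1..r}}"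
            using ne le[of m r] by linarith
        qed
        show "\<forall>r\<in>{1..length lam}. card {k\<in>{1..m}. f k \<in> {1..r}} \<le> card {k\<in>{1..m}. ?u k \<in> {1..r}}"
          by (rule ballI, rule le) (use m in simp)
      qed simp
      then have "\<exists>m\<in>{1..n}. (\<Sum>r\<in>{1..length lam}. card {k\<in>{1..m}. f k \<in> {1..r}})
          < (\<Sum>r\<in>{1..length lam}. card {k\<in>{1..m}. ?u k \<in> {1..r}})" using m by (rule bexI)
      moreover have "\<forall>m\<in>{1..n}. (\<Sum>r\<in>{1..length lam}. card {k\<in>{1..m}. f k \<in> {1..r}})
          \<le> (\<Sum>r\<in>{1..length lam}. card {k\<in>{1..m}. ?u k \<in> {1..r}})"
      proof (rule ballI, rule sum_mono, rule le)
        fix m assume "m \<in> {1..n}" then show "m \<le> n" by simp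
      qed
      ultimately have "dmeas n (length lam) f < dmeas n (length lam) ?u" unfolding dmeas_def
        by (intro sum_strict_mono_ex1) simp_all
      then show False using nlt by blast
    qed
    have step: "card {k\<in>{1..Suc m}. P k} = card {k\<in>{1..m}. P k} + (if P (Suc m) then 1 else 0)" for P and m :: nat
    proof -
      have "{k\<in>{1..Suc m}. P k} = (if P (Suc m) then insert (Suc m) {k\<in>{1..m}. P k} else {k\<in>{1..m}. P k})"
        by (auto simp: le_Suc_eq)
      then show ?thesis by simp
    qed
    have iff: "f k \<in> {1..r} \<longleftrightarrow> ?u k \<in> {1..r}" if k: "k \<in> {1..n}" and r: "r \<in> {1..length lam}" for k r
    proof -
      obtain m where m: "k = Suc m" using k by (cases k) auto
      have "card {j\<in>{1..m}. f j \<in> {1..r}} = card {j\<in>{1..m}. ?u j \<in> {1..r}}"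
      proof (cases "m = 0")
        case False
        then have "m \<in> {1..n}" using k m by simp
        then show ?thesis using r by (rule eq)
      qed simp
      then have "(if f k \<in> {1..r} then 1 else 0::nat) = (if ?u k \<in> {1..r} then 1 else 0)"
        using eq[OF k r] unfolding m step by linarith
      then show ?thesis by (metis zero_neq_one)
    qed
    show "f = ?u"
    proof (rule words_eqI[OF f u])
      fix k assume k: "k \<in> {1..n}"
      have "f k \<in> {1..length lam}" "?u k \<in> {1..length lam}" using words_range[OF f k] words_range[OF u k] by auto
      moreover from this have "?u k \<le> f k" "f k \<le> ?u k" using iff[OF k, of "f k"] iff[OF k, of "?u k"] by simp_all
      ultimately show "f k = ?u k" by linarith
    qed
  qed
qed

lemma cpair_diag:
  assumes lam: "is_partition n lam" and s: "standard n lam s"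
  shows "cpair n lam s (rmatch n (rword n lam s) (tword n lam)) = 1"
proof -
  have tab: "is_tableau n lam s" using s by (simp add: standard_def)
  note d = dperm_perms[OF lam tab]
  let ?d = "inv (dperm n lam s)"
  have id: "id \<in> col_stab n lam" by (simp add: col_stab_def perms_id)
  have X: "rmatch n (rword n lam s) (tword n lam) (c \<circ> ?d) = (if c = id then 1 else 0)" if c: "c \<in> col_stab n lam" for c
  proof -
    have cp: "c \<in> perms n" using c by (simp add: col_stab_def)
    \<comment> \<open>A column permutation that also preserves the row of every entry of t^lambda
      fixes every node.\<close>
    have "c = id" if *: "\<forall>k\<in>{1..n}. tword n lam (c (?d k)) = rword n lam s k"
    proof
      fix k
      show "c k = id k"
      proof (cases "k \<in> {1..n}")
        case True
        have dk: "dperm n lam s k \<in> {1..n}" using perms_in[OF d] True by simp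
        have "tword n lam (c k) = tword n lam k"
          using *[rule_format, OF dk] tword_dperm[OF lam tab dk] perms_inv_apply(2)[OF d, of k] by simp
        moreover have ck: "c k \<in> {1..n}" using perms_in[OF cp] True by simp
        ultimately have "fst (node_of lam (c k)) = fst (node_of lam k)"
          using tword_eq[OF lam ck] tword_eq[OF lam True] by simp
        moreover have "snd (node_of lam (c k)) = snd (node_of lam k)" using c True by (auto simp: col_stab_def)
        ultimately have "node_of lam (c k) = node_of lam k" by (simp add: prod_eq_iff)
        then show ?thesis using node_of_props(2)[OF lam ck] node_of_props(2)[OF lam True] by simp
      qed (simp add: perms_out[OF cp])
    qed
    moreover have "rmatch n (rword n lam s) (tword n lam) (id \<circ> ?d) = 1"
      using tword_dperm[OF lam tab] perms_inv[OF d] by (simp add: rmatch_def)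
    ultimately show ?thesis by (auto simp: rmatch_def)
  qed
  have "cpair n lam s (rmatch n (rword n lam s) (tword n lam)) = (\<Sum>c\<in>col_stab n lam. if c = id then 1 else 0)"
    unfolding cpair_def by (rule sum.cong) (use X in \<open>auto simp: sign_id\<close>)
  then show ?thesis using id finite_col_stab by simp
qed

section \<open>The standard basis of the cell module\<close>

definition lwords :: "nat \<Rightarrow> nat list \<Rightarrow> (nat \<Rightarrow> nat) set" where
  "lwords n lam = {f\<in>words n lam. lattice n f}"

lemma finite_lwords: "finite (lwords n lam)" unfolding lwords_def using finite_words by simp

text \<open>Let u have least measure among the words with nonzero coefficient. The pairing at the
  tableau of u sees u alone, since any other word it detects has smaller measure.\<close>

lemma lwords_independent:
  assumes lam: "is_partition n lam"
    and z: "\<And>s. standard n lam s \<Longrightarrow> cpair n lam s (\<Sum>f\<in>lwords n lam. ga_smult (r f) (rmatch n f (tword n lam))) = 0"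
  shows "\<forall>f\<in>lwords n lam. r f = 0"
proof (rule ccontr)
  assume nz: "\<not> ?thesis"
  define S where "S = {f\<in>lwords n lam. r f \<noteq> 0}"
  have "finite S" "S \<noteq> {}" using nz finite_lwords by (auto simp: S_def)
  then obtain u where u: "u \<in> S" "\<And>f. f \<in> S \<Longrightarrow> dmeas n (length lam) u \<le> dmeas n (length lam) f"
    using arg_min_if_finite[of S "dmeas n (length lam)"] by (meson not_le)
  then have uY: "u \<in> lwords n lam" "r u \<noteq> 0" by (auto simp: S_def)
  obtain s where s: "standard n lam s" "rword n lam s = u"
    using lattice_standard[OF lam, of u] uY by (auto simp: lwords_def)
  have "r f * cpair n lam s (rmatch n f (tword n lam)) = (if f = u then r u else 0)" if "f \<in> lwords n lam" for f
  proof (cases "f = u")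
    case True
    then show ?thesis using cpair_diag[OF lam s(1)] s(2) by simp
  next
    case False
    have "cpair n lam s (rmatch n f (tword n lam)) = 0" if "r f \<noteq> 0"
    proof (rule ccontr)
      assume nz: "\<not> ?thesis"
      have "f \<in> words n lam" using \<open>f \<in> lwords n lam\<close> by (simp add: lwords_def)
      then have "dmeas n (length lam) f < dmeas n (length lam) u"
        using cpair_triangular[OF lam s(1) _ nz] False s(2) by blast
      then show False using u(2)[of f] \<open>f \<in> lwords n lam\<close> that by (auto simp: S_def)
    qed
    then show ?thesis using False by auto
  qed
  then have "cpair n lam s (\<Sum>f\<in>lwords n lam. ga_smult (r f) (rmatch n f (tword n lam))) = (\<Sum>f\<in>lwords n lam. if f = u then r u else 0)"
    unfolding cpair_sum cpair_smult by (intro sum.cong refl)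
  also have "\<dots> = r u" using finite_lwords uY by simp
  finally show False using z[OF s(1)] uY by simp
qed

lemma lwords_spanning:
  assumes p: "prime p" and lam: "is_partition n lam" and a: "a \<in> GA p n"
  shows "\<exists>r. (\<forall>f. r f \<in> Rloc p) \<and>
    ga_mult n a (xlam n lam) - (\<Sum>f\<in>lwords n lam. ga_smult (r f) (rmatch n f (tword n lam))) \<in> dom_ideal p n lam"
proof -
  let ?S = "\<lambda>r. \<Sum>f\<in>lwords n lam. ga_smult (r f) (rmatch n f (tword n lam))"
  \<comment> \<open>Everything congruent to an R-combination of standard elements; straightening is
    applied with T in place of the ideal.\<close>
  define T where "T = {b. \<exists>r. (\<forall>f. r f \<in> Rloc p) \<and> b - ?S r \<in> dom_ideal p n lam}"
  note JJ = dom_ideal_rsub[OF p, of n lam]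
  have S_add: "?S (\<lambda>f. r f + r' f) = ?S r + ?S r'" for r r'
    by (auto simp: fun_eq_iff sum_fun_apply sum.distrib algebra_simps)
  have S_smult: "?S (\<lambda>f. c * r f) = ga_smult c (?S r)" for c r
    by (auto simp: fun_eq_iff sum_fun_apply sum_distrib_left algebra_simps)
  have S_0: "?S (\<lambda>f. 0) = 0" by (auto simp: fun_eq_iff sum_fun_apply)
  have dom_ideal_T: "dom_ideal p n lam \<subseteq> T"
  proof
    fix b assume b: "b \<in> dom_ideal p n lam"
    then have "b - ?S (\<lambda>f. 0) \<in> dom_ideal p n lam" unfolding S_0 by simp
    then show "b \<in> T" unfolding T_def mem_Collect_eq by (intro exI[of _ "\<lambda>f. 0"]) (simp add: p)
  qed
  have T: "rsub p T"
  proof (rule rsubI)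
    show "0 \<in> T" using dom_ideal_T rsub_0[OF JJ] by blast
  next
    fix a b assume "a \<in> T" "b \<in> T"
    then obtain r r' where r: "\<forall>f. r f \<in> Rloc p" "a - ?S r \<in> dom_ideal p n lam" "\<forall>f. r' f \<in> Rloc p" "b - ?S r' \<in> dom_ideal p n lam"
      unfolding T_def by blast
    have "(a - ?S r) + (b - ?S r') = a + b - ?S (\<lambda>f. r f + r' f)" unfolding S_add by simp
    then have "a + b - ?S (\<lambda>f. r f + r' f) \<in> dom_ideal p n lam" using rsub_add[OF JJ r(2,4)] by metis
    then show "a + b \<in> T" unfolding T_def mem_Collect_eq using r p by (intro exI[of _ "\<lambda>f. r f + r' f"]) simp
  next
    fix c a assume c: "c \<in> Rloc p" "a \<in> T"
    then obtain r where r: "\<forall>f. r f \<in> Rloc p" "a - ?S r \<in> dom_ideal p n lam" unfolding T_def by blast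
    have "ga_smult c (a - ?S r) = ga_smult c a - ?S (\<lambda>f. c * r f)"
      unfolding S_smult by (auto simp: fun_eq_iff algebra_simps)
    then have "ga_smult c a - ?S (\<lambda>f. c * r f) \<in> dom_ideal p n lam" using rsub_smult[OF JJ c(1) r(2)] by metis
    then show "ga_smult c a \<in> T" unfolding T_def mem_Collect_eq using r p c by (intro exI[of _ "\<lambda>f. c * r f"]) simp
  qed
  have "rmatch n f (tword n lam) \<in> T" if f: "f \<in> words n lam" for f
  proof (rule straighten[OF p f tword_words[OF lam] T dom_ideal_T])
    fix f assume f: "f \<in> words n lam" "lattice n f"
    have "?S (\<lambda>f'. if f' = f then 1 else 0) = (\<Sum>f'\<in>lwords n lam. if f' = f then rmatch n f (tword n lam) else 0)"
      by (intro sum.cong refl ext) (simp split: if_split)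
    also have "\<dots> = rmatch n f (tword n lam)" using finite_lwords f by (simp add: lwords_def)
    finally have "rmatch n f (tword n lam) - ?S (\<lambda>f'. if f' = f then 1 else 0) = 0" by (simp only: diff_self)
    then have "rmatch n f (tword n lam) - ?S (\<lambda>f'. if f' = f then 1 else 0) \<in> dom_ideal p n lam" using rsub_0[OF JJ] by metis
    then show "rmatch n f (tword n lam) \<in> T" unfolding T_def mem_Collect_eq
      by (intro exI[of _ "\<lambda>f'. if f' = f then 1 else 0"]) (simp add: p)
  qed
  then have "ga_mult n (ga_of \<sigma>) (xlam n lam) \<in> T" if "\<sigma> \<in> perms n" for \<sigma>
    unfolding xlam_eq[OF lam] rmatch_left[OF that] using words_comp[OF tword_words[OF lam] that] by blast
  then have "a \<in> {a. ga_mult n a (xlam n lam) \<in> T}"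
    by (intro rsub_GA_induct[OF rsub_vimage_mult_left[OF T] _ a]) simp
  then show ?thesis by (simp add: T_def)
qed

text \<open>Modulo the ideal, a x_lambda is a combination of standard elements, whose coefficients
  the pairings detect. As the pairings are rational-valued, this contains the torsion-freeness of
  C(lambda).\<close>

lemma dom_ideal_saturated:
  assumes p: "prime p" and lam: "is_partition n lam" and a: "a \<in> GA p n"
    and z: "\<And>s. standard n lam s \<Longrightarrow> cpair n lam s (ga_mult n a (xlam n lam)) = 0"
  shows "ga_mult n a (xlam n lam) \<in> dom_ideal p n lam"
proof -
  let ?S = "\<lambda>r. \<Sum>f\<in>lwords n lam. ga_smult (r f) (rmatch n f (tword n lam))"
  obtain r where r: "ga_mult n a (xlam n lam) - ?S r \<in> dom_ideal p n lam"
    using lwords_spanning[OF p lam a] by blast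
  have "cpair n lam s (?S r) = 0" if "standard n lam s" for s
    using cpair_dom_ideal[OF lam r, of s] z[OF that] by (simp add: cpair_diff)
  then have "\<forall>f\<in>lwords n lam. r f = 0" by (rule lwords_independent[OF lam])
  then have "?S r = 0" by (intro sum.neutral) (auto simp: fun_eq_iff)
  then show ?thesis using r by (simp only: diff_0_right)
qed

section \<open>Torsion in the induced module\<close>

text \<open>Modulo T the same b is a multiple of a by two different integers. Their difference need
  not be invertible in R; dividing by it is what \<open>sat\<close> is for.\<close>

lemma rsub_diff_smult_int:
  assumes p: "prime p" and T: "rsub p T"
    and sat: "\<And>N a. N \<noteq> 0 \<Longrightarrow> a \<in> GA p n \<Longrightarrow> ga_smult (of_int N) a \<in> T \<Longrightarrow> a \<in> T"
    and ab: "b - ga_smult (of_int i) a \<in> T" "b - ga_smult (of_int j) a \<in> T" "i \<noteq> j" and a: "a \<in> GA p n"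
  shows "a \<in> T"
proof -
  have "(b - ga_smult (of_int i) a) - (b - ga_smult (of_int j) a) = ga_smult (of_int (j - i)) a"
    by (rule ext) (simp add: algebra_simps)
  then have "ga_smult (of_int (j - i)) a \<in> T" using rsub_diff[OF p T ab(1,2)] by metis
  then show ?thesis using sat[of "j - i" a] ab(3) a by simp
qed

text \<open>The contents of \<open>t\<^sup>\<lambda>\<close> occur for no other word, so modulo the relations
\<open>a L\<^sub>k = r\<^sub>\<lambda>(k) a\<close> triangularity removes, up to torsion, all elements \<open>rmatch g f\<close> with \<open>f \<noteq> tword\<close>.\<close>

lemma torsion_words:
  assumes p: "prime p" and lam: "is_partition n lam" and T: "rsub p T"
    and sat: "\<And>N a. N \<noteq> 0 \<Longrightarrow> a \<in> GA p n \<Longrightarrow> ga_smult (of_int N) a \<in> T \<Longrightarrow> a \<in> T"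
    and rel: "\<And>a k. a \<in> GA p n \<Longrightarrow> k \<in> {1..n} \<Longrightarrow>
      ga_mult n a (JM k) - ga_smult (of_int (content lam k)) a \<in> T"
    and mu: "is_partition n mu"
  shows "(\<forall>g\<in>words n lam. rmatch n g (tword n lam) \<in> T) \<or> sdominates mu lam \<Longrightarrow>
    g \<in> words n mu \<Longrightarrow> f \<in> words n mu \<Longrightarrow> rmatch n g f \<in> T"
  using mu
proof (induction mu arbitrary: f g rule: dominance_induct)
  case (1 mu)
  have JT: "dom_ideal p n mu \<subseteq> T"
  proof (rule dom_ideal_minimal_words[OF T])
    fix kap f g
    assume h: "is_partition n kap" "sdominates kap mu" "f \<in> words n kap" "g \<in> words n kap"
    have "(\<forall>g\<in>words n lam. rmatch n g (tword n lam) \<in> T) \<or> sdominates kap lam"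
      using 1(3) sdominates_trans[OF lam 1(1) h(2)] by blast
    then show "rmatch n f g \<in> T" by (rule 1(2)[OF h(1,2) _ h(3,4)])
  qed
  show ?case
    using 1(5)
  proof (induction rule: wt_induct)
    case (1 f)
    show ?case
    \<comment> \<open>If all contents are those of t^lambda, then f is \<open>tword n lam\<close>
      and mu has the parts of lam. The second alternative of the hypothesis is then impossible, and
      the first one is the claim.\<close>
    proof (cases "\<forall>k\<in>{1..n}. wcont f k = wcont (tword n lam) k")
      case True
      have eq: "f k = tword n lam k" if "k \<in> {1..n}" for k
        by (rule wcont_determines[OF tword_lattice[OF lam] _ _ _ that])
           (use words_range(1)[OF tword_words[OF lam]] words_range(1)[OF 1(1)] True in auto)
      then have ft: "f = tword n lam" by (rule words_eqI[OF 1(1) tword_words[OF lam]])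
      have part: "part mu i = part lam i" for i
        using words_D(1)[OF 1(1), of i] words_D(1)[OF tword_words[OF lam], of i] ft by simp
      then have "words n mu = words n lam" by (simp add: words_def)
      moreover have "\<not> sdominates mu lam"
        using sdominates_strict[OF lam \<open>is_partition n mu\<close>] part by (metis nat_less_le psum_def sum.cong)
      ultimately show ?thesis using \<open>(\<forall>g\<in>words n lam. rmatch n g (tword n lam) \<in> T) \<or> sdominates mu lam\<close>
          \<open>g \<in> words n mu\<close> unfolding ft by blast
    next
      case False
      then obtain k where k: "k \<in> {1..n}" "wcont f k \<noteq> content lam k" using wcont_tword[OF lam] by metis
      \<comment> \<open>Modulo heavier words and more dominant types L_k acts by
        \<open>wcont f k\<close>, whereas \<open>rel\<close> makes it act by
        \<open>content lam k\<close>.\<close>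
      have tri: "ga_mult n (rmatch n g f) (JM k) - ga_smult (of_int (wcont f k)) (rmatch n g f) \<in> T"
        by (rule JM_triangular_right[OF p 1(1) \<open>g \<in> words n mu\<close> k(1) T JT 1(2)])
      show ?thesis
        by (rule rsub_diff_smult_int[OF p T sat tri rel[OF rmatch_GA[OF p] k(1)] k(2) rmatch_GA[OF p]])
    qed
  qed
qed

text \<open>All types in the ideal strictly dominate lam, so the exceptional word
  \<open>tword n lam\<close> never occurs.\<close>

lemma torsion_dom_ideal:
  assumes p: "prime p" and lam: "is_partition n lam" and T: "rsub p T"
    and sat: "\<And>N a. N \<noteq> 0 \<Longrightarrow> a \<in> GA p n \<Longrightarrow> ga_smult (of_int N) a \<in> T \<Longrightarrow> a \<in> T"
    and rel: "\<And>a k. a \<in> GA p n \<Longrightarrow> k \<in> {1..n} \<Longrightarrow>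
      ga_mult n a (JM k) - ga_smult (of_int (content lam k)) a \<in> T"
  shows "dom_ideal p n lam \<subseteq> T"
  by (rule dom_ideal_minimal_words[OF T], rule torsion_words[OF p lam T sat rel _ disjI2])

text \<open>Permutations are row-matching elements of type (1^n), so \<open>torsion_words\<close>
  for this one type covers RS_n.\<close>

lemma torsion_GA:
  assumes p: "prime p" and lam: "is_partition n lam" and T: "rsub p T"
    and sat: "\<And>N a. N \<noteq> 0 \<Longrightarrow> a \<in> GA p n \<Longrightarrow> ga_smult (of_int N) a \<in> T \<Longrightarrow> a \<in> T"
    and rel: "\<And>a k. a \<in> GA p n \<Longrightarrow> k \<in> {1..n} \<Longrightarrow>
      ga_mult n a (JM k) - ga_smult (of_int (content lam k)) a \<in> T"
    and x: "\<And>g. g \<in> words n lam \<Longrightarrow> rmatch n g (tword n lam) \<in> T"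
  shows "GA p n \<subseteq> T"
proof
  fix a assume a: "a \<in> GA p n"
  define one where "one = replicate n (1::nat)"
  have one: "is_partition n one" by (simp add: one_def is_partition_def sorted_wrt_iff_nth_less sum_list_replicate)
  \<comment> \<open>Permutations fix the points outside {1..n}, whereas words vanish there.\<close>
  define w where "w \<sigma> k = (if k \<in> {1..n} then \<sigma> k else (0::nat))" for \<sigma> k
  have ww: "w \<sigma> \<in> words n one" if s: "\<sigma> \<in> perms n" for \<sigma>
  proof -
    have "card {k\<in>{1..n}. w \<sigma> k = i} = part one i" for i
    proof -
      have "{k\<in>{1..n}. w \<sigma> k = i} = {k\<in>{1..n}. \<sigma> k = i}" by (auto simp: w_def)
      also have "card \<dots> = card {k\<in>{1..n}. k = i}" by (rule card_perm_vimage[OF s])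
      also have "{k\<in>{1..n}. k = i} = (if i \<in> {1..n} then {i} else {})" by auto
      also have "card \<dots> = part one i" by (auto simp: part_def one_def)
      finally show ?thesis .
    qed
    then show ?thesis by (simp add: words_def w_def)
  qed
  have tx: "\<forall>g\<in>words n lam. rmatch n g (tword n lam) \<in> T" using x by blast
  show "a \<in> T"
  proof (rule rsub_GA_induct[OF T _ a])
    fix \<sigma> assume s: "\<sigma> \<in> perms n"
    have "ga_of \<sigma> = rmatch n (w \<sigma>) (w id)"
      unfolding rmatch_id[OF s] by (rule rmatch_cong) (simp_all only: w_def if_True)
    moreover have "rmatch n (w \<sigma>) (w id) \<in> T"
      by (rule torsion_words[OF p lam T sat rel one disjI1[OF tx] ww[OF s] ww[OF perms_id]])
    ultimately show "ga_of \<sigma> \<in> T" by (simp only:)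
  qed
qed

section \<open>The kernel of the surjection onto the cell module\<close>

lemma xlam_GA: "prime p \<Longrightarrow> xlam n lam \<in> GA p n"
  by (auto simp: GA_def xlam_def row_stab_def)

lemma xlam_square:
  assumes lam: "is_partition n lam"
  shows "ga_mult n (xlam n lam) (xlam n lam) = ga_smult (of_nat (card (row_stab n lam))) (xlam n lam)"
proof -
  have fin: "finite (row_stab n lam)" unfolding row_stab_def using finite_perms by simp
  have "xlam n lam \<rho> = (\<Sum>\<sigma>\<in>row_stab n lam. ga_of \<sigma>) \<rho>" for \<rho>
    using fin by (simp add: sum_fun_apply ga_of_def xlam_def)
  then have "xlam n lam = (\<Sum>\<sigma>\<in>row_stab n lam. ga_of \<sigma>)" by (rule ext)
  then have "ga_mult n (xlam n lam) (xlam n lam) = (\<Sum>\<sigma>\<in>row_stab n lam. ga_mult n (ga_of \<sigma>) (xlam n lam))"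
    using ga_mult_sum_left by metis
  also have "\<dots> = (\<Sum>\<sigma>\<in>row_stab n lam. xlam n lam)"
  proof (rule sum.cong[OF refl])
    fix \<sigma> assume s: "\<sigma> \<in> row_stab n lam"
    then have sp: "\<sigma> \<in> perms n" by (simp add: row_stab_def)
    have "(tword n lam \<circ> \<sigma>) k = tword n lam k" if k: "k \<in> {1..n}" for k
    proof -
      have "\<sigma> k \<in> {1..n}" using perms_in[OF sp] k by blast
      then show ?thesis using s k tword_eq[OF lam] by (simp add: row_stab_def)
    qed
    then show "ga_mult n (ga_of \<sigma>) (xlam n lam) = xlam n lam"
      unfolding xlam_eq[OF lam] rmatch_left[OF sp] by (intro rmatch_cong) (simp_all only:)
  qed
  also have "\<dots> = ga_smult (of_nat (card (row_stab n lam))) (xlam n lam)"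
    by (rule ext, unfold sum_fun_apply) simp
  finally show ?thesis .
qed

lemma row_stab_card_pos: "card (row_stab n lam) \<noteq> 0"
proof -
  have "id \<in> row_stab n lam" by (simp add: row_stab_def perms_id)
  moreover have "finite (row_stab n lam)" unfolding row_stab_def using finite_perms by simp
  ultimately show ?thesis by (metis card_0_eq empty_iff)
qed

lemma rmatch_tword_multiple:
  assumes p: "prime p" and lam: "is_partition n lam"
  obtains b where "b \<in> GA p n" "rmatch n g (tword n lam) = ga_mult n b (xlam n lam)"
proof (cases "\<exists>\<sigma>\<in>perms n. \<forall>k\<in>{1..n}. tword n lam (\<sigma> k) = g k")
  case True
  then obtain \<sigma> where s: "\<sigma> \<in> perms n" "\<forall>k\<in>{1..n}. tword n lam (\<sigma> k) = g k" by blast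
  have "rmatch n g (tword n lam) = rmatch n (tword n lam \<circ> \<sigma>) (tword n lam)" by (rule rmatch_cong) (simp_all add: s(2))
  also have "\<dots> = ga_mult n (ga_of \<sigma>) (xlam n lam)" unfolding xlam_eq[OF lam] rmatch_left[OF s(1)] ..
  finally show thesis by (rule that[OF GA_ga_of[OF p s(1)]])
next
  case False
  then have "rmatch n g (tword n lam) = 0" by (rule rmatch_eq_0)
  then have "rmatch n g (tword n lam) = ga_mult n 0 (xlam n lam)" by (simp only: ga_mult_0_left)
  then show thesis by (rule that[OF rsub_0[OF GA_rsub[OF p]]])
qed

text \<open>The torsion of the kernel, as seen by functionals. Up to z in Z, some multiple N a is b
  x_lambda. Right multiplication by x_lambda and pairing turn the assumption on a into the vanishing
  of |S_lambda| times the pairings of b x_lambda. Hence b x_lambda lies in the ideal, where \<phi>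
  is zero, and N times \<phi> a vanishes.\<close>

lemma functional_vanishes:
  assumes p: "prime p" and lam: "is_partition n lam"
    and add: "\<And>a b. a \<in> GA p n \<Longrightarrow> b \<in> GA p n \<Longrightarrow> \<phi> (a + b) = \<phi> a + \<phi> b"
    and smult: "\<And>r a. r \<in> Rloc p \<Longrightarrow> a \<in> GA p n \<Longrightarrow> \<phi> (ga_smult r a) = r * \<phi> a"
    and JM: "\<And>a k. a \<in> GA p n \<Longrightarrow> k \<in> {1..n} \<Longrightarrow> \<phi> (ga_mult n a (JM k)) = of_int (content lam k) * \<phi> a"
    and a: "a \<in> GA p n" and aJ: "ga_mult n a (xlam n lam) \<in> dom_ideal p n lam"
  shows "\<phi> a = (0::rat)"
proof -
  note G = GA_rsub[OF p, of n]
  note x = xlam_GA[OF p, of n lam]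
  have ri: "of_int N \<in> Rloc p" for N by (rule Rloc_of_int[OF p])
  have \<phi>_0: "\<phi> 0 = 0"
    using smult[OF Rloc_0[OF p] rsub_0[OF G]] by (simp add: ga_smult_def zero_fun_def)
  have \<phi>_diff: "\<phi> (a - b) = \<phi> a - \<phi> b" if "a \<in> GA p n" "b \<in> GA p n" for a b
    using add[OF rsub_diff[OF p G that] that(2)] by simp
  have \<phi>_rel: "\<phi> (ga_mult n a (JM k) - ga_smult (of_int (content lam k)) a) = 0"
    if "a \<in> GA p n" "k \<in> {1..n}" for a k
    unfolding \<phi>_diff[OF GA_mult[OF p that(1) GA_JM[OF p that(2)]] rsub_smult[OF G ri that(1)]]
      JM[OF that] smult[OF ri that(1)] by simp
  define K where "K = {a\<in>GA p n. \<phi> a = 0}"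
  have K: "rsub p K"
    by (rule rsubI) (auto simp: K_def \<phi>_0 add smult rsub_0[OF G] rsub_add[OF G] rsub_smult[OF G])
  have rel_GA: "ga_mult n a (JM k) - ga_smult (of_int (content lam k)) a \<in> GA p n"
    if "a \<in> GA p n" "k \<in> {1..n}" for a k
    by (rule rsub_diff[OF p G GA_mult[OF p that(1) GA_JM[OF p that(2)]] rsub_smult[OF G ri that(1)]])
  \<comment> \<open>The kernel of the rational-valued \<phi> is saturated, so \<phi> vanishes on the
    ideal.\<close>
  have JK: "dom_ideal p n lam \<subseteq> K"
  proof (rule torsion_dom_ideal[OF p lam K])
    show "a \<in> K" if "N \<noteq> 0" "a \<in> GA p n" "ga_smult (of_int N) a \<in> K" for N a
      using that smult[OF ri that(2), of N] by (simp add: K_def)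
    show "ga_mult n a (JM k) - ga_smult (of_int (content lam k)) a \<in> K" if "a \<in> GA p n" "k \<in> {1..n}" for a k
      using rel_GA[OF that] \<phi>_rel[OF that] by (simp add: K_def)
  qed
  \<comment> \<open>Z contains the relations a L_k - r_lambda(k) a: \<phi> kills them by assumption,
    and multiplied by x_lambda they fall into the ideal by \<open>JM_xlam\<close>.\<close>
  define Z where "Z = {z\<in>GA p n. \<phi> z = 0 \<and> (\<forall>s. standard n lam s \<longrightarrow> cpair n lam s (ga_mult n z (xlam n lam)) = 0)}"
  have Z: "rsub p Z"
  proof (rule rsubI)
    show "0 \<in> Z" unfolding Z_def using rsub_0[OF G] \<phi>_0 by (simp only: mem_Collect_eq ga_mult_0_left cpair_0) simp
    show "z + z' \<in> Z" if "z \<in> Z" "z' \<in> Z" for z z'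
      using that rsub_add[OF G, of z z'] add[of z z'] unfolding Z_def ga_mult_add_left mem_Collect_eq cpair_add by simp
    show "ga_smult r z \<in> Z" if "r \<in> Rloc p" "z \<in> Z" for r z
      using that rsub_smult[OF G that(1), of z] smult[OF that(1), of z]
      unfolding Z_def ga_mult_smult_left mem_Collect_eq cpair_smult by simp
  qed
  \<comment> \<open>The factor N makes T saturated, as \<open>torsion_GA\<close> requires; the
    multiples of x_lambda account for the elements \<open>rmatch n g (tword n lam)\<close>.\<close>
  define T where "T = {a\<in>GA p n. \<exists>N b. N \<noteq> 0 \<and> b \<in> GA p n \<and> ga_smult (of_int N) a - ga_mult n b (xlam n lam) \<in> Z}"
  have ZT: "Z \<subseteq> T"
  proof
    fix z assume z: "z \<in> Z"
    have eq: "ga_smult (of_int 1) z - ga_mult n 0 (xlam n lam) = z" unfolding ga_mult_0_left by (rule ext) simp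
    have "ga_smult (of_int 1) z - ga_mult n 0 (xlam n lam) \<in> Z" unfolding eq by (rule z)
    moreover have "z \<in> GA p n" using z by (simp add: Z_def)
    ultimately show "z \<in> T" unfolding T_def mem_Collect_eq
      using rsub_0[OF G] one_neq_zero by (intro conjI exI)
  qed
  have T: "rsub p T"
  proof (rule rsubI)
    show "0 \<in> T" using ZT rsub_0[OF Z] by blast
  next
    fix a a' assume "a \<in> T" "a' \<in> T"
    then obtain N b N' b' where h: "a \<in> GA p n" "a' \<in> GA p n" "N \<noteq> 0" "b \<in> GA p n" "N' \<noteq> 0" "b' \<in> GA p n"
      and z: "ga_smult (of_int N) a - ga_mult n b (xlam n lam) \<in> Z" (is "?z \<in> Z")
        "ga_smult (of_int N') a' - ga_mult n b' (xlam n lam) \<in> Z" (is "?z' \<in> Z")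
      unfolding T_def by blast
    let ?b = "ga_smult (of_int N') b + ga_smult (of_int N) b'"
    have "ga_smult (of_int N') ?z + ga_smult (of_int N) ?z'
      = ga_smult (of_int (N * N')) (a + a') - ga_mult n ?b (xlam n lam)"
      unfolding ga_mult_add_left ga_mult_smult_left by (rule ext) (simp add: algebra_simps)
    then have "ga_smult (of_int (N * N')) (a + a') - ga_mult n ?b (xlam n lam) \<in> Z"
      using rsub_add[OF Z rsub_smult[OF Z ri z(1)] rsub_smult[OF Z ri z(2)], of N' N] by metis
    moreover have "?b \<in> GA p n" "N * N' \<noteq> 0" using h rsub_add[OF G] rsub_smult[OF G ri] by auto
    ultimately show "a + a' \<in> T" unfolding T_def mem_Collect_eq using rsub_add[OF G h(1,2)] by (intro conjI exI)
  next
    fix r a assume r: "r \<in> Rloc p" and "a \<in> T"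
    then obtain N b where h: "a \<in> GA p n" "N \<noteq> 0" "b \<in> GA p n"
      and z: "ga_smult (of_int N) a - ga_mult n b (xlam n lam) \<in> Z" (is "?z \<in> Z") unfolding T_def by blast
    have "ga_smult r ?z = ga_smult (of_int N) (ga_smult r a) - ga_mult n (ga_smult r b) (xlam n lam)"
      unfolding ga_mult_smult_left by (rule ext) (simp add: algebra_simps)
    then have "ga_smult (of_int N) (ga_smult r a) - ga_mult n (ga_smult r b) (xlam n lam) \<in> Z"
      using rsub_smult[OF Z r z] by metis
    then show "ga_smult r a \<in> T" unfolding T_def mem_Collect_eq
      using rsub_smult[OF G r h(1)] rsub_smult[OF G r h(3)] h(2) by (intro conjI exI)
  qed
  have "GA p n \<subseteq> T"
  proof (rule torsion_GA[OF p lam T])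
    fix N :: int and a assume N: "N \<noteq> 0" and a: "a \<in> GA p n" and "ga_smult (of_int N) a \<in> T"
    then obtain N' b where h: "N' \<noteq> 0" "b \<in> GA p n"
      and z: "ga_smult (of_int N') (ga_smult (of_int N) a) - ga_mult n b (xlam n lam) \<in> Z" unfolding T_def by blast
    have "ga_smult (of_int N') (ga_smult (of_int N) a) = ga_smult (of_int (N' * N)) a" by (rule ext) simp
    then have "ga_smult (of_int (N' * N)) a - ga_mult n b (xlam n lam) \<in> Z" using z by (simp only:)
    moreover have "N' * N \<noteq> 0" using N h by simp
    ultimately show "a \<in> T" unfolding T_def mem_Collect_eq using a h(2) by (intro conjI exI)
  next
    fix a k assume ak: "a \<in> GA p n" "k \<in> {1..n}"
    let ?z = "ga_mult n a (JM k) - ga_smult (of_int (content lam k)) a"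
    have "ga_mult n ?z (xlam n lam) =
      ga_mult n a (ga_mult n (JM k) (xlam n lam) - ga_smult (of_int (content lam k)) (xlam n lam))"
      unfolding ga_mult_diff_left ga_mult_diff_right ga_mult_assoc ga_mult_smult_left ga_mult_smult_right ..
    also have "\<dots> \<in> dom_ideal p n lam" by (rule dom_ideal_left[OF p ak(1) JM_xlam[OF p lam ak(2)]])
    finally have "cpair n lam s (ga_mult n ?z (xlam n lam)) = 0" for s by (rule cpair_dom_ideal[OF lam])
    then have "?z \<in> Z" unfolding Z_def mem_Collect_eq using rel_GA[OF ak] \<phi>_rel[OF ak] by (intro conjI allI impI)
    then show "?z \<in> T" using ZT by blast
  next
    fix g
    obtain b where b: "b \<in> GA p n" "rmatch n g (tword n lam) = ga_mult n b (xlam n lam)" by (rule rmatch_tword_multiple[OF p lam])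
    have "ga_smult (of_int 1) (rmatch n g (tword n lam)) - ga_mult n b (xlam n lam) = 0"
      unfolding b(2) by (rule ext) simp
    then have "ga_smult (of_int 1) (rmatch n g (tword n lam)) - ga_mult n b (xlam n lam) \<in> Z" using rsub_0[OF Z] by (simp only:)
    then show "rmatch n g (tword n lam) \<in> T" unfolding T_def mem_Collect_eq
      using b(1) rmatch_GA[OF p] one_neq_zero by (intro conjI exI)
  qed
  then obtain N b where N: "N \<noteq> 0" and b: "b \<in> GA p n"
    and z: "ga_smult (of_int N) a - ga_mult n b (xlam n lam) \<in> Z" (is "?z \<in> Z") using a unfolding T_def by blast
  have "cpair n lam s (ga_mult n b (xlam n lam)) = 0" if s: "standard n lam s" for s
  proof -
    have "cpair n lam s (ga_mult n ?z (xlam n lam)) = 0" using z s by (simp only: Z_def mem_Collect_eq)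
    then have "of_int N * cpair n lam s (ga_mult n a (xlam n lam))
      - of_nat (card (row_stab n lam)) * cpair n lam s (ga_mult n b (xlam n lam)) = 0"
      by (simp only: ga_mult_diff_left ga_mult_smult_left ga_mult_assoc xlam_square[OF lam] ga_mult_smult_right
          cpair_diff cpair_smult)
    then show ?thesis using cpair_dom_ideal[OF lam aJ, of s] row_stab_card_pos[of n lam] by simp
  qed
  then have "ga_mult n b (xlam n lam) \<in> dom_ideal p n lam" by (rule dom_ideal_saturated[OF p lam b])
  then have "\<phi> (ga_mult n b (xlam n lam)) = 0" using JK by (auto simp: K_def)
  moreover have "\<phi> ?z = 0" using z by (simp only: Z_def mem_Collect_eq)
  ultimately have "of_int N * \<phi> a = 0"
    using \<phi>_diff[OF rsub_smult[OF G ri a] GA_mult[OF p b x], of N] smult[OF ri a, of N] by simp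
  then show ?thesis using N by simp
qed

section \<open>Quotient modules\<close>

text \<open>Shared by 1_lambda, the tensor product and the cell module. \<open>quot_mod\<close>
  computes with representatives chosen by \<open>SOME\<close>, and the results do not depend on this
  choice.\<close>

locale additive_quotient =
  fixes M :: "('m::ab_group_add, 'x) lmod_scheme" and N :: "'m set"
  assumes madd_M: "madd M = (+)"
    and N_0: "0 \<in> N" and N_add: "a \<in> N \<Longrightarrow> b \<in> N \<Longrightarrow> a + b \<in> N" and N_neg: "a \<in> N \<Longrightarrow> - a \<in> N"
begin

lemma N_diff: "a \<in> N \<Longrightarrow> b \<in> N \<Longrightarrow> a - b \<in> N"
  using N_add[of a "- b"] N_neg[of b] by simp

lemma mem_coset: "y \<in> coset M N a \<longleftrightarrow> y - a \<in> N"
proof -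
  have "y \<in> coset M N a \<longleftrightarrow> (\<exists>v. y = a + v \<and> v \<in> N)" by (simp add: coset_def madd_M)
  also have "\<dots> \<longleftrightarrow> y - a \<in> N"
  proof
    assume "y - a \<in> N"
    then show "\<exists>v. y = a + v \<and> v \<in> N" by (intro exI[of _ "y - a"]) simp
  qed auto
  finally show ?thesis .
qed

lemma coset_eq_iff: "coset M N a = coset M N b \<longleftrightarrow> a - b \<in> N"
proof
  assume "coset M N a = coset M N b"
  moreover have "a \<in> coset M N a" using N_0 by (simp add: mem_coset)
  ultimately have "a \<in> coset M N b" by blast
  then show "a - b \<in> N" by (simp only: mem_coset)
next
  assume ab: "a - b \<in> N"
  have "y - a \<in> N \<longleftrightarrow> y - b \<in> N" for y
    using N_add[of "y - a" "a - b"] N_diff[of "y - b" "a - b"] ab by auto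
  then show "coset M N a = coset M N b" by (intro set_eqI) (simp only: mem_coset)
qed

lemma some_coset: "(SOME y. y \<in> coset M N a) - a \<in> N"
proof -
  have "a \<in> coset M N a" using N_0 by (simp add: mem_coset)
  then have "(SOME y. y \<in> coset M N a) \<in> coset M N a" by (rule someI)
  then show ?thesis by (simp only: mem_coset)
qed

lemma quot_madd: "madd (quot_mod M N) (coset M N a) (coset M N b) = coset M N (a + b)"
proof -
  let ?a = "SOME y. y \<in> coset M N a" and ?b = "SOME y. y \<in> coset M N b"
  have eq: "(?a + ?b) - (a + b) = (?a - a) + (?b - b)" by (rule add_diff_add)
  have "coset M N (?a + ?b) = coset M N (a + b)"
    unfolding coset_eq_iff eq by (rule N_add[OF some_coset some_coset])
  then show ?thesis by (simp add: quot_mod_def madd_M)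
qed

text \<open>The condition concerns a single class, not additivity of the action everywhere: the
  action on the free module is additive only for functions of finite support.\<close>

lemma quot_mact:
  assumes "\<And>y. y - a \<in> N \<Longrightarrow> mact M r y - mact M r a \<in> N"
  shows "mact (quot_mod M N) r (coset M N a) = coset M N (mact M r a)"
proof -
  have "coset M N (mact M r (SOME y. y \<in> coset M N a)) = coset M N (mact M r a)"
    unfolding coset_eq_iff by (rule assms[OF some_coset])
  then show ?thesis by (simp add: quot_mod_def)
qed

end

lemma mcar_quot: "mcar (quot_mod M N) = coset M N ` mcar M"
  by (simp add: quot_mod_def)

section \<open>The Gelfand--Zetlin algebra and its character\<close>

lemma GZ_GA:
  assumes p: "prime p" and a: "a \<in> GZ p n" shows "a \<in> GA p n"
  using a
proof (induction rule: GZ.induct)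
  case (GZ_add a b) then show ?case using rsub_add[OF GA_rsub[OF p]] by (simp only: ga_add_eq)
next
  case (GZ_smult r a) then show ?case using rsub_smult[OF GA_rsub[OF p]] by blast
qed (auto intro: GA_scal GA_JM GA_mult simp: p)

lemma GZ_rsub: "prime p \<Longrightarrow> rsub p (GZ p n)"
proof (rule rsubI)
  assume p: "prime p"
  have "ga_smult 0 (ga_scal 1) = 0" by (rule ext) simp
  then show "0 \<in> GZ p n" using GZ_smult[OF Rloc_0[OF p] GZ_one, of n] by (simp only:)
  show "a + b \<in> GZ p n" if "a \<in> GZ p n" "b \<in> GZ p n" for a b using GZ.GZ_add[OF that] by (simp only: ga_add_eq)
  show "ga_smult r a \<in> GZ p n" if "r \<in> Rloc p" "a \<in> GZ p n" for r a using GZ.GZ_smult[OF that] .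
qed

lemma GZ_scal: "prime p \<Longrightarrow> r \<in> Rloc p \<Longrightarrow> ga_scal r \<in> GZ p n"
proof -
  assume "prime p" "r \<in> Rloc p"
  then have "ga_smult r (ga_scal 1) \<in> GZ p n" by (intro GZ.GZ_smult GZ_one)
  moreover have "ga_smult r (ga_scal 1) = ga_scal r" by (auto simp: ga_scal_def)
  ultimately show ?thesis by (simp only:)
qed

lemma Ilam_GZ:
  assumes p: "prime p" and a: "a \<in> Ilam p n lam" shows "a \<in> GZ p n"
  using a
proof (induction rule: Ilam.induct)
  case (I_gen i)
  then show ?case by (intro GZ.GZ_add GZ_gen GZ_scal p) (simp_all add: p flip: of_int_minus)
next
  case I_zero
  then show ?case using rsub_0[OF GZ_rsub[OF p]] by (simp only: zero_fun_def)
qed (auto intro: GZ.GZ_add GZ_mult)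

lemma Ilam_quotient:
  assumes p: "prime p" shows "additive_quotient (GZ_mod p n) (Ilam p n lam)"
proof
  show "madd (GZ_mod p n) = (+)" by (auto simp: GZ_mod_def ga_add_eq fun_eq_iff)
  show "0 \<in> Ilam p n lam" using I_zero[of p n lam] by (simp only: zero_fun_def)
  show "a + b \<in> Ilam p n lam" if "a \<in> Ilam p n lam" "b \<in> Ilam p n lam" for a b
    using I_add[OF that] by (simp only: ga_add_eq)
  \<comment> \<open>Negation is not among the rules of \<open>Ilam\<close>; it is multiplication by
    the scalar -1 of GZ_n.\<close>
  show "- a \<in> Ilam p n lam" if "a \<in> Ilam p n lam" for a
  proof -
    have "ga_mult n (ga_scal (-1)) a \<in> Ilam p n lam" by (rule I_lmult[OF GZ_scal[OF p Rloc_m1[OF p]] that])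
    moreover have "ga_mult n (ga_scal (-1)) a = - a"
      unfolding GA_scal_mult[OF GZ_GA[OF p Ilam_GZ[OF p that]]] by (rule ext) simp
    ultimately show ?thesis by (simp only:)
  qed
qed

abbreviation gcls :: "nat \<Rightarrow> nat \<Rightarrow> nat list \<Rightarrow> ga \<Rightarrow> ga set" where
  "gcls p n lam \<equiv> coset (GZ_mod p n) (Ilam p n lam)"

lemma one_lam_car: "mcar (one_lam p n lam) = gcls p n lam ` GZ p n"
  by (simp add: one_lam_def mcar_quot GZ_mod_def)

lemma one_lam_madd: "prime p \<Longrightarrow> madd (one_lam p n lam) (gcls p n lam a) (gcls p n lam b) = gcls p n lam (a + b)"
  unfolding one_lam_def by (rule additive_quotient.quot_madd[OF Ilam_quotient])

lemma one_lam_mact: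
  assumes p: "prime p" and z: "z \<in> GZ p n"
  shows "mact (one_lam p n lam) z (gcls p n lam a) = gcls p n lam (ga_mult n z a)"
proof -
  have m: "mact (GZ_mod p n) = ga_mult n" by (simp add: GZ_mod_def)
  have "mact (quot_mod (GZ_mod p n) (Ilam p n lam)) z (gcls p n lam a) = gcls p n lam (mact (GZ_mod p n) z a)"
  proof (rule additive_quotient.quot_mact[OF Ilam_quotient[OF p]])
    fix y assume "y - a \<in> Ilam p n lam"
    then have "ga_mult n z (y - a) \<in> Ilam p n lam" by (rule I_lmult[OF z])
    then show "mact (GZ_mod p n) z y - mact (GZ_mod p n) z a \<in> Ilam p n lam" by (simp only: m ga_mult_diff_right)
  qed
  then show ?thesis by (simp only: m one_lam_def)
qed

text \<open>The functionals on \<open>RS\<^sub>n\<close> that factor through \<open>R S\<^sub>n \<otimes> 1\<^sub>\<lambda>\<close>.\<close>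

definition balanced :: "nat \<Rightarrow> nat \<Rightarrow> nat list \<Rightarrow> (ga \<Rightarrow> rat) \<Rightarrow> bool" where
  "balanced p n lam \<kappa> \<longleftrightarrow> (\<forall>a\<in>GA p n. \<kappa> a \<in> Rloc p)
    \<and> (\<forall>a\<in>GA p n. \<forall>b\<in>GA p n. \<kappa> (a + b) = \<kappa> a + \<kappa> b)
    \<and> (\<forall>r\<in>Rloc p. \<forall>a\<in>GA p n. \<kappa> (ga_smult r a) = r * \<kappa> a)
    \<and> (\<forall>a\<in>GA p n. \<forall>k\<in>{1..n}. \<kappa> (ga_mult n a (JM k)) = of_int (content lam k) * \<kappa> a)"

lemma balanced_D:
  assumes "balanced p n lam \<kappa>"
  shows "a \<in> GA p n \<Longrightarrow> \<kappa> a \<in> Rloc p"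
    "a \<in> GA p n \<Longrightarrow> b \<in> GA p n \<Longrightarrow> \<kappa> (a + b) = \<kappa> a + \<kappa> b"
    "r \<in> Rloc p \<Longrightarrow> a \<in> GA p n \<Longrightarrow> \<kappa> (ga_smult r a) = r * \<kappa> a"
    "a \<in> GA p n \<Longrightarrow> k \<in> {1..n} \<Longrightarrow> \<kappa> (ga_mult n a (JM k)) = of_int (content lam k) * \<kappa> a"
  using assms by (auto simp: balanced_def)

lemma balanced_vanishes:
  assumes "prime p" "is_partition n lam" "balanced p n lam \<kappa>" "a \<in> GA p n"
    "ga_mult n a (xlam n lam) \<in> dom_ideal p n lam"
  shows "\<kappa> a = 0"
  using functional_vanishes[OF assms(1,2) balanced_D(2-4)[OF assms(3)] assms(4,5)] .

lemma balanced_0: "prime p \<Longrightarrow> balanced p n lam \<kappa> \<Longrightarrow> \<kappa> 0 = 0"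
proof -
  assume p: "prime p" and \<kappa>: "balanced p n lam \<kappa>"
  have "\<kappa> (ga_smult 0 0) = 0 * \<kappa> 0" by (rule balanced_D(3)[OF \<kappa> Rloc_0[OF p] rsub_0[OF GA_rsub[OF p]]])
  moreover have "ga_smult 0 0 = 0" by (rule ext) simp
  ultimately show ?thesis by simp
qed

lemma balanced_sum:
  assumes p: "prime p" and \<kappa>: "balanced p n lam \<kappa>" and F: "\<And>i. i \<in> I \<Longrightarrow> F i \<in> GA p n"
  shows "\<kappa> (\<Sum>i\<in>I. F i) = (\<Sum>i\<in>I. \<kappa> (F i))"
  using F
proof (induction I rule: infinite_finite_induct)
  case (insert x I)
  have "(\<Sum>i\<in>I. F i) \<in> GA p n" using insert.prems by (intro rsub_sum[OF GA_rsub[OF p]]) auto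
  then have "\<kappa> (F x + (\<Sum>i\<in>I. F i)) = \<kappa> (F x) + \<kappa> (\<Sum>i\<in>I. F i)"
    using insert.prems by (intro balanced_D(2)[OF \<kappa>]) auto
  moreover have "\<kappa> (\<Sum>i\<in>I. F i) = (\<Sum>i\<in>I. \<kappa> (F i))" using insert by auto
  ultimately show ?case unfolding sum.insert[OF insert.hyps] by (simp only:)
qed (simp_all only: sum.infinite sum.empty balanced_0[OF p \<kappa>] not_False_eq_True)

text \<open>\<open>Ilam\<close> is generated from both sides. In \<open>balanced_Ilam\<close> a left
  factor from GZ_n is absorbed into a, while a right factor comes out as the scalar s provided
  here.\<close>

lemma balanced_character:
  assumes p: "prime p" and \<kappa>: "balanced p n lam \<kappa>" and c: "c \<in> GZ p n"
  shows "\<exists>s. \<forall>a\<in>GA p n. \<kappa> (ga_mult n a c) = s * \<kappa> a"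
  using c
proof (induction rule: GZ.induct)
  case GZ_one
  have "ga_mult n a (ga_scal 1) = a" if "a \<in> GA p n" for a
    unfolding GA_scal_mult(2)[OF that] by (rule ext) simp
  then show ?case by (intro exI[of _ 1]) simp
next
  case (GZ_gen k)
  then show ?case using balanced_D(4)[OF \<kappa>] by blast
next
  case (GZ_add b c)
  then obtain s t where st: "\<forall>a\<in>GA p n. \<kappa> (ga_mult n a b) = s * \<kappa> a" "\<forall>a\<in>GA p n. \<kappa> (ga_mult n a c) = t * \<kappa> a" by blast
  have "\<kappa> (ga_mult n a (b + c)) = (s + t) * \<kappa> a" if a: "a \<in> GA p n" for a
    unfolding ga_mult_add_right
      balanced_D(2)[OF \<kappa> GA_mult[OF p a GZ_GA[OF p GZ_add(1)]] GA_mult[OF p a GZ_GA[OF p GZ_add(2)]]]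
    using st a by (simp add: algebra_simps)
  then show ?case unfolding ga_add_eq by blast
next
  case (GZ_smult r b)
  then obtain s where s: "\<forall>a\<in>GA p n. \<kappa> (ga_mult n a b) = s * \<kappa> a" by blast
  have "\<kappa> (ga_mult n a (ga_smult r b)) = (r * s) * \<kappa> a" if a: "a \<in> GA p n" for a
    unfolding ga_mult_smult_right balanced_D(3)[OF \<kappa> GZ_smult(1) GA_mult[OF p a GZ_GA[OF p GZ_smult(2)]]]
    using s a by simp
  then show ?case by blast
next
  case (GZ_mult b c)
  then obtain s t where st: "\<forall>a\<in>GA p n. \<kappa> (ga_mult n a b) = s * \<kappa> a" "\<forall>a\<in>GA p n. \<kappa> (ga_mult n a c) = t * \<kappa> a" by blast
  have "\<kappa> (ga_mult n a (ga_mult n b c)) = (t * s) * \<kappa> a" if a: "a \<in> GA p n" for a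
    unfolding ga_mult_assoc[symmetric] using st a GA_mult[OF p a GZ_GA[OF p GZ_mult(1)]] by simp
  then show ?case by blast
qed

lemma balanced_Ilam:
  assumes p: "prime p" and \<kappa>: "balanced p n lam \<kappa>" and i: "i \<in> Ilam p n lam"
  shows "a \<in> GA p n \<Longrightarrow> \<kappa> (ga_mult n a i) = 0"
  using i
proof (induction arbitrary: a rule: Ilam.induct)
  case (I_gen k)
  have r: "- of_int (content lam k) \<in> Rloc p" using Rloc_of_int[OF p, of "- content lam k"] by simp
  have "\<kappa> (ga_mult n a (JM k + ga_scal (- of_int (content lam k))))
      = \<kappa> (ga_mult n a (JM k)) + \<kappa> (ga_smult (- of_int (content lam k)) a)"
    unfolding ga_mult_add_right GA_scal_mult(2)[OF I_gen(2)]
    by (rule balanced_D(2)[OF \<kappa> GA_mult[OF p I_gen(2) GA_JM[OF p I_gen(1)]] rsub_smult[OF GA_rsub[OF p] r I_gen(2)]])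
  also have "\<dots> = 0"
    unfolding balanced_D(4)[OF \<kappa> I_gen(2,1)] balanced_D(3)[OF \<kappa> r I_gen(2)] by simp
  finally show ?case by (simp only: ga_add_eq)
next
  case I_zero
  then show ?case using balanced_0[OF p \<kappa>] by (simp only: zero_fun_def[symmetric] ga_mult_0_right)
next
  case (I_add b c)
  note bc = GZ_GA[OF p Ilam_GZ[OF p I_add(1)]] GZ_GA[OF p Ilam_GZ[OF p I_add(2)]]
  show ?case
    unfolding ga_add_eq ga_mult_add_right
      balanced_D(2)[OF \<kappa> GA_mult[OF p I_add(5) bc(1)] GA_mult[OF p I_add(5) bc(2)]] I_add(3)[OF I_add(5)] I_add(4)[OF I_add(5)]
    by simp
next
  case (I_lmult c i)
  then show ?case unfolding ga_mult_assoc[symmetric] using GA_mult[OF p I_lmult(4) GZ_GA[OF p I_lmult(1)]] by blast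
next
  case (I_rmult c i)
  obtain s where s: "\<forall>a\<in>GA p n. \<kappa> (ga_mult n a c) = s * \<kappa> a" using balanced_character[OF p \<kappa> I_rmult(1)] by blast
  have "ga_mult n a i \<in> GA p n" by (rule GA_mult[OF p I_rmult(4) GZ_GA[OF p Ilam_GZ[OF p I_rmult(2)]]])
  then show ?case unfolding ga_mult_assoc[symmetric] using s I_rmult(3)[OF I_rmult(4)] by simp
qed

section \<open>The tensor product\<close>

abbreviation fcar :: "nat \<Rightarrow> nat \<Rightarrow> nat list \<Rightarrow> (tpair \<Rightarrow> int) set" where
  "fcar p n lam \<equiv> mcar (free_mod p n lam)"

abbreviation push :: "nat \<Rightarrow> nat \<Rightarrow> nat list \<Rightarrow> ga \<Rightarrow> (tpair \<Rightarrow> int) \<Rightarrow> tpair \<Rightarrow> int" where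
  "push p n lam \<equiv> mact (free_mod p n lam)"

lemma fcar_iff: "F \<in> fcar p n lam \<longleftrightarrow> finite {q. F q \<noteq> 0}
    \<and> (\<forall>q. F q \<noteq> 0 \<longrightarrow> fst q \<in> GA p n \<and> snd q \<in> mcar (one_lam p n lam))"
  by (auto simp: free_mod_def)

lemma fs_add_eq: "fs_add F G = F + G"
  by (simp add: fs_add_def plus_fun_def)

lemma fcar_0: "0 \<in> fcar p n lam" by (simp add: fcar_iff)

lemma fcar_add:
  assumes "F \<in> fcar p n lam" "G \<in> fcar p n lam" shows "F + G \<in> fcar p n lam"
proof -
  have "{q. (F + G) q \<noteq> 0} \<subseteq> {q. F q \<noteq> 0} \<union> {q. G q \<noteq> 0}" by auto
  then have "finite {q. (F + G) q \<noteq> 0}" using assms by (auto simp only: fcar_iff intro: finite_subset)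
  moreover have "(F + G) q \<noteq> 0 \<Longrightarrow> F q \<noteq> 0 \<or> G q \<noteq> 0" for q by auto
  ultimately show ?thesis using assms unfolding fcar_iff by blast
qed

lemma fcar_neg: "F \<in> fcar p n lam \<Longrightarrow> - F \<in> fcar p n lam"
  by (simp add: fcar_iff)

lemma fcar_diff: "F \<in> fcar p n lam \<Longrightarrow> G \<in> fcar p n lam \<Longrightarrow> F - G \<in> fcar p n lam"
  using fcar_add[of F p n lam "- G"] fcar_neg[of G p n lam] by simp

lemma fcar_tdelta: "a \<in> GA p n \<Longrightarrow> Y \<in> mcar (one_lam p n lam) \<Longrightarrow> tdelta (a, Y) \<in> fcar p n lam"
  by (auto simp: fcar_iff tdelta_def)

text \<open>The deltas generate the free Z-module under addition and negation, so additive
  statements need checking on pairs only.\<close>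

lemma fcar_induct [consumes 1, case_names zero add neg tdelta]:
  assumes F: "F \<in> fcar p n lam" and 0: "P 0"
    and add: "\<And>F G. F \<in> fcar p n lam \<Longrightarrow> G \<in> fcar p n lam \<Longrightarrow> P F \<Longrightarrow> P G \<Longrightarrow> P (F + G)"
    and neg: "\<And>F. F \<in> fcar p n lam \<Longrightarrow> P F \<Longrightarrow> P (- F)"
    and t: "\<And>a Y. a \<in> GA p n \<Longrightarrow> Y \<in> mcar (one_lam p n lam) \<Longrightarrow> P (tdelta (a, Y))"
  shows "P F"
proof -
  define sc where "sc k q = (\<lambda>q'. k * tdelta q q')" for k :: int and q
  have P_sc: "sc k q \<in> fcar p n lam \<and> P (sc k q)"
    if "fst q \<in> GA p n" "snd q \<in> mcar (one_lam p n lam)" for k q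
  proof -
    have td: "tdelta q \<in> fcar p n lam" "P (tdelta q)" using t[OF that] fcar_tdelta[OF that] by simp_all
    have nat: "sc (int m) q \<in> fcar p n lam \<and> P (sc (int m) q)" for m
    proof (induction m)
      case 0
      have "sc (int 0) q = 0" by (rule ext) (simp add: sc_def)
      then show ?case using \<open>P 0\<close> fcar_0 by (simp only: simp_thms)
    next
      case (Suc m)
      have "sc (int (Suc m)) q = sc (int m) q + tdelta q" by (rule ext) (simp add: sc_def algebra_simps)
      then show ?case using Suc td add fcar_add by metis
    qed
    have "sc (- int m) q = - sc (int m) q" for m by (rule ext) (simp add: sc_def)
    then have "sc (- int m) q \<in> fcar p n lam \<and> P (sc (- int m) q)" for m
      using nat[of m] neg fcar_neg by metis
    then show ?thesis using nat by (cases k rule: int_cases2) auto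
  qed
  have fin: "finite {q. F q \<noteq> 0}" and sup: "\<And>q. F q \<noteq> 0 \<Longrightarrow> fst q \<in> GA p n \<and> snd q \<in> mcar (one_lam p n lam)"
    using F by (auto simp only: fcar_iff)
  have "(\<Sum>q\<in>S. sc (F q) q) \<in> fcar p n lam \<and> P (\<Sum>q\<in>S. sc (F q) q)" if "finite S" "S \<subseteq> {q. F q \<noteq> 0}" for S
    using that
  proof (induction S rule: finite_induct)
    case empty
    then show ?case using 0 fcar_0 by (simp only: sum.empty simp_thms)
  next
    case (insert q S)
    have "sc (F q) q \<in> fcar p n lam \<and> P (sc (F q) q)" using insert.prems sup by (intro P_sc) auto
    moreover have "(\<Sum>q\<in>S. sc (F q) q) \<in> fcar p n lam \<and> P (\<Sum>q\<in>S. sc (F q) q)"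
      using insert.prems by (intro insert.IH) auto
    ultimately show ?case unfolding sum.insert[OF insert.hyps] using add fcar_add by blast
  qed
  then have "P (\<Sum>q\<in>{q. F q \<noteq> 0}. sc (F q) q)" using fin by blast
  moreover have "(\<Sum>q\<in>{q. F q \<noteq> 0}. sc (F q) q) = F"
  proof
    fix q'
    have "(\<Sum>q\<in>{q. F q \<noteq> 0}. sc (F q) q) q' = (\<Sum>q\<in>{q. F q \<noteq> 0}. if q = q' then F q else 0)"
      unfolding sum_fun_apply by (rule sum.cong) (auto simp: sc_def tdelta_def)
    then show "(\<Sum>q\<in>{q. F q \<noteq> 0}. sc (F q) q) q' = F q'" using fin by simp
  qed
  ultimately show ?thesis by (simp only:)
qed

text \<open>The defining sum runs over a set depending on F; with a fixed finite superset S it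
  becomes linear in F.\<close>

lemma push_apply:
  assumes "finite S" "{q. F q \<noteq> 0} \<subseteq> S"
  shows "push p n lam x F (b, Y) = (\<Sum>q\<in>S. if ga_mult n x (fst q) = b \<and> snd q = Y then F q else 0)"
proof -
  have "push p n lam x F (b, Y) = (\<Sum>a\<in>{a. F (a, Y) \<noteq> 0 \<and> ga_mult n x a = b}. F (a, Y))"
    by (simp add: free_mod_def)
  also have "\<dots> = (\<Sum>q\<in>(\<lambda>a. (a, Y)) ` {a. F (a, Y) \<noteq> 0 \<and> ga_mult n x a = b}. F q)"
    by (subst sum.reindex) (auto simp: inj_on_def)
  also have "\<dots> = (\<Sum>q\<in>S. if ga_mult n x (fst q) = b \<and> snd q = Y then F q else 0)"
    using assms by (intro sum.mono_neutral_cong_left) (auto simp: image_iff)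
  finally show ?thesis .
qed

lemma push_add:
  assumes "F \<in> fcar p n lam" "G \<in> fcar p n lam"
  shows "push p n lam x (F + G) = push p n lam x F + push p n lam x G"
proof (rule ext, clarify)
  fix b Y
  let ?S = "{q. F q \<noteq> 0} \<union> {q. G q \<noteq> 0}"
  have "finite ?S" using assms by (simp add: fcar_iff)
  moreover have "{q. (F + G) q \<noteq> 0} \<subseteq> ?S" by auto
  ultimately show "push p n lam x (F + G) (b, Y) = (push p n lam x F + push p n lam x G) (b, Y)"
    unfolding plus_fun_apply
    by (subst (1 2 3) push_apply[where S="?S"]) (auto simp flip: sum.distrib intro!: sum.cong)
qed

lemma push_neg:
  assumes "F \<in> fcar p n lam" shows "push p n lam x (- F) = - push p n lam x F"
proof (rule ext, clarify)
  fix b Y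
  have fin: "finite {q. F q \<noteq> 0}" using assms by (simp add: fcar_iff)
  show "push p n lam x (- F) (b, Y) = (- push p n lam x F) (b, Y)"
    unfolding uminus_apply push_apply[where F=F, OF fin order_refl]
    by (subst push_apply[where S="{q. F q \<noteq> 0}"]) (auto simp: fin simp flip: sum_negf intro!: sum.cong)
qed

lemma push_diff: "F \<in> fcar p n lam \<Longrightarrow> G \<in> fcar p n lam \<Longrightarrow>
    push p n lam x (F - G) = push p n lam x F - push p n lam x G"
  using push_add[of F p n lam "- G" x] push_neg[of G p n lam x] fcar_neg[of G p n lam] by simp

lemma push_tdelta: "push p n lam x (tdelta (a, Y)) = tdelta (ga_mult n x a, Y)"
proof (rule ext, clarify)
  fix b Z
  show "push p n lam x (tdelta (a, Y)) (b, Z) = tdelta (ga_mult n x a, Y) (b, Z)"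
    by (subst push_apply[where S="{(a, Y)}"]) (auto simp: tdelta_def)
qed

lemma push_0: "push p n lam x 0 = 0"
  using push_diff[OF fcar_0 fcar_0, of p n lam x] by simp

lemma push_fcar:
  assumes p: "prime p" and x: "x \<in> GA p n" and F: "F \<in> fcar p n lam" shows "push p n lam x F \<in> fcar p n lam"
  using F
proof (induction rule: fcar_induct)
  case zero show ?case unfolding push_0 by (rule fcar_0)
next
  case (add F G) then show ?case unfolding push_add[OF add(1,2)] by (intro fcar_add)
next
  case (neg F) then show ?case unfolding push_neg[OF neg(1)] by (intro fcar_neg)
next
  case (tdelta a Y) then show ?case unfolding push_tdelta using GA_mult[OF p x] by (intro fcar_tdelta)
qed

lemma push_comp:
  assumes p: "prime p" and y: "y \<in> GA p n" and F: "F \<in> fcar p n lam"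
  shows "push p n lam x (push p n lam y F) = push p n lam (ga_mult n x y) F"
  using F
proof (induction rule: fcar_induct)
  case zero show ?case by (simp only: push_0)
next
  case (add F G)
  then show ?case
    by (simp only: push_add push_fcar[OF p y])
next
  case (neg F) then show ?case by (simp only: push_neg push_fcar[OF p y])
next
  case (tdelta a Y) then show ?case by (simp only: push_tdelta ga_mult_assoc)
qed

lemma one_lam_closed:
  assumes p: "prime p" and Y: "Y \<in> mcar (one_lam p n lam)"
  shows "Z \<in> mcar (one_lam p n lam) \<Longrightarrow> madd (one_lam p n lam) Y Z \<in> mcar (one_lam p n lam)"
    "z \<in> GZ p n \<Longrightarrow> mact (one_lam p n lam) z Y \<in> mcar (one_lam p n lam)"
  using Y unfolding one_lam_car
  by (auto simp: one_lam_madd[OF p] one_lam_mact[OF p] intro!: imageI rsub_add[OF GZ_rsub[OF p]] GZ_mult)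

lemma tens_rel_0: "0 \<in> tens_rel p n lam"
  using rel_zero[of p n lam] by (simp only: zero_fun_def)

lemma tens_rel_fcar:
  assumes p: "prime p" and F: "F \<in> tens_rel p n lam" shows "F \<in> fcar p n lam"
  using F
proof (induction rule: tens_rel.induct)
  case (rel_l a a' Y)
  have "tdelta (ga_add a a', Y) - tdelta (a, Y) - tdelta (a', Y) \<in> fcar p n lam"
    using rel_l rsub_add[OF GA_rsub[OF p]] unfolding ga_add_eq by (intro fcar_diff fcar_tdelta)
  then show ?case by (simp only: fun_diff_def)
next
  case (rel_r a Y Z)
  have "tdelta (a, madd (one_lam p n lam) Y Z) - tdelta (a, Y) - tdelta (a, Z) \<in> fcar p n lam"
    using rel_r one_lam_closed[OF p] by (intro fcar_diff fcar_tdelta)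
  then show ?case by (simp only: fun_diff_def)
next
  case (rel_bal a b Y)
  have "tdelta (ga_mult n a b, Y) - tdelta (a, mact (one_lam p n lam) b Y) \<in> fcar p n lam"
    using rel_bal one_lam_closed(2)[OF p rel_bal(3,2)] GA_mult[OF p rel_bal(1) GZ_GA[OF p rel_bal(2)]]
    by (intro fcar_diff fcar_tdelta)
  then show ?case by (simp only: fun_diff_def)
next
  case rel_zero show ?case using fcar_0 by (simp only: zero_fun_def)
next
  case (rel_add F G) then show ?case unfolding fs_add_eq by (intro fcar_add)
next
  case (rel_neg F) then show ?case using fcar_neg[of F] by (simp only: fun_Compl_def)
qed

lemma push_tens_rel:
  assumes p: "prime p" and x: "x \<in> GA p n" and F: "F \<in> tens_rel p n lam"
  shows "push p n lam x F \<in> tens_rel p n lam"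
  using F
proof (induction rule: tens_rel.induct)
  case (rel_l a a' Y)
  have aa: "a + a' \<in> GA p n" using rel_l rsub_add[OF GA_rsub[OF p]] by blast
  have "push p n lam x (tdelta (ga_add a a', Y) - tdelta (a, Y) - tdelta (a', Y)) =
    tdelta (ga_add (ga_mult n x a) (ga_mult n x a'), Y) - tdelta (ga_mult n x a, Y) - tdelta (ga_mult n x a', Y)"
    using rel_l aa unfolding ga_add_eq
    by (simp only: push_diff fcar_diff fcar_tdelta push_tdelta ga_mult_add_right)
  moreover have "tdelta (ga_add (ga_mult n x a) (ga_mult n x a'), Y) - tdelta (ga_mult n x a, Y) - tdelta (ga_mult n x a', Y)
      \<in> tens_rel p n lam"
    unfolding fun_diff_def using rel_l GA_mult[OF p x] by (intro tens_rel.rel_l)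
  ultimately show ?case by (simp only: fun_diff_def)
next
  case (rel_r a Y Z)
  have "push p n lam x (tdelta (a, madd (one_lam p n lam) Y Z) - tdelta (a, Y) - tdelta (a, Z)) =
    tdelta (ga_mult n x a, madd (one_lam p n lam) Y Z) - tdelta (ga_mult n x a, Y) - tdelta (ga_mult n x a, Z)"
    using rel_r one_lam_closed[OF p] by (simp only: push_diff fcar_diff fcar_tdelta push_tdelta)
  moreover have "tdelta (ga_mult n x a, madd (one_lam p n lam) Y Z) - tdelta (ga_mult n x a, Y) - tdelta (ga_mult n x a, Z)
      \<in> tens_rel p n lam"
    unfolding fun_diff_def using rel_r GA_mult[OF p x] by (intro tens_rel.rel_r)
  ultimately show ?case by (simp only: fun_diff_def)
next
  case (rel_bal a b Y)
  have "push p n lam x (tdelta (ga_mult n a b, Y) - tdelta (a, mact (one_lam p n lam) b Y)) =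
    tdelta (ga_mult n (ga_mult n x a) b, Y) - tdelta (ga_mult n x a, mact (one_lam p n lam) b Y)"
    using rel_bal one_lam_closed[OF p] GA_mult[OF p] GZ_GA[OF p]
    by (simp only: push_diff fcar_diff fcar_tdelta push_tdelta ga_mult_assoc)
  moreover have "tdelta (ga_mult n (ga_mult n x a) b, Y) - tdelta (ga_mult n x a, mact (one_lam p n lam) b Y)
      \<in> tens_rel p n lam"
    unfolding fun_diff_def using rel_bal GA_mult[OF p x] by (intro tens_rel.rel_bal)
  ultimately show ?case by (simp only: fun_diff_def)
next
  case rel_zero show ?case using push_0[of p n lam x] tens_rel_0 by (simp only: zero_fun_def)
next
  case (rel_add F G)
  then show ?case unfolding fs_add_eq push_add[OF tens_rel_fcar[OF p rel_add(1)] tens_rel_fcar[OF p rel_add(2)]]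
    by (intro tens_rel.rel_add[unfolded fs_add_eq])
next
  case (rel_neg F)
  then have "- push p n lam x F \<in> tens_rel p n lam" unfolding fun_Compl_def by (intro tens_rel.rel_neg)
  then show ?case using push_neg[OF tens_rel_fcar[OF p rel_neg(1)], of x] by (simp only: fun_Compl_def)
qed

lemma tensor_quotient: "additive_quotient (free_mod p n lam) (tens_rel p n lam)"
proof
  show "madd (free_mod p n lam) = (+)" by (auto simp: free_mod_def fs_add_eq fun_eq_iff)
  show "0 \<in> tens_rel p n lam" by (rule tens_rel_0)
  show "F + G \<in> tens_rel p n lam" if "F \<in> tens_rel p n lam" "G \<in> tens_rel p n lam" for F G
    using rel_add[OF that] by (simp only: fs_add_eq)
  show "- F \<in> tens_rel p n lam" if "F \<in> tens_rel p n lam" for F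
    using rel_neg[OF that] by (simp only: fun_Compl_def)
qed

abbreviation tcls :: "nat \<Rightarrow> nat \<Rightarrow> nat list \<Rightarrow> (tpair \<Rightarrow> int) \<Rightarrow> (tpair \<Rightarrow> int) set" where
  "tcls p n lam \<equiv> coset (free_mod p n lam) (tens_rel p n lam)"

lemma tensor_car: "mcar (tensor_mod p n lam) = tcls p n lam ` fcar p n lam"
  by (simp add: tensor_mod_def mcar_quot)

lemma tensor_madd: "madd (tensor_mod p n lam) (tcls p n lam F) (tcls p n lam G) = tcls p n lam (F + G)"
  unfolding tensor_mod_def by (rule additive_quotient.quot_madd[OF tensor_quotient])

lemma tensor_mact:
  assumes p: "prime p" and x: "x \<in> GA p n" and F: "F \<in> fcar p n lam"
  shows "mact (tensor_mod p n lam) x (tcls p n lam F) = tcls p n lam (push p n lam x F)"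
  unfolding tensor_mod_def
proof (rule additive_quotient.quot_mact[OF tensor_quotient])
  fix G assume G: "G - F \<in> tens_rel p n lam"
  \<comment> \<open>The chosen representative differs from F by a relation, so it is again in the
    free module, as \<open>push_diff\<close> requires.\<close>
  have "(G - F) + F \<in> fcar p n lam" by (rule fcar_add[OF tens_rel_fcar[OF p G] F])
  then have "G \<in> fcar p n lam" by simp
  then show "push p n lam x G - push p n lam x F \<in> tens_rel p n lam"
    using push_tens_rel[OF p x G] F by (simp only: push_diff)
qed

section \<open>The dual of the tensor product\<close>

abbreviation one1 :: "nat \<Rightarrow> nat \<Rightarrow> nat list \<Rightarrow> ga set" where
  "one1 p n lam \<equiv> gcls p n lam (ga_scal 1)"

text \<open>\<open>tens1 a\<close> is \<open>a \<otimes> 1\<close>.\<close>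

definition tens1 :: "nat \<Rightarrow> nat \<Rightarrow> nat list \<Rightarrow> ga \<Rightarrow> (tpair \<Rightarrow> int) set" where
  "tens1 p n lam a = tcls p n lam (tdelta (a, one1 p n lam))"

abbreviation TM :: "nat \<Rightarrow> nat \<Rightarrow> nat list \<Rightarrow> (tpair \<Rightarrow> int) set lmod" where
  "TM p n lam \<equiv> tensor_mod p n lam"

abbreviation Dual :: "nat \<Rightarrow> nat \<Rightarrow> nat list \<Rightarrow> ((tpair \<Rightarrow> int) set \<Rightarrow> rat) set" where
  "Dual p n lam \<equiv> dual_set p (TM p n lam)"

lemma tcls_eqI: "F - G \<in> tens_rel p n lam \<Longrightarrow> tcls p n lam F = tcls p n lam G"
  using additive_quotient.coset_eq_iff[OF tensor_quotient] by blast

lemma one1_in: "one1 p n lam \<in> mcar (one_lam p n lam)"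
  unfolding one_lam_car by (rule imageI[OF GZ_one])

lemma tens1_in: "a \<in> GA p n \<Longrightarrow> tens1 p n lam a \<in> mcar (TM p n lam)"
  unfolding tensor_car tens1_def by (intro imageI fcar_tdelta one1_in)

lemma tens1_add:
  assumes "a \<in> GA p n" "b \<in> GA p n"
  shows "madd (TM p n lam) (tens1 p n lam a) (tens1 p n lam b) = tens1 p n lam (a + b)"
  unfolding tens1_def tensor_madd
proof (rule tcls_eqI)
  have "(\<lambda>q. - (tdelta (ga_add a b, one1 p n lam) q - tdelta (a, one1 p n lam) q - tdelta (b, one1 p n lam) q))
      \<in> tens_rel p n lam" by (intro rel_neg rel_l assms one1_in)
  moreover have "(\<lambda>q. - (tdelta (ga_add a b, one1 p n lam) q - tdelta (a, one1 p n lam) q - tdelta (b, one1 p n lam) q))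
      = tdelta (a, one1 p n lam) + tdelta (b, one1 p n lam) - tdelta (a + b, one1 p n lam)"
    by (rule ext) (simp add: ga_add_eq)
  ultimately show "tdelta (a, one1 p n lam) + tdelta (b, one1 p n lam) - tdelta (a + b, one1 p n lam) \<in> tens_rel p n lam"
    by (simp only:)
qed

lemma tens1_mact:
  assumes "prime p" "r \<in> GA p n" "a \<in> GA p n"
  shows "mact (TM p n lam) r (tens1 p n lam a) = tens1 p n lam (ga_mult n r a)"
  unfolding tens1_def tensor_mact[OF assms(1,2) fcar_tdelta[OF assms(3) one1_in]] push_tdelta ..

text \<open>Balancing moves z across the tensor sign, so the elements a \<otimes> 1 exhaust the pure
  tensors.\<close>

lemma tcls_tdelta_gcls:
  assumes p: "prime p" and a: "a \<in> GA p n" and z: "z \<in> GZ p n"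
  shows "tcls p n lam (tdelta (a, gcls p n lam z)) = tens1 p n lam (ga_mult n a z)"
proof -
  have "ga_mult n z (ga_scal 1) = z"
    unfolding GA_scal_mult(2)[OF GZ_GA[OF p z]] by (rule ext) simp
  then have m: "mact (one_lam p n lam) z (one1 p n lam) = gcls p n lam z" unfolding one_lam_mact[OF p z] by (rule arg_cong)
  have "tdelta (ga_mult n a z, one1 p n lam) - tdelta (a, gcls p n lam z) \<in> tens_rel p n lam"
    using rel_bal[OF a z one1_in[of p n lam]] unfolding m fun_diff_def .
  then show ?thesis unfolding tens1_def by (intro tcls_eqI[symmetric])
qed

lemma Dual_D:
  assumes "\<phi> \<in> Dual p n lam"
  shows "m \<notin> mcar (TM p n lam) \<Longrightarrow> \<phi> m = 0"
    "m \<in> mcar (TM p n lam) \<Longrightarrow> \<phi> m \<in> Rloc p"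
    "m \<in> mcar (TM p n lam) \<Longrightarrow> m' \<in> mcar (TM p n lam) \<Longrightarrow> \<phi> (madd (TM p n lam) m m') = \<phi> m + \<phi> m'"
    "r \<in> Rloc p \<Longrightarrow> m \<in> mcar (TM p n lam) \<Longrightarrow> \<phi> (mact (TM p n lam) (ga_scal r) m) = r * \<phi> m"
  using assms by (auto simp: dual_set_def)

lemma Dual_balanced:
  assumes p: "prime p" and \<phi>: "\<phi> \<in> Dual p n lam"
  shows "balanced p n lam (\<lambda>a. \<phi> (tens1 p n lam a))"
proof -
  have smult: "\<phi> (tens1 p n lam (ga_smult r a)) = r * \<phi> (tens1 p n lam a)" if "r \<in> Rloc p" "a \<in> GA p n" for r a
    using Dual_D(4)[OF \<phi> that(1) tens1_in[OF that(2)]] tens1_mact[OF p GA_scal[OF p that(1)] that(2), of lam]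
    unfolding GA_scal_mult(1)[OF that(2)] by (simp only:)
  show ?thesis
    unfolding balanced_def
  proof (intro conjI ballI)
    fix a assume a: "a \<in> GA p n"
    show "\<phi> (tens1 p n lam a) \<in> Rloc p" by (rule Dual_D(2)[OF \<phi> tens1_in[OF a]])
    show "\<phi> (tens1 p n lam (a + b)) = \<phi> (tens1 p n lam a) + \<phi> (tens1 p n lam b)" if b: "b \<in> GA p n" for b
      using Dual_D(3)[OF \<phi> tens1_in[OF a] tens1_in[OF b]] unfolding tens1_add[OF a b] .
    show "\<phi> (tens1 p n lam (ga_smult r a)) = r * \<phi> (tens1 p n lam a)" if "r \<in> Rloc p" for r by (rule smult[OF that a])
    fix k assume k: "k \<in> {1..n}"
    let ?c = "of_int (content lam k) :: rat"
    have c: "?c \<in> Rloc p" by (rule Rloc_of_int[OF p])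
    \<comment> \<open>L_k and its content have the same class in 1_lambda, so L_k can be moved
      across the tensor sign and come back as a scalar.\<close>
    have "ga_add (JM k) (ga_scal (- ?c)) = JM k - ga_scal ?c" by (rule ext) (simp add: ga_add_def ga_scal_def)
    then have "JM k - ga_scal ?c \<in> Ilam p n lam" using I_gen[OF k, where p=p and lam=lam] by (simp only:)
    then have eq: "gcls p n lam (JM k) = gcls p n lam (ga_scal ?c)"
      using additive_quotient.coset_eq_iff[OF Ilam_quotient[OF p]] by blast
    have "tens1 p n lam (ga_mult n a (JM k)) = tens1 p n lam (ga_smult ?c a)"
      using tcls_tdelta_gcls[OF p a GZ_gen[OF k], where lam=lam] tcls_tdelta_gcls[OF p a GZ_scal[OF p c], where lam=lam]
      unfolding eq GA_scal_mult(2)[OF a] by (simp only:)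
    then show "\<phi> (tens1 p n lam (ga_mult n a (JM k))) = ?c * \<phi> (tens1 p n lam a)" using smult[OF c a] by (simp only:)
  qed
qed

lemma Dual_tcls_add:
  assumes "\<phi> \<in> Dual p n lam" "F \<in> fcar p n lam" "G \<in> fcar p n lam"
  shows "\<phi> (tcls p n lam (F + G)) = \<phi> (tcls p n lam F) + \<phi> (tcls p n lam G)"
  using Dual_D(3)[OF assms(1), of "tcls p n lam F" "tcls p n lam G"] assms(2,3)
  unfolding tensor_car tensor_madd by blast

lemma Dual_eqI:
  assumes p: "prime p" and \<phi>: "\<phi> \<in> Dual p n lam" and \<psi>: "\<psi> \<in> Dual p n lam"
    and eq: "\<And>a. a \<in> GA p n \<Longrightarrow> \<phi> (tens1 p n lam a) = \<psi> (tens1 p n lam a)"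
  shows "\<phi> = \<psi>"
proof
  fix m
  have \<chi>_0: "\<chi> (tcls p n lam 0) = 0" if "\<chi> \<in> Dual p n lam" for \<chi>
    using Dual_tcls_add[OF that fcar_0 fcar_0] by simp
  have \<chi>_neg: "\<chi> (tcls p n lam (- F)) = - \<chi> (tcls p n lam F)" if "\<chi> \<in> Dual p n lam" "F \<in> fcar p n lam" for \<chi> F
    using Dual_tcls_add[OF that(1) fcar_neg[OF that(2)] that(2)] \<chi>_0[OF that(1)] by simp
  have "\<phi> (tcls p n lam F) = \<psi> (tcls p n lam F)" if "F \<in> fcar p n lam" for F
    using that
  proof (induction rule: fcar_induct)
    case zero then show ?case by (simp only: \<chi>_0[OF \<phi>] \<chi>_0[OF \<psi>])
  next
    case (add F G)
    then show ?case by (simp only: Dual_tcls_add[OF \<phi>] Dual_tcls_add[OF \<psi>])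
  next
    case (neg F)
    then show ?case by (simp only: \<chi>_neg[OF \<phi>] \<chi>_neg[OF \<psi>])
  next
    case (tdelta a Y)
    then obtain z where z: "z \<in> GZ p n" "Y = gcls p n lam z" unfolding one_lam_car by blast
    show ?case unfolding z(2) tcls_tdelta_gcls[OF p tdelta(1) z(1)]
      by (rule eq[OF GA_mult[OF p tdelta(1) GZ_GA[OF p z(1)]]])
  qed
  then show "\<phi> m = \<psi> m"
    using Dual_D(1)[OF \<phi>, of m] Dual_D(1)[OF \<psi>, of m] unfolding tensor_car by (cases "m \<in> tcls p n lam ` fcar p n lam") auto
qed

section \<open>Functionals on the tensor product built from balanced ones\<close>

text \<open>Value at a \<otimes> X through a representative of the class X; \<open>hval_gcls\<close>
  shows that the representative does not matter.\<close>

definition hval :: "nat \<Rightarrow> (ga \<Rightarrow> rat) \<Rightarrow> tpair \<Rightarrow> rat" where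
  "hval n \<kappa> q = \<kappa> (ga_mult n (fst q) (SOME z. z \<in> snd q))"

definition feval :: "nat \<Rightarrow> (ga \<Rightarrow> rat) \<Rightarrow> (tpair \<Rightarrow> int) \<Rightarrow> rat" where
  "feval n \<kappa> F = (\<Sum>q\<in>{q. F q \<noteq> 0}. of_int (F q) * hval n \<kappa> q)"

lemma feval_superset:
  "finite S \<Longrightarrow> {q. F q \<noteq> 0} \<subseteq> S \<Longrightarrow> feval n \<kappa> F = (\<Sum>q\<in>S. of_int (F q) * hval n \<kappa> q)"
  unfolding feval_def by (rule sum.mono_neutral_left) auto

lemma feval_add:
  assumes "F \<in> fcar p n lam" "G \<in> fcar p n lam" shows "feval n \<kappa> (F + G) = feval n \<kappa> F + feval n \<kappa> G"
proof -
  let ?S = "{q. F q \<noteq> 0} \<union> {q. G q \<noteq> 0}"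
  have S: "finite ?S" using assms by (simp add: fcar_iff)
  have "feval n \<kappa> (F + G) = (\<Sum>q\<in>?S. of_int ((F + G) q) * hval n \<kappa> q)" by (rule feval_superset[OF S]) auto
  also have "\<dots> = (\<Sum>q\<in>?S. of_int (F q) * hval n \<kappa> q) + (\<Sum>q\<in>?S. of_int (G q) * hval n \<kappa> q)"
    by (simp add: algebra_simps flip: sum.distrib)
  also have "\<dots> = feval n \<kappa> F + feval n \<kappa> G"
    using feval_superset[OF S, of F n \<kappa>] feval_superset[OF S, of G n \<kappa>] by simp
  finally show ?thesis .
qed

lemma feval_neg: "feval n \<kappa> (- F) = - feval n \<kappa> F"
  by (simp add: feval_def sum_negf)

lemma feval_diff: "F \<in> fcar p n lam \<Longrightarrow> G \<in> fcar p n lam \<Longrightarrow> feval n \<kappa> (F - G) = feval n \<kappa> F - feval n \<kappa> G"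
  using feval_add[of F p n lam "- G" \<kappa>] fcar_neg[of G p n lam] by (simp add: feval_neg)

lemma feval_tdelta: "feval n \<kappa> (tdelta q) = hval n \<kappa> q"
  by (subst feval_superset[where S="{q}"]) (auto simp: tdelta_def)

lemma feval_0: "feval n \<kappa> 0 = 0"
  by (simp add: feval_def)

lemma hval_gcls:
  assumes p: "prime p" and \<kappa>: "balanced p n lam \<kappa>" and a: "a \<in> GA p n" and z: "z \<in> GZ p n"
  shows "hval n \<kappa> (a, gcls p n lam z) = \<kappa> (ga_mult n a z)"
proof -
  define i where "i = (SOME y. y \<in> gcls p n lam z) - z"
  have i: "i \<in> Ilam p n lam" unfolding i_def by (rule additive_quotient.some_coset[OF Ilam_quotient[OF p]])
  have "hval n \<kappa> (a, gcls p n lam z) = \<kappa> (ga_mult n a (z + i))" by (simp add: hval_def i_def)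
  also have "\<dots> = \<kappa> (ga_mult n a z) + \<kappa> (ga_mult n a i)"
    unfolding ga_mult_add_right
    by (rule balanced_D(2)[OF \<kappa> GA_mult[OF p a GZ_GA[OF p z]] GA_mult[OF p a GZ_GA[OF p Ilam_GZ[OF p i]]]])
  also have "\<dots> = \<kappa> (ga_mult n a z)" using balanced_Ilam[OF p \<kappa> i a] by simp
  finally show ?thesis .
qed

lemma feval_tens_rel:
  assumes p: "prime p" and \<kappa>: "balanced p n lam \<kappa>" and F: "F \<in> tens_rel p n lam"
  shows "feval n \<kappa> F = 0"
  using F
proof (induction rule: tens_rel.induct)
  case (rel_l a a' Y)
  then obtain z where z: "z \<in> GZ p n" "Y = gcls p n lam z" unfolding one_lam_car by blast
  have aa: "a + a' \<in> GA p n" by (rule rsub_add[OF GA_rsub[OF p] rel_l(1,2)])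
  have "feval n \<kappa> (tdelta (a + a', Y) - tdelta (a, Y) - tdelta (a', Y)) =
      hval n \<kappa> (a + a', Y) - hval n \<kappa> (a, Y) - hval n \<kappa> (a', Y)"
    using rel_l aa by (simp only: feval_diff[where p=p and lam=lam] fcar_diff fcar_tdelta feval_tdelta)
  also have "\<dots> = 0"
    unfolding z(2) hval_gcls[OF p \<kappa> aa z(1)] hval_gcls[OF p \<kappa> rel_l(1) z(1)] hval_gcls[OF p \<kappa> rel_l(2) z(1)]
      ga_mult_add_left balanced_D(2)[OF \<kappa> GA_mult[OF p rel_l(1) GZ_GA[OF p z(1)]] GA_mult[OF p rel_l(2) GZ_GA[OF p z(1)]]]
    by simp
  finally show ?case by (simp only: fun_diff_def ga_add_eq)
next
  case (rel_r a Y Z)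
  then obtain z z' where z: "z \<in> GZ p n" "Y = gcls p n lam z" "z' \<in> GZ p n" "Z = gcls p n lam z'"
    unfolding one_lam_car by blast
  have zz: "z + z' \<in> GZ p n" by (rule rsub_add[OF GZ_rsub[OF p] z(1,3)])
  have "feval n \<kappa> (tdelta (a, madd (one_lam p n lam) Y Z) - tdelta (a, Y) - tdelta (a, Z)) =
      hval n \<kappa> (a, madd (one_lam p n lam) Y Z) - hval n \<kappa> (a, Y) - hval n \<kappa> (a, Z)"
    using rel_r one_lam_closed[OF p] by (simp only: feval_diff[where p=p and lam=lam] fcar_diff fcar_tdelta feval_tdelta)
  also have "\<dots> = 0"
    unfolding z(2,4) one_lam_madd[OF p] hval_gcls[OF p \<kappa> rel_r(1) zz] hval_gcls[OF p \<kappa> rel_r(1) z(1)]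
      hval_gcls[OF p \<kappa> rel_r(1) z(3)] ga_mult_add_right
      balanced_D(2)[OF \<kappa> GA_mult[OF p rel_r(1) GZ_GA[OF p z(1)]] GA_mult[OF p rel_r(1) GZ_GA[OF p z(3)]]]
    by simp
  finally show ?case by (simp only: fun_diff_def)
next
  case (rel_bal a b Y)
  then obtain z where z: "z \<in> GZ p n" "Y = gcls p n lam z" unfolding one_lam_car by blast
  have ab: "ga_mult n a b \<in> GA p n" by (rule GA_mult[OF p rel_bal(1) GZ_GA[OF p rel_bal(2)]])
  have "feval n \<kappa> (tdelta (ga_mult n a b, Y) - tdelta (a, mact (one_lam p n lam) b Y)) =
      hval n \<kappa> (ga_mult n a b, Y) - hval n \<kappa> (a, mact (one_lam p n lam) b Y)"
    using rel_bal ab one_lam_closed[OF p] by (simp only: feval_diff[where p=p and lam=lam] fcar_diff fcar_tdelta feval_tdelta)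
  also have "\<dots> = 0"
    unfolding z(2) one_lam_mact[OF p rel_bal(2)] hval_gcls[OF p \<kappa> ab z(1)]
      hval_gcls[OF p \<kappa> rel_bal(1) GZ_mult[OF rel_bal(2) z(1)]] ga_mult_assoc by simp
  finally show ?case by (simp only: fun_diff_def)
next
  case rel_zero show ?case using feval_0[of n \<kappa>] by (simp only: zero_fun_def)
next
  case (rel_add F G)
  then show ?case unfolding fs_add_eq feval_add[OF tens_rel_fcar[OF p rel_add(1)] tens_rel_fcar[OF p rel_add(2)]] by simp
next
  case (rel_neg F)
  then show ?case using feval_neg[of n \<kappa> F] by (simp add: fun_Compl_def)
qed

text \<open>Converse of \<open>Dual_balanced\<close>: the integer-linear extension of
  \<open>hval\<close> kills all tensor relations and descends to the quotient.\<close>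

lemma Dual_exists:
  assumes p: "prime p" and \<kappa>: "balanced p n lam \<kappa>"
  shows "\<exists>\<phi>\<in>Dual p n lam. \<forall>a\<in>GA p n. \<phi> (tens1 p n lam a) = \<kappa> a"
proof -
  define \<phi> where "\<phi> m = (if m \<in> mcar (TM p n lam) then feval n \<kappa> (SOME F. F \<in> m) else 0)" for m
  have \<phi>: "\<phi> (tcls p n lam F) = feval n \<kappa> F" if F: "F \<in> fcar p n lam" for F
  proof -
    define G where "G = (SOME G. G \<in> tcls p n lam F) - F"
    have G: "G \<in> tens_rel p n lam" unfolding G_def by (rule additive_quotient.some_coset[OF tensor_quotient])
    have "tcls p n lam F \<in> mcar (TM p n lam)" unfolding tensor_car using F by (rule imageI)
    then have "\<phi> (tcls p n lam F) = feval n \<kappa> (F + G)" unfolding \<phi>_def G_def by simp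
    also have "\<dots> = feval n \<kappa> F"
      unfolding feval_add[OF F tens_rel_fcar[OF p G]] using feval_tens_rel[OF p \<kappa> G] by simp
    finally show ?thesis .
  qed
  have Rl: "feval n \<kappa> F \<in> Rloc p" if "F \<in> fcar p n lam" for F
    using that
  proof (induction rule: fcar_induct)
    case (tdelta a Y)
    then obtain z where z: "z \<in> GZ p n" "Y = gcls p n lam z" unfolding one_lam_car by blast
    show ?case unfolding feval_tdelta z(2) hval_gcls[OF p \<kappa> tdelta(1) z(1)]
      by (rule balanced_D(1)[OF \<kappa> GA_mult[OF p tdelta(1) GZ_GA[OF p z(1)]]])
  qed (simp_all only: feval_0 feval_add[where p=p and lam=lam] feval_neg Rloc_0 Rloc_add Rloc_minus p)
  have sc: "feval n \<kappa> (push p n lam (ga_scal r) F) = r * feval n \<kappa> F" if r: "r \<in> Rloc p" and F: "F \<in> fcar p n lam" for r F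
    using F
  proof (induction rule: fcar_induct)
    case zero show ?case unfolding push_0 feval_0 by simp
  next
    case (add F G)
    note c = push_fcar[OF p GA_scal[OF p r] add(1)] push_fcar[OF p GA_scal[OF p r] add(2)]
    show ?case unfolding push_add[OF add(1,2)] feval_add[OF c] feval_add[OF add(1,2)] add(3,4) by (simp add: algebra_simps)
  next
    case (neg F) then show ?case unfolding push_neg[OF neg(1)] feval_neg by simp
  next
    case (tdelta a Y)
    then obtain z where z: "z \<in> GZ p n" "Y = gcls p n lam z" unfolding one_lam_car by blast
    show ?case
      unfolding push_tdelta feval_tdelta z(2) hval_gcls[OF p \<kappa> tdelta(1) z(1)] GA_scal_mult(1)[OF tdelta(1)]
        hval_gcls[OF p \<kappa> rsub_smult[OF GA_rsub[OF p] r tdelta(1)] z(1)] ga_mult_smult_left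
      by (rule balanced_D(3)[OF \<kappa> r GA_mult[OF p tdelta(1) GZ_GA[OF p z(1)]]])
  qed
  have "\<phi> \<in> Dual p n lam"
    unfolding dual_set_def mem_Collect_eq
  proof (intro conjI allI ballI impI)
    show "\<phi> m = 0" if "m \<notin> mcar (TM p n lam)" for m using that by (simp add: \<phi>_def)
    show "\<phi> m \<in> Rloc p" if "m \<in> mcar (TM p n lam)" for m using that \<phi> Rl unfolding tensor_car by auto
    show "\<phi> (madd (TM p n lam) m m') = \<phi> m + \<phi> m'" if "m \<in> mcar (TM p n lam)" "m' \<in> mcar (TM p n lam)" for m m'
    proof -
      obtain F G where FG: "F \<in> fcar p n lam" "G \<in> fcar p n lam" "m = tcls p n lam F" "m' = tcls p n lam G"
        using \<open>m \<in> _\<close> \<open>m' \<in> _\<close> unfolding tensor_car by blast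
      show ?thesis unfolding FG(3,4) tensor_madd \<phi>[OF fcar_add[OF FG(1,2)]] \<phi>[OF FG(1)] \<phi>[OF FG(2)] by (rule feval_add[OF FG(1,2)])
    qed
    show "\<phi> (mact (TM p n lam) (ga_scal r) m) = r * \<phi> m" if r: "r \<in> Rloc p" and m: "m \<in> mcar (TM p n lam)" for r m
    proof -
      obtain F where F: "F \<in> fcar p n lam" "m = tcls p n lam F" using m unfolding tensor_car by blast
      note c = push_fcar[OF p GA_scal[OF p r] F(1)]
      show ?thesis unfolding F(2) tensor_mact[OF p GA_scal[OF p r] F(1)] \<phi>[OF c] \<phi>[OF F(1)] by (rule sc[OF r F(1)])
    qed
  qed
  moreover have "\<phi> (tens1 p n lam a) = \<kappa> a" if a: "a \<in> GA p n" for a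
  proof -
    have "ga_mult n a (ga_scal 1) = a" unfolding GA_scal_mult(2)[OF a] by (rule ext) simp
    then show ?thesis
      unfolding tens1_def \<phi>[OF fcar_tdelta[OF a one1_in]] feval_tdelta hval_gcls[OF p \<kappa> a GZ_one] by (simp only:)
  qed
  ultimately show ?thesis by blast
qed

text \<open>The coefficients of a x_lambda modulo the ideal are unique, hence linear in a, and
  \<open>JM_xlam\<close> makes them balanced. They supply the dual basis of the final
  argument.\<close>

lemma coordinates:
  assumes p: "prime p" and lam: "is_partition n lam"
  shows "\<exists>\<kappa>. (\<forall>u\<in>lwords n lam. balanced p n lam (\<kappa> u)) \<and> (\<forall>a\<in>GA p n.
      ga_mult n a (xlam n lam) - (\<Sum>u\<in>lwords n lam. ga_smult (\<kappa> u a) (rmatch n u (tword n lam))) \<in> dom_ideal p n lam)"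
proof -
  let ?S = "\<lambda>r. \<Sum>f\<in>lwords n lam. ga_smult (r f) (rmatch n f (tword n lam))"
  note JJ = dom_ideal_rsub[OF p, of n lam] and G = GA_rsub[OF p, of n]
  obtain R where R: "\<And>a. a \<in> GA p n \<Longrightarrow> (\<forall>f. R a f \<in> Rloc p) \<and> ga_mult n a (xlam n lam) - ?S (R a) \<in> dom_ideal p n lam"
    using lwords_spanning[OF p lam] by metis
  have unique: "R a u = r u" if a: "a \<in> GA p n" and r: "ga_mult n a (xlam n lam) - ?S r \<in> dom_ideal p n lam" and u: "u \<in> lwords n lam" for a r u
  proof -
    have "(ga_mult n a (xlam n lam) - ?S r) - (ga_mult n a (xlam n lam) - ?S (R a)) = ?S (\<lambda>f. R a f - r f)"
      by (rule ext) (simp add: sum_fun_apply algebra_simps sum_subtractf)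
    then have "?S (\<lambda>f. R a f - r f) \<in> dom_ideal p n lam" using rsub_diff[OF p JJ r conjunct2[OF R[OF a]]] by (simp only:)
    then have "\<forall>f\<in>lwords n lam. R a f - r f = 0" by (intro lwords_independent[OF lam] cpair_dom_ideal[OF lam])
    then show ?thesis using u by simp
  qed
  have "balanced p n lam (\<lambda>a. R a u)" if u: "u \<in> lwords n lam" for u
    unfolding balanced_def
  proof (intro conjI ballI)
    fix a assume a: "a \<in> GA p n"
    show "R a u \<in> Rloc p" using R[OF a] by blast
    show "R (a + b) u = R a u + R b u" if b: "b \<in> GA p n" for b
    proof (rule unique[OF rsub_add[OF G a b] _ u])
      have "(ga_mult n a (xlam n lam) - ?S (R a)) + (ga_mult n b (xlam n lam) - ?S (R b)) =
        ga_mult n (a + b) (xlam n lam) - ?S (\<lambda>f. R a f + R b f)"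
        unfolding ga_mult_add_left by (rule ext) (simp add: sum_fun_apply algebra_simps sum.distrib)
      then show "ga_mult n (a + b) (xlam n lam) - ?S (\<lambda>f. R a f + R b f) \<in> dom_ideal p n lam"
        using rsub_add[OF JJ conjunct2[OF R[OF a]] conjunct2[OF R[OF b]]] by (simp only:)
    qed
    have smult: "ga_smult r (ga_mult n a (xlam n lam)) - ?S (\<lambda>f. r * R a f) \<in> dom_ideal p n lam" if r: "r \<in> Rloc p" for r
    proof -
      have "ga_smult r (ga_mult n a (xlam n lam) - ?S (R a)) = ga_smult r (ga_mult n a (xlam n lam)) - ?S (\<lambda>f. r * R a f)"
        by (rule ext) (simp add: sum_fun_apply algebra_simps sum_distrib_left)
      then show ?thesis using rsub_smult[OF JJ r conjunct2[OF R[OF a]]] by (simp only:)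
    qed
    show "R (ga_smult r a) u = r * R a u" if r: "r \<in> Rloc p" for r
      by (rule unique[OF rsub_smult[OF G r a] _ u]) (use smult[OF r] in \<open>simp only: ga_mult_smult_left\<close>)
    fix k assume k: "k \<in> {1..n}"
    let ?c = "of_int (content lam k) :: rat"
    show "R (ga_mult n a (JM k)) u = ?c * R a u"
    proof (rule unique[OF GA_mult[OF p a GA_JM[OF p k]] _ u])
      have 1: "ga_mult n a (ga_mult n (JM k) (xlam n lam) - ga_smult ?c (xlam n lam)) \<in> dom_ideal p n lam"
        by (rule dom_ideal_left[OF p a JM_xlam[OF p lam k]])
      have "ga_mult n a (ga_mult n (JM k) (xlam n lam) - ga_smult ?c (xlam n lam))
          + (ga_smult ?c (ga_mult n a (xlam n lam)) - ?S (\<lambda>f. ?c * R a f))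
        = ga_mult n (ga_mult n a (JM k)) (xlam n lam) - ?S (\<lambda>f. ?c * R a f)"
        unfolding ga_mult_diff_right ga_mult_smult_right ga_mult_assoc by simp
      then show "ga_mult n (ga_mult n a (JM k)) (xlam n lam) - ?S (\<lambda>f. ?c * R a f) \<in> dom_ideal p n lam"
        using rsub_add[OF JJ 1 smult[OF Rloc_of_int[OF p, of "content lam k"]]] by (simp only:)
    qed
  qed
  then show ?thesis using R by (intro exI[of _ "\<lambda>u a. R a u"]) blast
qed

lemma Dual_mact:
  "mact (dual_mod p (TM p n lam)) a f = (\<lambda>m. if m \<in> mcar (TM p n lam) then f (mact (TM p n lam) a m) else 0)"
  by (simp add: dual_mod_def)

lemma tensor_mact_closed:
  "prime p \<Longrightarrow> a \<in> GA p n \<Longrightarrow> m \<in> mcar (TM p n lam) \<Longrightarrow> mact (TM p n lam) a m \<in> mcar (TM p n lam)"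
  unfolding tensor_car using tensor_mact push_fcar by fastforce

lemma Dual_mact_closed:
  assumes p: "prime p" and a: "a \<in> GA p n" and f: "f \<in> Dual p n lam"
  shows "mact (dual_mod p (TM p n lam)) a f \<in> Dual p n lam"
  unfolding dual_set_def mem_Collect_eq Dual_mact
proof (intro conjI allI ballI impI)
  let ?T = "TM p n lam"
  let ?h = "\<lambda>m. if m \<in> mcar ?T then f (mact ?T a m) else 0"
  note closed = tensor_mact_closed[OF p, where lam=lam]
  show "?h m = 0" if "m \<notin> mcar ?T" for m using that by simp
  show "?h m \<in> Rloc p" if "m \<in> mcar ?T" for m using Dual_D(2)[OF f closed[OF a that]] that by simp
  show "?h (madd ?T m m') = ?h m + ?h m'" if m: "m \<in> mcar ?T" "m' \<in> mcar ?T" for m m'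
  proof -
    obtain F G where FG: "F \<in> fcar p n lam" "G \<in> fcar p n lam" "m = tcls p n lam F" "m' = tcls p n lam G"
      using m unfolding tensor_car by blast
    note c = fcar_add[OF FG(1,2)]
    have "madd ?T m m' \<in> mcar ?T" unfolding FG(3,4) tensor_madd unfolding tensor_car by (rule imageI[OF c])
    moreover have "f (mact ?T a (madd ?T m m')) = f (mact ?T a m) + f (mact ?T a m')"
      unfolding FG(3,4) tensor_madd tensor_mact[OF p a c] tensor_mact[OF p a FG(1)] tensor_mact[OF p a FG(2)]
        push_add[OF FG(1,2)]
      by (rule Dual_tcls_add[OF f push_fcar[OF p a FG(1)] push_fcar[OF p a FG(2)]])
    ultimately show ?thesis using m by simp
  qed
  show "?h (mact ?T (ga_scal r) m) = r * ?h m" if r: "r \<in> Rloc p" and m: "m \<in> mcar ?T" for r m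
  proof -
    obtain F where F: "F \<in> fcar p n lam" "m = tcls p n lam F" using m unfolding tensor_car by blast
    note s = GA_scal[OF p r]
    \<comment> \<open>Scalars are central in RS_n.\<close>
    have "mact ?T a (mact ?T (ga_scal r) m) = mact ?T (ga_scal r) (mact ?T a m)"
      unfolding F(2) tensor_mact[OF p s F(1)] tensor_mact[OF p a F(1)] tensor_mact[OF p a push_fcar[OF p s F(1)]]
        tensor_mact[OF p s push_fcar[OF p a F(1)]] push_comp[OF p s F(1)] push_comp[OF p a F(1)] GA_scal_mult[OF a] ..
    then show ?thesis using Dual_D(4)[OF f r closed[OF a m]] closed[OF s m] m by simp
  qed
qed

lemma Dual_mact_tens1:
  assumes "prime p" "r \<in> GA p n" "a \<in> GA p n"
  shows "mact (dual_mod p (TM p n lam)) r f (tens1 p n lam a) = f (tens1 p n lam (ga_mult n r a))"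
  using tens1_in[OF assms(3)] tens1_mact[OF assms] by (simp add: Dual_mact)

lemma Dual_mact_scal:
  assumes "f \<in> Dual p n lam" "r \<in> Rloc p"
  shows "mact (dual_mod p (TM p n lam)) (ga_scal r) f = (\<lambda>m. r * f m)"
  using Dual_D(1,4)[OF assms(1)] assms(2) by (auto simp: Dual_mact fun_eq_iff)

lemma Dual_lincomb:
  assumes p: "prime p" and f: "\<And>u. u \<in> U \<Longrightarrow> f u \<in> Dual p n lam" and r: "\<And>u. u \<in> U \<Longrightarrow> r u \<in> Rloc p"
  shows "(\<lambda>m. \<Sum>u\<in>U. r u * f u m) \<in> Dual p n lam"
  unfolding dual_set_def mem_Collect_eq
proof (intro conjI allI ballI impI)
  show "(\<Sum>u\<in>U. r u * f u m) = 0" if "m \<notin> mcar (TM p n lam)" for m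
    using Dual_D(1)[OF f that] by (intro sum.neutral) simp
  show "(\<Sum>u\<in>U. r u * f u m) \<in> Rloc p" if "m \<in> mcar (TM p n lam)" for m
    using Dual_D(2)[OF f that] r by (intro Rloc_sum[OF p] Rloc_mult[OF p])
  show "(\<Sum>u\<in>U. r u * f u (madd (TM p n lam) m m')) = (\<Sum>u\<in>U. r u * f u m) + (\<Sum>u\<in>U. r u * f u m')"
    if "m \<in> mcar (TM p n lam)" "m' \<in> mcar (TM p n lam)" for m m'
    unfolding sum.distrib[symmetric] using Dual_D(3)[OF f that] by (intro sum.cong refl) (simp add: algebra_simps)
  show "(\<Sum>u\<in>U. r u * f u (mact (TM p n lam) (ga_scal s) m)) = s * (\<Sum>u\<in>U. r u * f u m)"
    if "s \<in> Rloc p" "m \<in> mcar (TM p n lam)" for s m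
    unfolding sum_distrib_left using Dual_D(4)[OF f that] by (intro sum.cong refl) (simp add: algebra_simps)
qed

section \<open>The bidual\<close>

text \<open>The scalars of \<open>dual_mod\<close> act by precomposition; on a functional this is
  pointwise multiplication.\<close>

lemma Ind_car: "\<Phi> \<in> mcar (Ind p n lam) \<longleftrightarrow>
    (\<forall>f. f \<notin> Dual p n lam \<longrightarrow> \<Phi> f = 0) \<and> (\<forall>f\<in>Dual p n lam. \<Phi> f \<in> Rloc p)
    \<and> (\<forall>f\<in>Dual p n lam. \<forall>g\<in>Dual p n lam. \<Phi> (\<lambda>m. f m + g m) = \<Phi> f + \<Phi> g)
    \<and> (\<forall>r\<in>Rloc p. \<forall>f\<in>Dual p n lam. \<Phi> (\<lambda>m. r * f m) = r * \<Phi> f)"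
proof -
  have car: "mcar (dual_mod p (TM p n lam)) = Dual p n lam" "madd (dual_mod p (TM p n lam)) = (\<lambda>f g m. f m + g m)"
    by (simp_all add: dual_mod_def)
  have "mcar (Ind p n lam) = dual_set p (dual_mod p (TM p n lam))" by (simp add: Ind_def Fr_def)
  then show ?thesis unfolding dual_set_def[of p "dual_mod p (TM p n lam)"] car by (simp add: Dual_mact_scal cong: ball_cong)
qed

lemma Ind_lincomb:
  assumes p: "prime p" and \<Phi>: "\<Phi> \<in> mcar (Ind p n lam)" and U: "finite U"
    and f: "\<And>u. u \<in> U \<Longrightarrow> f u \<in> Dual p n lam" and r: "\<And>u. u \<in> U \<Longrightarrow> r u \<in> Rloc p"
  shows "\<Phi> (\<lambda>m. \<Sum>u\<in>U. r u * f u m) = (\<Sum>u\<in>U. r u * \<Phi> (f u))"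
  using U f r
proof (induction U rule: finite_induct)
  case empty
  have z: "(\<lambda>m. 0) \<in> Dual p n lam" using Dual_lincomb[OF p, of "{}"] by simp
  have "\<forall>r\<in>Rloc p. \<forall>f\<in>Dual p n lam. \<Phi> (\<lambda>m. r * f m) = r * \<Phi> f" using \<Phi> unfolding Ind_car by blast
  from bspec[OF bspec[OF this Rloc_0[OF p]] z] show ?case by simp
next
  case (insert u U)
  have u: "f u \<in> Dual p n lam" "r u \<in> Rloc p" using insert.prems by auto
  have 1: "(\<lambda>m. r u * f u m) \<in> Dual p n lam" using Dual_lincomb[OF p, of "{u}" f n lam r] u by simp
  have 2: "(\<lambda>m. \<Sum>u\<in>U. r u * f u m) \<in> Dual p n lam" using insert.prems by (intro Dual_lincomb[OF p]) auto
  have "\<Phi> (\<lambda>m. (\<lambda>m. r u * f u m) m + (\<lambda>m. \<Sum>u\<in>U. r u * f u m) m) = \<Phi> (\<lambda>m. r u * f u m) + \<Phi> (\<lambda>m. \<Sum>u\<in>U. r u * f u m)"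
  proof -
    have "\<forall>f\<in>Dual p n lam. \<forall>g\<in>Dual p n lam. \<Phi> (\<lambda>m. f m + g m) = \<Phi> f + \<Phi> g" using \<Phi> unfolding Ind_car by blast
    from bspec[OF bspec[OF this 1] 2] show ?thesis .
  qed
  moreover have "\<Phi> (\<lambda>m. r u * f u m) = r u * \<Phi> (f u)"
  proof -
    have "\<forall>r\<in>Rloc p. \<forall>f\<in>Dual p n lam. \<Phi> (\<lambda>m. r * f m) = r * \<Phi> f" using \<Phi> unfolding Ind_car by blast
    from bspec[OF bspec[OF this u(2)] u(1)] show ?thesis .
  qed
  moreover have "\<Phi> (\<lambda>m. \<Sum>u\<in>U. r u * f u m) = (\<Sum>u\<in>U. r u * \<Phi> (f u))" using insert by auto
  ultimately show ?case using insert.hyps by simp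
qed

section \<open>The cell module\<close>

text \<open>The summand from the ideal in the carrier disappears in the quotient, so every class has
  this form, see \<open>Cell_car\<close>.\<close>

abbreviation ccls :: "nat \<Rightarrow> nat \<Rightarrow> nat list \<Rightarrow> ga \<Rightarrow> ga set" where
  "ccls p n lam a \<equiv> coset (cell_ambient p n lam) (ideal_above p n lam) (ga_mult n a (xlam n lam))"

lemma cell_quotient:
  assumes p: "prime p" and lam: "is_partition n lam"
  shows "additive_quotient (cell_ambient p n lam) (ideal_above p n lam)"
  unfolding ideal_above_eq_dom_ideal[OF p lam]
proof
  show "madd (cell_ambient p n lam) = (+)" by (auto simp: cell_ambient_def ga_add_eq fun_eq_iff)
qed (use dom_ideal_rsub[OF p] in \<open>auto intro: rsub_0 rsub_add rsub_uminus[OF p]\<close>)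

lemma ccls_eq_iff:
  assumes "prime p" "is_partition n lam"
  shows "ccls p n lam a = ccls p n lam b \<longleftrightarrow> ga_mult n (a - b) (xlam n lam) \<in> dom_ideal p n lam"
  using additive_quotient.coset_eq_iff[OF cell_quotient[OF assms]]
  by (simp only: ga_mult_diff_left ideal_above_eq_dom_ideal[OF assms])

lemma Cell_car:
  assumes p: "prime p" and lam: "is_partition n lam"
  shows "mcar (Cell p n lam) = ccls p n lam ` GA p n"
proof -
  have "coset (cell_ambient p n lam) (ideal_above p n lam) (ga_add (ga_mult n c (xlam n lam)) b) = ccls p n lam c"
    if "b \<in> ideal_above p n lam" for b c
    unfolding additive_quotient.coset_eq_iff[OF cell_quotient[OF p lam]] ga_add_eq using that by simp
  moreover have "0 \<in> ideal_above p n lam" by (rule additive_quotient.N_0[OF cell_quotient[OF p lam]])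
  moreover have "mcar (cell_ambient p n lam) = {ga_add (ga_mult n c (xlam n lam)) b | c b. c \<in> GA p n \<and> b \<in> ideal_above p n lam}"
    by (simp add: cell_ambient_def)
  ultimately show ?thesis unfolding Cell_def mcar_quot by (auto simp: image_iff)
qed

lemma Cell_madd:
  assumes p: "prime p" and lam: "is_partition n lam"
  shows "madd (Cell p n lam) (ccls p n lam a) (ccls p n lam b) = ccls p n lam (a + b)"
  unfolding Cell_def additive_quotient.quot_madd[OF cell_quotient[OF p lam]] ga_mult_add_left ..

lemma Cell_mact:
  assumes p: "prime p" and lam: "is_partition n lam" and r: "r \<in> GA p n"
  shows "mact (Cell p n lam) r (ccls p n lam a) = ccls p n lam (ga_mult n r a)"
proof -
  have m: "mact (cell_ambient p n lam) = ga_mult n" by (simp add: cell_ambient_def)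
  have "mact (quot_mod (cell_ambient p n lam) (ideal_above p n lam)) r (ccls p n lam a) =
    coset (cell_ambient p n lam) (ideal_above p n lam) (mact (cell_ambient p n lam) r (ga_mult n a (xlam n lam)))"
  proof (rule additive_quotient.quot_mact[OF cell_quotient[OF p lam]])
    fix y assume "y - ga_mult n a (xlam n lam) \<in> ideal_above p n lam"
    then show "mact (cell_ambient p n lam) r y - mact (cell_ambient p n lam) r (ga_mult n a (xlam n lam))
      \<in> ideal_above p n lam"
      unfolding m ideal_above_eq_dom_ideal[OF p lam] ga_mult_diff_right[symmetric] by (rule dom_ideal_left[OF p r])
  qed
  then show ?thesis unfolding m by (simp only: Cell_def ga_mult_assoc)
qed

text \<open>The natural map goes from the cell module to the bidual, opposite to the isomorphism
  asked for.\<close>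

lemma lmod_iso_from_inverse:
  assumes bij: "bij_betw g (mcar N) (mcar M)"
    and add: "\<And>x y. x \<in> mcar N \<Longrightarrow> y \<in> mcar N \<Longrightarrow> madd N x y \<in> mcar N \<and> g (madd N x y) = madd M (g x) (g y)"
    and act: "\<And>a x. a \<in> GA p n \<Longrightarrow> x \<in> mcar N \<Longrightarrow> mact N a x \<in> mcar N \<and> g (mact N a x) = mact M a (g x)"
  shows "lmod_iso p n M N"
  unfolding lmod_iso_def
proof (intro exI conjI ballI)
  let ?f = "inv_into (mcar N) g"
  note fb = bij_betw_inv_into[OF bij] and fg = bij_betw_inv_into_left[OF bij] and gf = bij_betw_inv_into_right[OF bij]
  show "bij_betw ?f (mcar M) (mcar N)" by (rule fb)
  show "?f (madd M x y) = madd N (?f x) (?f y)" if "x \<in> mcar M" "y \<in> mcar M" for x y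
  proof -
    note a = add[OF bij_betw_apply[OF fb that(1)] bij_betw_apply[OF fb that(2)]]
    show ?thesis using fg[OF conjunct1[OF a]] conjunct2[OF a] gf[OF that(1)] gf[OF that(2)] by simp
  qed
  show "?f (mact M a x) = mact N a (?f x)" if "a \<in> GA p n" "x \<in> mcar M" for a x
  proof -
    note b = act[OF that(1) bij_betw_apply[OF fb that(2)]]
    show ?thesis using fg[OF conjunct1[OF b]] conjunct2[OF b] gf[OF that(2)] by simp
  qed
qed

theorem mainTheorem10:
  fixes p n :: nat and lam :: "nat list"
  assumes "prime p" and "is_partition n lam"
  shows "lmod_iso p n (Ind p n lam) (Cell p n lam)"
proof -
  note p = assms(1) and lam = assms(2)
  note G = GA_rsub[OF p, of n]
  let ?D = "Dual p n lam" and ?tens1 = "tens1 p n lam" and ?C = "ccls p n lam"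
  \<comment> \<open>The class of a x_lambda goes to evaluation at a \<otimes> 1, independently of a
    by \<open>balanced_vanishes\<close>. Elements of a \<open>dual_set\<close> are 0 off their
    domain, whence the default value.\<close>
  define g where "g C = (\<lambda>\<phi>. if \<phi> \<in> ?D then \<phi> (?tens1 (SOME a. a \<in> GA p n \<and> ?C a = C)) else 0)" for C
  have g: "g (?C a) = (\<lambda>\<phi>. if \<phi> \<in> ?D then \<phi> (?tens1 a) else 0)" if a: "a \<in> GA p n" for a
  proof -
    define b where "b = (SOME b. b \<in> GA p n \<and> ?C b = ?C a)"
    have b: "b \<in> GA p n" "?C b = ?C a" unfolding b_def using someI[of "\<lambda>b. b \<in> GA p n \<and> ?C b = ?C a" a] a by auto
    have ba: "b - a \<in> GA p n" by (rule rsub_diff[OF p G b(1) a])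
    have "ga_mult n (b - a) (xlam n lam) \<in> dom_ideal p n lam" using b(2) unfolding ccls_eq_iff[OF p lam] .
    then have "\<phi> (?tens1 b) = \<phi> (?tens1 a)" if "\<phi> \<in> ?D" for \<phi>
      using balanced_vanishes[OF p lam Dual_balanced[OF p that] ba] balanced_D(2)[OF Dual_balanced[OF p that] ba a] by simp
    then show ?thesis unfolding g_def b_def[symmetric] by auto
  qed
  obtain \<kappa> where \<kappa>: "\<And>u. u \<in> lwords n lam \<Longrightarrow> balanced p n lam (\<kappa> u)"
    and \<kappa>J: "\<And>a. a \<in> GA p n \<Longrightarrow>
      ga_mult n a (xlam n lam) - (\<Sum>u\<in>lwords n lam. ga_smult (\<kappa> u a) (rmatch n u (tword n lam))) \<in> dom_ideal p n lam"
    using coordinates[OF p lam] by blast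
  \<comment> \<open>The f u form the dual basis, and the b u lift the standard basis of the cell
    module to RS_n.\<close>
  obtain f where f: "\<And>u. u \<in> lwords n lam \<Longrightarrow> f u \<in> ?D"
    and f_tens1: "\<And>u a. u \<in> lwords n lam \<Longrightarrow> a \<in> GA p n \<Longrightarrow> f u (?tens1 a) = \<kappa> u a"
    using Dual_exists[OF p \<kappa>] by metis
  obtain b where b: "\<And>u. u \<in> lwords n lam \<Longrightarrow> b u \<in> GA p n"
    and b_rmatch: "\<And>u. u \<in> lwords n lam \<Longrightarrow> rmatch n u (tword n lam) = ga_mult n (b u) (xlam n lam)"
  proof -
    have "\<exists>b. b \<in> GA p n \<and> rmatch n u (tword n lam) = ga_mult n b (xlam n lam)" for u
      by (rule rmatch_tword_multiple[OF p lam, of u]) blast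
    then show thesis using that by metis
  qed
  have \<kappa>R: "\<kappa> u a \<in> Rloc p" if "u \<in> lwords n lam" "a \<in> GA p n" for u a by (rule balanced_D(1)[OF \<kappa>[OF that(1)] that(2)])
  have car: "g (?C a) \<in> mcar (Ind p n lam)" if a: "a \<in> GA p n" for a
  proof -
    have "(\<lambda>m. \<phi> m + \<psi> m) \<in> ?D" if "\<phi> \<in> ?D" "\<psi> \<in> ?D" for \<phi> \<psi>
      using Dual_lincomb[OF p, of "{True, False}" "\<lambda>c. if c then \<phi> else \<psi>" n lam "\<lambda>_. 1"] that p by simp
    moreover have "(\<lambda>m. r * \<phi> m) \<in> ?D" if "\<phi> \<in> ?D" "r \<in> Rloc p" for \<phi> r
      using Dual_lincomb[OF p, of "{True}" "\<lambda>_. \<phi>" n lam "\<lambda>_. r"] that by simp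
    ultimately show ?thesis unfolding g[OF a] Ind_car using Dual_D(2)[OF _ tens1_in[OF a]] by simp
  qed
  have inj: "?C a = ?C a'" if a: "a \<in> GA p n" "a' \<in> GA p n" and eq: "g (?C a) = g (?C a')" for a a'
  proof -
    \<comment> \<open>Evaluations at the dual basis read off the coordinates.\<close>
    have "\<kappa> u a = \<kappa> u a'" if u: "u \<in> lwords n lam" for u
      using fun_cong[OF eq, of "f u"] f[OF u] f_tens1[OF u a(1)] f_tens1[OF u a(2)] unfolding g[OF a(1)] g[OF a(2)] by simp
    then have S: "(\<Sum>u\<in>lwords n lam. ga_smult (\<kappa> u a) (rmatch n u (tword n lam))) = (\<Sum>u\<in>lwords n lam. ga_smult (\<kappa> u a') (rmatch n u (tword n lam)))"
      by (intro sum.cong refl) (simp only:)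
    have "ga_mult n (a - a') (xlam n lam) \<in> dom_ideal p n lam"
      using rsub_diff[OF p dom_ideal_rsub[OF p] \<kappa>J[OF a(1)] \<kappa>J[OF a(2)]] unfolding S ga_mult_diff_left by simp
    then show ?thesis unfolding ccls_eq_iff[OF p lam] .
  qed
  have surj: "\<exists>a\<in>GA p n. \<Phi> = g (?C a)" if \<Phi>: "\<Phi> \<in> mcar (Ind p n lam)" for \<Phi>
  proof (rule bexI)
    \<comment> \<open>The candidate preimage has coordinates \<Phi> (f u) in the lifted
      basis.\<close>
    let ?a = "\<Sum>u\<in>lwords n lam. ga_smult (\<Phi> (f u)) (b u)"
    have \<Phi>R: "\<Phi> (f u) \<in> Rloc p" if "u \<in> lwords n lam" for u using \<Phi> f[OF that] unfolding Ind_car by blast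
    have sb: "ga_smult r (b u) \<in> GA p n" if "u \<in> lwords n lam" "r \<in> Rloc p" for u r
      by (rule rsub_smult[OF G that(2) b[OF that(1)]])
    show a: "?a \<in> GA p n" by (rule rsub_sum[OF G]) (rule sb[OF _ \<Phi>R])
    show "\<Phi> = g (?C ?a)"
    proof
      fix \<phi>
      show "\<Phi> \<phi> = g (?C ?a) \<phi>"
      proof (cases "\<phi> \<in> ?D")
        case \<phi>: True
        note bal = Dual_balanced[OF p \<phi>]
        have \<phi>R: "\<phi> (?tens1 (b u)) \<in> Rloc p" if "u \<in> lwords n lam" for u by (rule balanced_D(1)[OF bal b[OF that]])
        \<comment> \<open>Expansion of \<phi> in the dual basis: a minus its combination of the b u
          is carried into the ideal by x_lambda, so \<phi> vanishes on it.\<close>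
        have "\<phi> = (\<lambda>m. \<Sum>u\<in>lwords n lam. \<phi> (?tens1 (b u)) * f u m)"
        proof (rule Dual_eqI[OF p \<phi> Dual_lincomb[OF p f \<phi>R]])
          fix a assume a: "a \<in> GA p n"
          let ?s = "\<Sum>u\<in>lwords n lam. ga_smult (\<kappa> u a) (b u)"
          have s: "?s \<in> GA p n" by (rule rsub_sum[OF G]) (rule sb[OF _ \<kappa>R[OF _ a]])
          have as: "a - ?s \<in> GA p n" by (rule rsub_diff[OF p G a s])
          have "(\<Sum>u\<in>lwords n lam. ga_smult (\<kappa> u a) (rmatch n u (tword n lam))) = ga_mult n ?s (xlam n lam)"
            unfolding ga_mult_sum_left ga_mult_smult_left by (intro sum.cong refl) (simp only: b_rmatch)
          then have "ga_mult n (a - ?s) (xlam n lam) \<in> dom_ideal p n lam"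
            using \<kappa>J[OF a] unfolding ga_mult_diff_left by (simp only:)
          then have "\<phi> (?tens1 (a - ?s)) = 0" by (rule balanced_vanishes[OF p lam bal as])
          then have "\<phi> (?tens1 a) = \<phi> (?tens1 ?s)" using balanced_D(2)[OF bal as s] by simp
          also have "\<dots> = (\<Sum>u\<in>lwords n lam. \<phi> (?tens1 (ga_smult (\<kappa> u a) (b u))))"
            by (rule balanced_sum[OF p bal]) (rule sb[OF _ \<kappa>R[OF _ a]])
          also have "\<dots> = (\<Sum>u\<in>lwords n lam. \<phi> (?tens1 (b u)) * f u (?tens1 a))"
            using balanced_D(3)[OF bal \<kappa>R[OF _ a] b] f_tens1[OF _ a] by (intro sum.cong refl) simp
          finally show "\<phi> (?tens1 a) = (\<Sum>u\<in>lwords n lam. \<phi> (?tens1 (b u)) * f u (?tens1 a))" .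
        qed
        then have "\<Phi> \<phi> = \<Phi> (\<lambda>m. \<Sum>u\<in>lwords n lam. \<phi> (?tens1 (b u)) * f u m)" by (rule arg_cong)
        also have "\<dots> = (\<Sum>u\<in>lwords n lam. \<phi> (?tens1 (b u)) * \<Phi> (f u))"
          by (rule Ind_lincomb[OF p \<Phi> finite_lwords f \<phi>R])
        also have "\<dots> = (\<Sum>u\<in>lwords n lam. \<phi> (?tens1 (ga_smult (\<Phi> (f u)) (b u))))"
          using balanced_D(3)[OF bal \<Phi>R b] by (intro sum.cong refl) simp
        also have "\<dots> = \<phi> (?tens1 ?a)" by (rule balanced_sum[OF p bal, symmetric]) (rule sb[OF _ \<Phi>R])
        finally show ?thesis unfolding g[OF a] using \<phi> by simp
      next
        case False
        then show ?thesis using \<Phi> unfolding g[OF a] Ind_car by simp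
      qed
    qed
  qed
  show ?thesis
  proof (rule lmod_iso_from_inverse)
    show "bij_betw g (mcar (Cell p n lam)) (mcar (Ind p n lam))"
      unfolding bij_betw_def Cell_car[OF p lam]
    proof
      show "inj_on g (?C ` GA p n)" using inj by (auto simp: inj_on_def)
      show "g ` ?C ` GA p n = mcar (Ind p n lam)" using car surj by (auto simp: image_iff)
    qed
  next
    fix Y Z assume "Y \<in> mcar (Cell p n lam)" "Z \<in> mcar (Cell p n lam)"
    then obtain a c where ac: "a \<in> GA p n" "c \<in> GA p n" "Y = ?C a" "Z = ?C c" unfolding Cell_car[OF p lam] by blast
    note s = rsub_add[OF G ac(1,2)]
    have "madd (Ind p n lam) (g Y) (g Z) = (\<lambda>\<phi>. g Y \<phi> + g Z \<phi>)" by (simp add: Ind_def Fr_def)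
    also have "\<dots> = g (?C (a + c))"
      unfolding ac(3,4) g[OF ac(1)] g[OF ac(2)] g[OF s] using balanced_D(2)[OF Dual_balanced[OF p] ac(1,2)] by auto
    finally show "madd (Cell p n lam) Y Z \<in> mcar (Cell p n lam) \<and> g (madd (Cell p n lam) Y Z) = madd (Ind p n lam) (g Y) (g Z)"
      unfolding ac(3,4) Cell_madd[OF p lam] Cell_car[OF p lam] using s by simp
  next
    fix r Y assume r: "r \<in> GA p n" and "Y \<in> mcar (Cell p n lam)"
    then obtain a where a: "a \<in> GA p n" "Y = ?C a" unfolding Cell_car[OF p lam] by blast
    note s = GA_mult[OF p r a(1)]
    have "mact (Ind p n lam) r (g Y) = (\<lambda>\<phi>. if \<phi> \<in> ?D then g Y (mact (dual_mod p (TM p n lam)) r \<phi>) else 0)"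
      by (simp add: Ind_def Fr_def)
    also have "\<dots> = g (?C (ga_mult n r a))"
      unfolding a(2) g[OF a(1)] g[OF s] using Dual_mact_closed[OF p r] Dual_mact_tens1[OF p r a(1)] by auto
    finally show "mact (Cell p n lam) r Y \<in> mcar (Cell p n lam) \<and> g (mact (Cell p n lam) r Y) = mact (Ind p n lam) r (g Y)"
      unfolding a(2) Cell_mact[OF p lam r] Cell_car[OF p lam] using s by simp
  qed
qed

end
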